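(* Consider a two-phase composite with isotropic phases $\mathsf L_j=\sigma_j\otimes I_2+r_j\mathsf T$, $j=1,2$, where $\sigma_1,\sigma_2$ are not scalar multiples of one another, $r_1\neq r_2$ and \[ |r_1-r_2|=\big|\sqrt{\det\sigma_1}-\sqrt{\det\sigma_2}\big| . \] Let $\lambda_1,\lambda_2$ be the two roots of $\det(\sigma_2-\lambda\sigma_1)=0$ and \[ S_1=\frac{\sigma_2-\lambda_1\sigma_1}{\lambda_2-\lambda_1},\quad S_2=\frac{\sigma_2-\lambda_2\sigma_1}{\lambda_1-\lambda_2},\quad \sigma^*=\Sigma\Big(\sqrt{\lambda_2/\lambda_1}\Big),\quad \alpha=\frac{\sqrt{\det\sigma_1}-\sqrt{\det\sigma_2}}{r_1-r_2}\sqrt{\det\sigma_1}. \] Then there is a symmetric positive definite $2\times2$ matrix $L^*$, which depends on the microstructure and depends on the material moduli only through $\lambda_1$ and $\lambda_2$, such that \[ \mathsf L^*=S_1\otimes\sigma^*\mathrm{cof}(L^* )\sigma^*+S_2\otimes L^*+\alpha\,\mathsf T\big[\sigma_1^{-1}(S_1-S_2)\otimes A^*\big]+\beta\,\mathsf T, \] where \[ A^*=\mathrm{cof}(L^* )\sigma^*-a^*I_2,\qquad a^*=\tfrac12\mathrm{Tr}\,(\mathrm{cof}(L^* )\sigma^* ),\qquad \beta=r_1+\alpha(a^*-1). \]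
   Context: Let $R_\perp=\begin{pmatrix}0&-1\\1&0\end{pmatrix}$ and let $I_2$ be the $2\times2$ identity. Let $\mathcal T=\mathbb R^2\oplus\mathbb R^2$. Operators on $\mathcal T$ are written as $2\times2$ block matrices with real $2\times 2$ blocks, and $A\otimes B$ is the block matrix with blocks $A_{ij}B$. Put $\mathsf T=R_\perp\otimes R_\perp$; $\mathrm{cof}$ denotes the cofactor matrix. The phases $\mathsf L_j$ are assumed positive definite: $\sigma_j$ is a real symmetric positive definite $2\times2$ matrix and $r_j\in\mathbb R$ with $r_j^2<\det\sigma_j$. A two-phase composite is given by a measurable partition of the period cell $[0,1]^2=A_1\cup A_2$ (the microstructure) and the periodic tensor field $\mathsf L(x)=\mathsf L_j$ for $x\in A_j$. Its effective tensor $\mathsf L^*$ is defined by $\mathsf L^*E_0=\int_{[0,1]^2}\mathsf L(x)E(x)\,dx$ for $E_0\in\mathcal T$, where $E=E_0+(\nabla\varphi_1,\nabla\varphi_2)$ with $\varphi_1,\varphi_2\in H^1_{\rm per}$ is the unique such field for which both $\mathbb R^2$-components of $\mathsf L E$ are divergence-free. For $h>0$, $\Sigma(h)$ is the effective ($2\times2$ symmetric) conductivity of the two-dimensional conducting composite with the same microstructure and conductivities $I_2$ on $A_1$ and $hI_2$ on $A_2$: $\Sigma(h)e_0=\int\sigma(e_0+\nabla\varphi)\,dx$ with $\nabla\cdot\sigma(e_0+\nabla\varphi)=0$, $\varphi\in H^1_{\rm per}$. *)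

theory Defs
  imports "HOL-Analysis.Analysis"
begin

definition R_perp :: "real^2^2" where
  "R_perp = vector [vector [0, -1], vector [1, 0]]"

definition cof :: "real^2^2 \<Rightarrow> real^2^2" where
  "cof M = vector [vector [M $ 2 $ 2, - (M $ 2 $ 1)], vector [- (M $ 1 $ 2), M $ 1 $ 1]]"

definition spd :: "real^2^2 \<Rightarrow> bool" where
  "spd M \<longleftrightarrow> transpose M = M \<and> (\<forall>x. x \<noteq> 0 \<longrightarrow> x \<bullet> (M *v x) > 0)"

text \<open>
  An element of \<open>\<real>\<^sup>2 \<oplus> \<real>\<^sup>2\<close> is a vector \<open>E\<close> with two entries \<open>E $ 1\<close>, \<open>E $ 2\<close> in \<open>\<real>\<^sup>2\<close>; an operator
  on this space is a \<open>2 \<times> 2\<close> array \<open>M\<close> of blocks \<open>M $ i $ j\<close>, each of them a real \<open>2 \<times> 2\<close> matrix.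
\<close>

type_synonym pair_field = "(real^2)^2"
type_synonym block = "(real^2^2)^2^2"

definition kron :: "real^2^2 \<Rightarrow> real^2^2 \<Rightarrow> block" where
  "kron A B = (\<chi> i j. A $ i $ j *\<^sub>R B)"

definition block_apply :: "block \<Rightarrow> pair_field \<Rightarrow> pair_field" where
  "block_apply M E = (\<chi> i. \<Sum>j\<in>UNIV. M $ i $ j *v E $ j)"

definition block_mult :: "block \<Rightarrow> block \<Rightarrow> block" where
  "block_mult M N = (\<chi> i j. \<Sum>k\<in>UNIV. M $ i $ k ** N $ k $ j)"

definition T_op :: block where
  "T_op = kron R_perp R_perp"

definition isotropic_phase :: "real^2^2 \<Rightarrow> real \<Rightarrow> block" where
  "isotropic_phase \<sigma> r = kron \<sigma> (mat 1) + r *\<^sub>R T_op"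


text \<open>
  A periodic \<open>L\<^sup>2\<close> field is represented by its values on the period cell \<open>[0,1]\<^sup>2\<close>.  Periodicity
  enters through the test functions: these are periodic on the whole plane and need not vanish on
  the boundary of the cell, so the weak derivatives below are those on the torus.
\<close>

definition cell :: "(real^2) set" where
  "cell = cbox 0 1"

definition L2_cell :: "(real^2 \<Rightarrow> 'b::euclidean_space) \<Rightarrow> bool" where
  "L2_cell f \<longleftrightarrow> f \<in> borel_measurable (lebesgue_on cell) \<and>
     integrable (lebesgue_on cell) (\<lambda>x. (norm (f x))\<^sup>2)"

text \<open>\<open>\<psi>\<close> is a periodic \<open>C\<^sup>1\<close> function on the plane with classical gradient \<open>\<psi>'\<close>.\<close>

definition test_fun :: "(real^2 \<Rightarrow> real) \<Rightarrow> (real^2 \<Rightarrow> real^2) \<Rightarrow> bool" where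
  "test_fun \<psi> \<psi>' \<longleftrightarrow>
     (\<forall>x i. \<psi> (x + axis i 1) = \<psi> x) \<and>
     (\<forall>x. (\<psi> has_derivative (\<lambda>h. \<psi>' x \<bullet> h)) (at x)) \<and>
     continuous_on UNIV \<psi>'"

text \<open>\<open>\<phi>\<close> is in \<open>H\<^sup>1\<close> of the torus, and its weak gradient is \<open>g\<close>.\<close>

definition H1_per :: "(real^2 \<Rightarrow> real) \<Rightarrow> (real^2 \<Rightarrow> real^2) \<Rightarrow> bool" where
  "H1_per \<phi> g \<longleftrightarrow> L2_cell \<phi> \<and> L2_cell g \<and>
     (\<forall>\<psi> \<psi>'. test_fun \<psi> \<psi>' \<longrightarrow>
        (LINT x|lebesgue_on cell. \<phi> x *\<^sub>R \<psi>' x) = - (LINT x|lebesgue_on cell. \<psi> x *\<^sub>R g x))"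

definition div_free :: "(real^2 \<Rightarrow> real^2) \<Rightarrow> bool" where
  "div_free J \<longleftrightarrow> L2_cell J \<and>
     (\<forall>\<psi> \<psi>'. test_fun \<psi> \<psi>' \<longrightarrow> (LINT x|lebesgue_on cell. J x \<bullet> \<psi>' x) = 0)"


definition microstructure :: "(real^2) set \<Rightarrow> (real^2) set \<Rightarrow> bool" where
  "microstructure A1 A2 \<longleftrightarrow>
     A1 \<in> sets lebesgue \<and> A2 \<in> sets lebesgue \<and> A1 \<inter> A2 = {} \<and> A1 \<union> A2 = cell"

text \<open>Only the values on the cell matter, where \<open>x \<notin> A1\<close> means \<open>x \<in> A2\<close>.\<close>

definition two_phase :: "(real^2) set \<Rightarrow> 'b \<Rightarrow> 'b \<Rightarrow> real^2 \<Rightarrow> 'b" where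
  "two_phase A1 L1 L2 = (\<lambda>x. if x \<in> A1 then L1 else L2)"

definition cell_solution :: "(real^2 \<Rightarrow> block) \<Rightarrow> pair_field \<Rightarrow> (real^2 \<Rightarrow> pair_field) \<Rightarrow> bool" where
  "cell_solution L E0 E \<longleftrightarrow>
     (\<exists>\<phi> g. (\<forall>i. H1_per (\<phi> i) (g i)) \<and> E = (\<lambda>x. E0 + (\<chi> i. g i x))) \<and>
     (\<forall>i. div_free (\<lambda>x. block_apply (L x) (E x) $ i))"

text \<open>
  For a coercive bounded \<open>L\<close> the field \<open>E\<close> exists and is unique up to null sets, so that the integral,
  and hence \<open>M\<close>, is well defined.
\<close>

definition is_effective_tensor :: "(real^2 \<Rightarrow> block) \<Rightarrow> block \<Rightarrow> bool" where
  "is_effective_tensor L M \<longleftrightarrow>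
     (\<forall>E0. \<exists>E. cell_solution L E0 E \<and>
        block_apply M E0 = (LINT x|lebesgue_on cell. block_apply (L x) (E x)))"

definition effective_tensor :: "(real^2 \<Rightarrow> block) \<Rightarrow> block" where
  "effective_tensor L = (THE M. is_effective_tensor L M)"

definition conductivity_solution ::
    "(real^2 \<Rightarrow> real^2^2) \<Rightarrow> real^2 \<Rightarrow> (real^2 \<Rightarrow> real^2) \<Rightarrow> bool" where
  "conductivity_solution s e0 e \<longleftrightarrow>
     (\<exists>\<phi> g. H1_per \<phi> g \<and> e = (\<lambda>x. e0 + g x)) \<and> div_free (\<lambda>x. s x *v e x)"

definition is_effective_conductivity :: "(real^2 \<Rightarrow> real^2^2) \<Rightarrow> real^2^2 \<Rightarrow> bool" where
  "is_effective_conductivity s M \<longleftrightarrow>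
     (\<forall>e0. \<exists>e. conductivity_solution s e0 e \<and>
        M *v e0 = (LINT x|lebesgue_on cell. s x *v e x))"

definition effective_conductivity :: "(real^2 \<Rightarrow> real^2^2) \<Rightarrow> real^2^2" where
  "effective_conductivity s = (THE M. is_effective_conductivity s M)"

definition \<Sigma>_eff :: "(real^2) set \<Rightarrow> real \<Rightarrow> real^2^2" where
  "\<Sigma>_eff A1 h = effective_conductivity (two_phase A1 (mat 1) (h *\<^sub>R mat 1))"

end

theory Submission
  imports Defs
begin

text \<open>
  A congruence \<open>E \<mapsto> (X \<otimes> I) E\<close> with \<open>\<sigma>1 = X\<^sup>T X\<close>, \<open>\<sigma>2 = X\<^sup>T diag (l1, l2) X\<close> and
  \<open>det X = \<alpha>\<close>, followed by a shift by a multiple of \<open>T\<close> (a null Lagrangian: \<open>T E\<close> is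
  divergence-free with mean \<open>T E0\<close>, since the components of \<open>E\<close> are curl-free), reduces the
  composite to the degenerate phases \<open>I + T\<close> and \<open>diag (l1, l2) \<otimes> I + sqrt (l1 l2) T\<close>.
  There the two components of the flux satisfy \<open>J2 = h R J1\<close> with \<open>h = 1\<close> or
  \<open>h = sqrt (l2 / l1)\<close>. As \<open>R J1\<close> is curl-free, it solves the scalar conduction
  problem with current \<open>J2\<close>, hence the averages are related by \<open>\<sigma>star R\<close>. Together with symmetry
  this determines the degenerate effective tensor from its upper left block \<open>Lstar\<close>.

  The analytic input is the Hodge decomposition on the torus, which rests on the completeness of the
  trigonometric system: a field that is orthogonal to all constants, gradients and rotated gradients
  has vanishing Fourier coefficients.
\<close>

section \<open>Square-integrable fields on the cell\<close>

text \<open>A congruence by X multiplies the coefficient of T by det X. To reach the canonical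
  coefficients 1 and s = sqrt (l1 l2) up to a common shift c, one needs r1 = det X + c and r2 = s
  det X + c, that is det X = (r1 - r2) / (1 - s). As det \<sigma>2 = s^2 det \<sigma>1, the
  hypothesis on |r1 - r2| says exactly that the square of this number is det \<sigma>1, as \<sigma>1
  = X^T X demands; the number itself is \<alpha>. The obstacle is that the canonical phases are only
  semidefinite, so that their cell problem is not coercive. The canonical composite is therefore
  solved with \<delta> T subtracted, and \<delta> T is added back to the fluxes and to their means.
  Taking \<delta> = min 1 s makes every choice a function of l1 and l2, and T has zero diagonal
  blocks, so that the shift does not change the upper left block. The effective matrix of the scalar
  problem is itself produced from solutions of the tensor problem.\<close>

abbreviation cell_measure :: "(real^2) measure" ("\<mu>") where
  "\<mu> \<equiv> lebesgue_on cell"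

lemma cell_lmeasurable: "cell \<in> lmeasurable"
  by (simp add: cell_def)

lemma sets_cell [simp]: "cell \<in> sets lebesgue"
  by (simp add: cell_def)

lemma measure_cell: "measure \<mu> cell = 1"
proof -
  have "measure \<mu> cell = measure lebesgue cell"
    by (simp add: measure_restrict_space)
  also have "\<dots> = 1"
    unfolding cell_def by (simp add: content_cbox_if_cart interval_eq_empty_cart)
  finally show ?thesis .
qed

global_interpretation cell: finite_measure \<mu>
  by (rule finite_measure_lebesgue_on[OF cell_lmeasurable])

lemma L2_meas: "L2_cell f \<Longrightarrow> f \<in> borel_measurable \<mu>"
  by (simp add: L2_cell_def)

lemma L2_sq: "L2_cell f \<Longrightarrow> integrable \<mu> (\<lambda>x. (norm (f x))\<^sup>2)"
  by (simp add: L2_cell_def)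

lemma L2_bound:
  fixes f :: "real^2 \<Rightarrow> 'b::euclidean_space"
  assumes "f \<in> borel_measurable \<mu>" "integrable \<mu> h" "\<And>x. x \<in> cell \<Longrightarrow> (norm (f x))\<^sup>2 \<le> h x"
  shows "L2_cell f"
  unfolding L2_cell_def
proof
  show "f \<in> borel_measurable \<mu>" by fact
  show "integrable \<mu> (\<lambda>x. (norm (f x))\<^sup>2)"
  proof (rule Bochner_Integration.integrable_bound[OF assms(2)])
    show "AE x in \<mu>. norm ((norm (f x))\<^sup>2) \<le> norm (h x)"
      using assms(3) by (intro AE_I2) (force intro: order_trans[OF _ abs_ge_self])
  qed (use assms(1) in measurable)
qed

lemma L2_integrable:
  fixes f :: "real^2 \<Rightarrow> 'b::euclidean_space"
  assumes "L2_cell f"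
  shows "integrable \<mu> f"
proof (rule Bochner_Integration.integrable_bound)
  show "integrable \<mu> (\<lambda>x. 1 + (norm (f x))\<^sup>2)"
    using L2_sq[OF assms] by simp
  have "norm (f x) \<le> 1 + (norm (f x))\<^sup>2" for x
  proof -
    have "0 \<le> (norm (f x) - 1)\<^sup>2 + (norm (f x))\<^sup>2" by simp
    then show ?thesis by (simp add: power2_diff)
  qed
  then show "AE x in \<mu>. norm (f x) \<le> norm (1 + (norm (f x))\<^sup>2)"
    by (intro AE_I2) (simp add: add_nonneg_nonneg)
qed (rule L2_meas[OF assms])

lemma norm_add_sq_le: "(norm (a + b :: 'b::real_normed_vector))\<^sup>2 \<le> 2 * (norm a)\<^sup>2 + 2 * (norm b)\<^sup>2"
proof -
  have "(norm (a + b))\<^sup>2 \<le> (norm a + norm b)\<^sup>2"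
    by (simp add: norm_triangle_ineq power_mono)
  also have "\<dots> \<le> 2 * (norm a)\<^sup>2 + 2 * (norm b)\<^sup>2"
    using sum_squares_bound[of "norm a" "norm b"] by (simp add: power2_sum)
  finally show ?thesis .
qed

lemma L2_add:
  fixes f g :: "real^2 \<Rightarrow> 'b::euclidean_space"
  assumes "L2_cell f" "L2_cell g"
  shows "L2_cell (\<lambda>x. f x + g x)"
  by (rule L2_bound[where h = "\<lambda>x. 2 * (norm (f x))\<^sup>2 + 2 * (norm (g x))\<^sup>2"])
     (use L2_meas[OF assms(1)] L2_meas[OF assms(2)] L2_sq[OF assms(1)] L2_sq[OF assms(2)]
        norm_add_sq_le in auto)

lemma L2_linear:
  fixes f :: "real^2 \<Rightarrow> 'b::euclidean_space" and T :: "'b \<Rightarrow> 'c::euclidean_space"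
  assumes "L2_cell f" "bounded_linear T"
  shows "L2_cell (\<lambda>x. T (f x))"
proof -
  obtain K where K: "\<And>x. norm (T x) \<le> norm x * K"
    using bounded_linear.bounded[OF assms(2)] by blast
  show ?thesis
  proof (rule L2_bound[where h = "\<lambda>x. K\<^sup>2 * (norm (f x))\<^sup>2"])
    show "(\<lambda>x. T (f x)) \<in> borel_measurable \<mu>"
      using measurable_compose[OF L2_meas[OF assms(1)], of T borel]
        linear_continuous_on[OF assms(2), of UNIV] borel_measurable_continuous_onI by blast
    fix x
    have "(norm (T (f x)))\<^sup>2 \<le> (norm (f x) * K)\<^sup>2"
      by (intro power_mono K) simp
    then show "(norm (T (f x)))\<^sup>2 \<le> K\<^sup>2 * (norm (f x))\<^sup>2"
      by (simp add: power_mult_distrib mult.commute)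
  qed (use L2_sq[OF assms(1)] in simp)
qed

lemma L2_scale: "L2_cell f \<Longrightarrow> L2_cell (\<lambda>x. c *\<^sub>R (f x :: 'b::euclidean_space))"
  by (rule L2_linear[OF _ bounded_linear_scaleR_right])

lemma L2_diff:
  fixes f g :: "real^2 \<Rightarrow> 'b::euclidean_space"
  assumes "L2_cell f" "L2_cell g"
  shows "L2_cell (\<lambda>x. f x - g x)"
  using L2_add[OF assms(1) L2_scale[OF assms(2), of "-1"]] by simp

lemma L2_const: "L2_cell (\<lambda>x. c :: 'b::euclidean_space)"
  by (simp add: L2_cell_def)

lemma L2_inner_integrable:
  fixes f g :: "real^2 \<Rightarrow> 'b::euclidean_space"
  assumes "L2_cell f" "L2_cell g"
  shows "integrable \<mu> (\<lambda>x. f x \<bullet> g x)"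
proof (rule Bochner_Integration.integrable_bound)
  show "integrable \<mu> (\<lambda>x. (norm (f x))\<^sup>2 + (norm (g x))\<^sup>2)"
    using L2_sq[OF assms(1)] L2_sq[OF assms(2)] by simp
  have "\<bar>f x \<bullet> g x\<bar> \<le> (norm (f x))\<^sup>2 + (norm (g x))\<^sup>2" for x
  proof -
    have "2 * (norm (f x) * norm (g x)) \<le> (norm (f x))\<^sup>2 + (norm (g x))\<^sup>2"
      using sum_squares_bound[of "norm (f x)" "norm (g x)"] by simp
    moreover have "0 \<le> norm (f x) * norm (g x)" by simp
    ultimately show ?thesis
      using Cauchy_Schwarz_ineq2[of "f x" "g x"] by linarith
  qed
  then show "AE x in \<mu>. norm (f x \<bullet> g x) \<le> norm ((norm (f x))\<^sup>2 + (norm (g x))\<^sup>2)"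
    by (intro AE_I2) simp
  show "(\<lambda>x. f x \<bullet> g x) \<in> borel_measurable \<mu>"
    using L2_meas[OF assms(1)] L2_meas[OF assms(2)] by simp
qed

lemma continuous_measurable_cell:
  "continuous_on UNIV f \<Longrightarrow> f \<in> borel_measurable \<mu>"
  by (intro continuous_imp_measurable_on_sets_lebesgue) (auto intro: continuous_on_subset)

lemma L2_continuous:
  fixes f :: "real^2 \<Rightarrow> 'b::euclidean_space"
  assumes "continuous_on UNIV f"
  shows "L2_cell f"
proof -
  have "compact (f ` cell)"
    unfolding cell_def
    by (intro compact_continuous_image compact_cbox continuous_on_subset[OF assms]) simp
  then obtain B where B: "\<And>x. x \<in> cell \<Longrightarrow> norm (f x) \<le> B"
    using compact_imp_bounded bounded_iff by (metis imageI)
  show ?thesis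
    by (rule L2_bound[where h = "\<lambda>x. B\<^sup>2"])
       (use continuous_measurable_cell[OF assms] B in \<open>auto intro: power_mono\<close>)
qed

lemma L2_if:
  fixes f g :: "real^2 \<Rightarrow> 'b::euclidean_space"
  assumes "L2_cell f" "L2_cell g" "A \<in> sets lebesgue"
  shows "L2_cell (\<lambda>x. if x \<in> A then f x else g x)"
proof (rule L2_bound[where h = "\<lambda>x. (norm (f x))\<^sup>2 + (norm (g x))\<^sup>2"])
  have "Measurable.pred \<mu> (\<lambda>x. x \<in> A)"
  proof -
    have "{x \<in> space \<mu>. x \<in> A} = A \<inter> cell" by auto
    then show ?thesis
      using assms(3) by (auto simp: pred_def sets_restrict_space)
  qed
  then show "(\<lambda>x. if x \<in> A then f x else g x) \<in> borel_measurable \<mu>"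
    using L2_meas[OF assms(1)] L2_meas[OF assms(2)] by (simp add: measurable_If)
qed (use L2_sq[OF assms(1)] L2_sq[OF assms(2)] in auto)

lemma L2_vec_iff:
  fixes f :: "real^2 \<Rightarrow> 'b::euclidean_space^2"
  shows "L2_cell f \<longleftrightarrow> (\<forall>i. L2_cell (\<lambda>x. f x $ i))"
proof
  assume "L2_cell f"
  then show "\<forall>i. L2_cell (\<lambda>x. f x $ i)"
    by (intro allI L2_linear[where T = "\<lambda>v. v $ _"] bounded_linear_vec_nth)
next
  assume *: "\<forall>i. L2_cell (\<lambda>x. f x $ i)"
  have axis: "bounded_linear (\<lambda>v. axis i v :: 'b^2)" for i :: 2
    by (intro linear_conv_bounded_linear[THEN iffD1] linearI) (auto simp: axis_def vec_eq_iff)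
  have "f = (\<lambda>x. axis 1 (f x $ 1) + axis 2 (f x $ 2))"
    by (auto simp: fun_eq_iff vec_eq_iff axis_def forall_2)
  then show "L2_cell f"
    using L2_add[OF L2_linear[OF *[rule_format, of 1] axis[of 1]] L2_linear[OF *[rule_format, of 2] axis[of 2]]]
    by simp
qed

section \<open>Inner product, squared norm and Cauchy-Schwarz on the cell\<close>

definition ip :: "(real^2 \<Rightarrow> 'b::euclidean_space) \<Rightarrow> (real^2 \<Rightarrow> 'b) \<Rightarrow> real" where
  "ip f g = (LINT x|\<mu>. f x \<bullet> g x)"

definition nsq :: "(real^2 \<Rightarrow> 'b::euclidean_space) \<Rightarrow> real" where
  "nsq f = (LINT x|\<mu>. (norm (f x))\<^sup>2)"

lemma nsq_ip: "nsq f = ip f f"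
  by (simp add: nsq_def ip_def dot_square_norm)

lemma nsq_nonneg: "0 \<le> nsq f"
  by (simp add: nsq_def)

lemma ip_commute: "ip f g = ip g f"
  by (simp add: ip_def inner_commute)

lemma ip_add_left: "L2_cell f \<Longrightarrow> L2_cell g \<Longrightarrow> L2_cell h \<Longrightarrow> ip (\<lambda>x. f x + g x) h = ip f h + ip g h"
  unfolding ip_def inner_add_left
  by (rule Bochner_Integration.integral_add) (auto intro: L2_inner_integrable)

lemma ip_diff_left: "L2_cell f \<Longrightarrow> L2_cell g \<Longrightarrow> L2_cell h \<Longrightarrow> ip (\<lambda>x. f x - g x) h = ip f h - ip g h"
  unfolding ip_def inner_diff_left
  by (rule Bochner_Integration.integral_diff) (auto intro: L2_inner_integrable)

lemma ip_scale_left: "ip (\<lambda>x. c *\<^sub>R f x) h = c * ip f h"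
  by (simp add: ip_def)

lemma ip_diff_right: "L2_cell f \<Longrightarrow> L2_cell g \<Longrightarrow> L2_cell h \<Longrightarrow> ip h (\<lambda>x. f x - g x) = ip h f - ip h g"
  by (simp add: ip_commute[of h] ip_diff_left)

lemma ip_scale_right: "ip h (\<lambda>x. c *\<^sub>R f x) = c * ip h f"
  by (simp add: ip_def)

lemma ip_const_left: "L2_cell f \<Longrightarrow> ip (\<lambda>x. c) f = c \<bullet> (LINT x|\<mu>. f x)"
  unfolding ip_def using L2_integrable integral_inner_right by blast

lemma ip_const_right: "L2_cell f \<Longrightarrow> ip f (\<lambda>x. c) = (LINT x|\<mu>. f x) \<bullet> c"
  by (simp add: ip_commute[of f] ip_const_left inner_commute)

text \<open>Common source of the Cauchy-Schwarz inequality for \<open>ip\<close>, of the one for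
  energy forms, and of the near-orthogonality of minimizing sequences. The case \<open>q = 0\<close>
  leaves a linear polynomial in \<open>t\<close>, which is bounded below only if
  \<open>b = 0\<close>.\<close>

lemma discriminant_bound:
  fixes e b q :: real
  assumes "\<And>t. 0 \<le> e - 2 * t * b + t\<^sup>2 * q" "0 \<le> q"
  shows "b\<^sup>2 \<le> e * q"
proof (cases "q = 0")
  case True
  have "b = 0"
  proof (rule ccontr)
    assume "b \<noteq> 0"
    \<comment> \<open>At this \<open>t\<close> the linear polynomial has the value -1.\<close>
    with assms(1)[of "(e + 1) / (2 * b)"] True show False by simp
  qed
  then show ?thesis using True by simp
next
  case False
  have "e - 2 * (b / q) * b + (b / q)\<^sup>2 * q = e - b\<^sup>2 / q"
    using False by (simp add: power2_eq_square field_simps)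
  with assms(1)[of "b / q"] have "b\<^sup>2 / q \<le> e" by simp
  then show ?thesis using False assms(2) by (simp add: field_simps)
qed

lemma ip_Cauchy_Schwarz:
  assumes f: "L2_cell f" and g: "L2_cell g"
  shows "(ip f g)\<^sup>2 \<le> nsq f * nsq g"
proof (rule discriminant_bound)
  fix t :: real
  have tg: "L2_cell (\<lambda>x. t *\<^sub>R g x)" by (rule L2_scale[OF g])
  have "nsq (\<lambda>x. f x - t *\<^sub>R g x) = nsq f - 2 * t * ip f g + t\<^sup>2 * nsq g"
    unfolding nsq_ip ip_diff_left[OF f tg L2_diff[OF f tg]] ip_diff_right[OF f tg f]
      ip_diff_right[OF f tg tg] ip_scale_left ip_scale_right ip_commute[of g f]
    by (simp add: power2_eq_square algebra_simps)
  then show "0 \<le> nsq f - 2 * t * ip f g + t\<^sup>2 * nsq g"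
    using nsq_nonneg[of "\<lambda>x. f x - t *\<^sub>R g x"] by simp
qed (rule nsq_nonneg)

lemma nsq_add_le:
  assumes f: "L2_cell f" and g: "L2_cell g"
  shows "nsq (\<lambda>x. f x + g x) \<le> 2 * nsq f + 2 * nsq g"
proof -
  have "nsq (\<lambda>x. f x + g x) \<le> (LINT x|\<mu>. 2 * (norm (f x))\<^sup>2 + 2 * (norm (g x))\<^sup>2)"
    unfolding nsq_def using L2_sq[OF L2_add[OF f g]] L2_sq[OF f] L2_sq[OF g] norm_add_sq_le
    by (intro integral_mono) auto
  then show ?thesis using L2_sq[OF f] L2_sq[OF g] by (simp add: nsq_def)
qed

lemma nsq_minus_commute: "nsq (\<lambda>x. f x - g x) = nsq (\<lambda>x. g x - f x)"
  by (simp add: nsq_def norm_minus_commute)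

lemma nsq_zero_AE:
  assumes "L2_cell f" "nsq f = 0"
  shows "AE x in \<mu>. f x = 0"
  using integral_nonneg_eq_0_iff_AE[OF L2_sq[OF assms(1)]] assms(2) by (simp add: nsq_def)

lemma ip_tendsto:
  assumes "\<And>n. L2_cell (F n)" "L2_cell f" "L2_cell g" "(\<lambda>n. nsq (\<lambda>x. F n x - f x)) \<longlonglongrightarrow> 0"
  shows "(\<lambda>n. ip (F n) g) \<longlonglongrightarrow> ip f g"
proof -
  have "(\<lambda>n. (ip (\<lambda>x. F n x - f x) g)\<^sup>2) \<longlonglongrightarrow> 0"
  proof (rule tendsto_sandwich[of "\<lambda>n. 0"])
    show "\<forall>\<^sub>F n in sequentially. (ip (\<lambda>x. F n x - f x) g)\<^sup>2 \<le> nsq (\<lambda>x. F n x - f x) * nsq g"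
      by (intro always_eventually allI ip_Cauchy_Schwarz L2_diff assms)
    show "(\<lambda>n. nsq (\<lambda>x. F n x - f x) * nsq g) \<longlonglongrightarrow> 0"
      using tendsto_mult_right[OF assms(4), of "nsq g"] by simp
  qed auto
  then have "(\<lambda>n. ip (\<lambda>x. F n x - f x) g) \<longlonglongrightarrow> 0"
    using tendsto_null_power by force
  then have "(\<lambda>n. ip (F n) g - ip f g) \<longlonglongrightarrow> 0"
    by (simp add: ip_diff_left assms)
  then show ?thesis by (rule LIM_zero_cancel)
qed

section \<open>Completeness and projections\<close>

text \<open>Cauchy-Schwarz against the constant 1, on a cell of measure 1.\<close>

lemma L1_le_L2:
  fixes f :: "real^2 \<Rightarrow> 'b::euclidean_space"
  assumes "L2_cell f"
  shows "(LINT x|\<mu>. norm (f x))\<^sup>2 \<le> nsq f"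
proof -
  have n: "L2_cell (\<lambda>x. norm (f x))"
    using assms by (auto simp: L2_cell_def)
  have "(ip (\<lambda>x. norm (f x)) (\<lambda>x. 1))\<^sup>2 \<le> nsq (\<lambda>x. norm (f x)) * nsq (\<lambda>x. 1 :: real)"
    by (rule ip_Cauchy_Schwarz[OF n L2_const])
  then show ?thesis by (simp add: ip_def nsq_def measure_cell)
qed

text \<open>The sum of the norms of all increments has a finite integral, hence is finite almost
  everywhere; there the telescoping series converges absolutely.\<close>

lemma AE_convergent_of_summable_L1:
  fixes G :: "nat \<Rightarrow> real^2 \<Rightarrow> 'b::euclidean_space"
  assumes G: "\<And>k. integrable \<mu> (G k)"
    and le: "\<And>k. (LINT x|\<mu>. norm (G (Suc k) x - G k x)) \<le> (1/2)^k"
  shows "AE x in \<mu>. convergent (\<lambda>k. G k x)"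
proof -
  have int: "integrable \<mu> (\<lambda>x. norm (G (Suc k) x - G k x))" for k
    using G by auto
  have "(\<integral>\<^sup>+x. (\<Sum>k. ennreal (norm (G (Suc k) x - G k x))) \<partial>\<mu>)
      = (\<Sum>k. \<integral>\<^sup>+x. ennreal (norm (G (Suc k) x - G k x)) \<partial>\<mu>)"
    using int by (intro nn_integral_suminf) auto
  also have "\<dots> = (\<Sum>k. ennreal (LINT x|\<mu>. norm (G (Suc k) x - G k x)))"
    using int by (intro suminf_cong nn_integral_eq_integral) auto
  also have "\<dots> \<le> (\<Sum>k. ennreal ((1/2)^k))"
    using le by (intro suminf_le ennreal_leI) auto
  also have "\<dots> = ennreal (\<Sum>k. (1/2::real)^k)"
    by (intro suminf_ennreal2) (auto intro: summable_geometric)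
  also have "\<dots> < \<infinity>" by simp
  finally have "(\<integral>\<^sup>+x. (\<Sum>k. ennreal (norm (G (Suc k) x - G k x))) \<partial>\<mu>) \<noteq> \<infinity>" by simp
  then have "AE x in \<mu>. (\<Sum>k. ennreal (norm (G (Suc k) x - G k x))) \<noteq> \<infinity>"
    using int by (intro nn_integral_PInf_AE) auto
  then show ?thesis
  proof (rule AE_mp[OF _ AE_I2], intro impI)
    fix x assume "(\<Sum>k. ennreal (norm (G (Suc k) x - G k x))) \<noteq> \<infinity>"
    then have "summable (\<lambda>k. norm (G (Suc k) x - G k x))"
      by (intro summable_suminf_not_top) auto
    then have "summable (\<lambda>k. G (Suc k) x - G k x)"
      by (rule summable_norm_cancel)
    then have "convergent (\<lambda>n. \<Sum>k<n. G (Suc k) x - G k x)"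
      by (simp add: summable_iff_convergent)
    then have "convergent (\<lambda>n. G n x - G 0 x)"
      by (simp only: sum_lessThan_telescope[of "\<lambda>k. G k x"])
    then show "convergent (\<lambda>n. G n x)"
      by (simp add: convergent_diff_const_right_iff)
  qed
qed

text \<open>Fatou's lemma carries the bound to the pointwise limit. Square-integrability of
  \<open>f\<close> is a by-product: \<open>F - f\<close> has a finite norm and \<open>F\<close> is
  in L2.\<close>

lemma nsq_Fatou:
  fixes F :: "real^2 \<Rightarrow> 'b::euclidean_space"
  assumes F: "L2_cell F" and G: "\<And>k. L2_cell (G k)" and f: "f \<in> borel_measurable \<mu>"
    and lim: "AE x in \<mu>. (\<lambda>k. G k x) \<longlonglongrightarrow> f x"
    and le: "\<forall>\<^sub>F k in sequentially. nsq (\<lambda>x. F x - G k x) \<le> e"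
  shows "L2_cell f \<and> nsq (\<lambda>x. F x - f x) \<le> e"
proof -
  have meas: "(\<lambda>x. F x - f x) \<in> borel_measurable \<mu>"
    using L2_meas[OF F] f by auto
  have "0 \<le> e"
    using eventually_happens[OF le] nsq_nonneg by (auto intro: order_trans)
  have "(\<integral>\<^sup>+x. ennreal ((norm (F x - f x))\<^sup>2) \<partial>\<mu>)
      = (\<integral>\<^sup>+x. liminf (\<lambda>k. ennreal ((norm (F x - G k x))\<^sup>2)) \<partial>\<mu>)"
  proof (rule nn_integral_cong_AE, rule AE_mp[OF lim AE_I2], intro impI)
    fix x assume "(\<lambda>k. G k x) \<longlonglongrightarrow> f x"
    then have "(\<lambda>k. ennreal ((norm (F x - G k x))\<^sup>2)) \<longlonglongrightarrow> ennreal ((norm (F x - f x))\<^sup>2)"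
      by (intro tendsto_intros tendsto_ennrealI)
    then show "ennreal ((norm (F x - f x))\<^sup>2) = liminf (\<lambda>k. ennreal ((norm (F x - G k x))\<^sup>2))"
      using lim_imp_Liminf[of sequentially] by (metis sequentially_bot)
  qed
  also have "\<dots> \<le> liminf (\<lambda>k. \<integral>\<^sup>+x. ennreal ((norm (F x - G k x))\<^sup>2) \<partial>\<mu>)"
    using L2_meas[OF F] L2_meas[OF G] by (intro nn_integral_liminf) auto
  also have "\<dots> = liminf (\<lambda>k. ennreal (nsq (\<lambda>x. F x - G k x)))"
    unfolding nsq_def
    by (intro arg_cong[where f = liminf] ext nn_integral_eq_integral L2_sq L2_diff F G) auto
  also have "\<dots> \<le> liminf (\<lambda>k. ennreal e)"
    by (intro Liminf_mono eventually_mono[OF le] ennreal_leI)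
  also have "\<dots> = ennreal e" by (simp add: Liminf_const)
  finally have le': "(\<integral>\<^sup>+x. ennreal ((norm (F x - f x))\<^sup>2) \<partial>\<mu>) \<le> ennreal e" .
  have int: "integrable \<mu> (\<lambda>x. (norm (F x - f x))\<^sup>2)"
  proof (rule integrableI_bounded)
    show "(\<integral>\<^sup>+x. ennreal (norm ((norm (F x - f x))\<^sup>2)) \<partial>\<mu>) < \<infinity>"
      using le_less_trans[OF le' ennreal_less_top] by simp
  qed (use meas in measurable)
  then have d: "L2_cell (\<lambda>x. F x - f x)"
    using meas by (simp add: L2_cell_def)
  have "ennreal (nsq (\<lambda>x. F x - f x)) \<le> ennreal e"
    using le' nn_integral_eq_integral[OF int] by (simp add: nsq_def)
  then have "nsq (\<lambda>x. F x - f x) \<le> e"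
    using \<open>0 \<le> e\<close> by (simp add: ennreal_le_iff)
  then show ?thesis
    using L2_diff[OF F d] by simp
qed

text \<open>Riesz-Fischer, stated for functions and the seminorm \<open>nsq\<close> instead of
  equivalence classes.\<close>

theorem L2_complete:
  fixes F :: "nat \<Rightarrow> real^2 \<Rightarrow> 'b::euclidean_space"
  assumes F: "\<And>n. L2_cell (F n)"
    and Cauchy: "\<And>e. 0 < e \<Longrightarrow> \<exists>N. \<forall>m\<ge>N. \<forall>n\<ge>N. nsq (\<lambda>x. F m x - F n x) < e"
  shows "\<exists>f. L2_cell f \<and> (\<lambda>n. nsq (\<lambda>x. F n x - f x)) \<longlonglongrightarrow> 0"
proof -
  \<comment> \<open>\<open>nsq\<close> is a squared norm, so the bound (1/4)^k makes the L1 norms of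
    the increments at most (1/2)^k.\<close>
  have "\<exists>N. \<forall>m\<ge>N. \<forall>n\<ge>N. nsq (\<lambda>x. F m x - F n x) < (1/4)^k" for k :: nat
    by (rule Cauchy) simp
  then obtain N where N: "\<And>k m n. m \<ge> N k \<Longrightarrow> n \<ge> N k \<Longrightarrow> nsq (\<lambda>x. F m x - F n x) < (1/4)^k"
    by metis
  \<comment> \<open>A nondecreasing index sequence with both \<open>N k\<close> and \<open>k\<close>
    below \<open>r k\<close>.\<close>
  define r where "r k = k + (\<Sum>j\<le>k. N j)" for k
  have rN: "N k \<le> r k" for k
    unfolding r_def by (rule trans_le_add2) (auto intro: member_le_sum)
  have r_Suc: "r k \<le> r (Suc k)" for k by (simp add: r_def)
  have r_ge: "k \<le> r k" for k by (simp add: r_def)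
  define G where "G k = F (r k)" for k
  have G: "L2_cell (G k)" for k by (simp add: G_def F)
  have "(LINT x|\<mu>. norm (G (Suc k) x - G k x)) \<le> (1/2)^k" for k
  proof (rule power2_le_imp_le)
    have "(LINT x|\<mu>. norm (G (Suc k) x - G k x))\<^sup>2 \<le> nsq (\<lambda>x. G (Suc k) x - G k x)"
      by (rule L1_le_L2[OF L2_diff[OF G G]])
    also have "\<dots> \<le> (1/4)^k"
      using N[of k "r (Suc k)" "r k"] rN[of k] r_Suc[of k] by (simp add: G_def)
    also have "\<dots> = ((1/2::real)^k)\<^sup>2"
      by (simp add: power2_eq_square flip: power_mult_distrib)
    finally show "(LINT x|\<mu>. norm (G (Suc k) x - G k x))\<^sup>2 \<le> ((1/2)^k)\<^sup>2" .
  qed simp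
  then have conv: "AE x in \<mu>. convergent (\<lambda>k. G k x)"
    by (intro AE_convergent_of_summable_L1 L2_integrable G)
  define f where "f x = lim (\<lambda>k. G k x)" for x
  have f: "f \<in> borel_measurable \<mu>"
    unfolding f_def using L2_meas[OF G] by (intro borel_measurable_lim_metric)
  have lim: "AE x in \<mu>. (\<lambda>k. G k x) \<longlonglongrightarrow> f x"
    using conv by (rule AE_mp) (auto simp: f_def convergent_LIMSEQ_iff)
  have key: "\<exists>N. \<forall>n\<ge>N. L2_cell f \<and> nsq (\<lambda>x. F n x - f x) \<le> e" if e: "0 < e" for e
  proof -
    obtain N' where N': "\<And>m n. m \<ge> N' \<Longrightarrow> n \<ge> N' \<Longrightarrow> nsq (\<lambda>x. F m x - F n x) < e"
      using Cauchy[OF e] by blast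
    have "L2_cell f \<and> nsq (\<lambda>x. F n x - f x) \<le> e" if "n \<ge> N'" for n
    proof (rule nsq_Fatou[OF F G f lim])
      show "\<forall>\<^sub>F k in sequentially. nsq (\<lambda>x. F n x - G k x) \<le> e"
        unfolding eventually_sequentially G_def using N'[OF that] r_ge order_trans
        by (metis less_imp_le)
    qed
    then show ?thesis by blast
  qed
  have "L2_cell f" using key[of 1] by auto
  moreover have "(\<lambda>n. nsq (\<lambda>x. F n x - f x)) \<longlonglongrightarrow> 0"
  proof (rule LIMSEQ_I)
    fix e :: real assume "0 < e"
    then obtain N' where "\<forall>n\<ge>N'. nsq (\<lambda>x. F n x - f x) \<le> e / 2"
      using key[of "e / 2"] by auto
    then show "\<exists>no. \<forall>n\<ge>no. norm (nsq (\<lambda>x. F n x - f x) - 0) < e"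
      using \<open>0 < e\<close> by (intro exI[of _ N'] allI impI) (force simp: abs_of_nonneg[OF nsq_nonneg])
  qed
  ultimately show ?thesis by blast
qed

text \<open>Orthogonal projection onto a closed subspace for any inner product \<open>b\<close>
  equivalent to that of L2. It serves twice: with \<open>ip\<close>, to split off gradients, and
  with the energy of a composite, to solve the cell problem.\<close>

theorem L2_projection:
  fixes S :: "(real^2 \<Rightarrow> 'b::euclidean_space) set" and b :: "(real^2 \<Rightarrow> 'b) \<Rightarrow> (real^2 \<Rightarrow> 'b) \<Rightarrow> real"
  assumes S_L2: "\<And>f. f \<in> S \<Longrightarrow> L2_cell f" and S_zero: "(\<lambda>x. 0) \<in> S"
    and S_add: "\<And>f g. f \<in> S \<Longrightarrow> g \<in> S \<Longrightarrow> (\<lambda>x. f x + g x) \<in> S"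
    and S_scale: "\<And>f c. f \<in> S \<Longrightarrow> (\<lambda>x. c *\<^sub>R f x) \<in> S"
    and S_closed: "\<And>F f. (\<And>n. F n \<in> S) \<Longrightarrow> L2_cell f \<Longrightarrow> (\<lambda>n. nsq (\<lambda>x. F n x - f x)) \<longlonglongrightarrow> 0 \<Longrightarrow> f \<in> S"
    and b_add: "\<And>f g h. L2_cell f \<Longrightarrow> L2_cell g \<Longrightarrow> L2_cell h \<Longrightarrow> b (\<lambda>x. f x + g x) h = b f h + b g h"
    and b_scale: "\<And>f h c. L2_cell f \<Longrightarrow> L2_cell h \<Longrightarrow> b (\<lambda>x. c *\<^sub>R f x) h = c * b f h"
    and b_sym: "\<And>f g. L2_cell f \<Longrightarrow> L2_cell g \<Longrightarrow> b f g = b g f"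
    and b_lower: "\<And>f. L2_cell f \<Longrightarrow> m * nsq f \<le> b f f" and m: "0 < m"
    and b_upper: "\<And>f. L2_cell f \<Longrightarrow> b f f \<le> C * nsq f"
    and f0: "L2_cell f0"
  shows "\<exists>s\<in>S. \<forall>t\<in>S. b (\<lambda>x. f0 x - s x) t = 0"
proof -
  have b_diff: "b (\<lambda>x. f x - g x) h = b f h - b g h" if "L2_cell f" "L2_cell g" "L2_cell h" for f g h
    using b_add[OF that(1) L2_scale[OF that(2), of "-1"] that(3)] b_scale[OF that(2,3), of "-1"] by simp
  have q_nonneg: "0 \<le> b f f" if "L2_cell f" for f
    using b_lower[OF that] m nsq_nonneg[of f] by (meson mult_nonneg_nonneg less_imp_le order_trans)
  have expand: "b (\<lambda>x. f x - c *\<^sub>R g x) (\<lambda>x. f x - c *\<^sub>R g x) = b f f - 2 * c * b f g + c\<^sup>2 * b g g"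
    if f: "L2_cell f" and g: "L2_cell g" for f g c
  proof -
    note cg = L2_scale[OF g, of c]
    note d = L2_diff[OF f cg]
    have "b (\<lambda>x. f x - c *\<^sub>R g x) (\<lambda>x. f x - c *\<^sub>R g x)
        = b (\<lambda>x. f x - c *\<^sub>R g x) f - c * b (\<lambda>x. f x - c *\<^sub>R g x) g"
      using b_diff[OF f cg d] b_scale[OF g d] b_sym[OF f d] b_sym[OF g d] by simp
    also have "b (\<lambda>x. f x - c *\<^sub>R g x) f = b f f - c * b f g"
      using b_diff[OF f cg f] b_scale[OF g f] b_sym[OF f g] by simp
    also have "b (\<lambda>x. f x - c *\<^sub>R g x) g = b f g - c * b g g"
      using b_diff[OF f cg g] b_scale[OF g g] by simp
    finally show ?thesis by (simp add: power2_eq_square algebra_simps)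
  qed
  have CS: "(b f g)\<^sup>2 \<le> b f f * b g g" if "L2_cell f" "L2_cell g" for f g
    by (rule discriminant_bound)
       (use expand[OF that] q_nonneg[OF L2_diff[OF that(1) L2_scale[OF that(2)]]] q_nonneg[OF that(2)] in auto)
  define q where "q s = b (\<lambda>x. f0 x - s x) (\<lambda>x. f0 x - s x)" for s
  define d where "d = (INF s\<in>S. q s)"
  have bdd: "bdd_below (q ` S)"
    unfolding q_def by (rule bdd_belowI[of _ 0]) (auto intro!: q_nonneg L2_diff f0 intro: S_L2)
  have d_le: "d \<le> q s" if "s \<in> S" for s
    unfolding d_def by (rule cINF_lower[OF bdd that])
  have "\<exists>s\<in>S. q s < d + e" if "0 < e" for e
    using cINF_less_iff[of S q "d + e"] bdd S_zero that unfolding d_def by auto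
  then have "\<exists>s. s \<in> S \<and> q s < d + 1 / real (Suc n)" for n
    by (metis of_nat_0_less_iff zero_less_Suc zero_less_divide_1_iff)
  then obtain s where sS: "\<And>n. s n \<in> S" and s: "\<And>n. q (s n) < d + 1 / real (Suc n)"
    by metis
  note sL = S_L2[OF sS]
  \<comment> \<open>First variation at an almost-minimizer: perturbing \<open>s n\<close> by any
    multiple of \<open>t\<close> lowers \<open>q\<close> by at most 1/(n+1), so the discriminant
    bounds the linear term.\<close>
  have near: "(b (\<lambda>x. f0 x - s n x) t)\<^sup>2 \<le> 1 / real (Suc n) * b t t" if t: "t \<in> S" for n t
  proof (rule discriminant_bound)
    fix c
    have "(\<lambda>x. s n x + c *\<^sub>R t x) \<in> S" by (intro S_add S_scale sS t)
    from d_le[OF this] have "d \<le> b (\<lambda>x. (f0 x - s n x) - c *\<^sub>R t x) (\<lambda>x. (f0 x - s n x) - c *\<^sub>R t x)"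
      by (simp add: q_def diff_diff_eq)
    then show "0 \<le> 1 / real (Suc n) - 2 * c * b (\<lambda>x. f0 x - s n x) t + c\<^sup>2 * b t t"
      using s[of n] expand[OF L2_diff[OF f0 sL] S_L2[OF t], of n c] by (simp add: q_def)
  qed (rule q_nonneg[OF S_L2[OF t]])
  \<comment> \<open>Parallelogram identity: the midpoint of \<open>s i\<close> and
    \<open>s j\<close> lies in \<open>S\<close>, hence has \<open>q\<close> at least
    \<open>d\<close>, which leaves little room for the difference.\<close>
  have par: "m * nsq (\<lambda>x. s i x - s j x) \<le> 2 / real (Suc i) + 2 / real (Suc j)" for i j
  proof -
    let ?u = "\<lambda>x. f0 x - s i x" and ?v = "\<lambda>x. f0 x - s j x"
    have u: "L2_cell ?u" and v: "L2_cell ?v" by (auto intro: L2_diff f0 sL)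
    have "(\<lambda>x. (1/2) *\<^sub>R (s i x + s j x)) \<in> S" by (intro S_add S_scale sS)
    from d_le[OF this]
    have "d \<le> b (\<lambda>x. (1/2) *\<^sub>R (?u x + ?v x)) (\<lambda>x. (1/2) *\<^sub>R (?u x + ?v x))"
    proof -
      have "(\<lambda>x. f0 x - (1/2) *\<^sub>R (s i x + s j x)) = (\<lambda>x. (1/2) *\<^sub>R (?u x + ?v x))"
        by (auto simp: fun_eq_iff algebra_simps simp flip: scaleR_add_left)
      then show ?thesis
        using \<open>d \<le> q _\<close> by (simp add: q_def)
    qed
    also have "\<dots> = (1/4) * b (\<lambda>x. ?u x + ?v x) (\<lambda>x. ?u x + ?v x)"
      using b_scale[OF L2_add[OF u v] L2_scale[OF L2_add[OF u v]], of "1/2" "1/2"]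
        b_sym[OF L2_add[OF u v] L2_scale[OF L2_add[OF u v]], of "1/2"]
        b_scale[OF L2_add[OF u v] L2_add[OF u v], of "1/2"] by simp
    finally have 1: "4 * d \<le> b (\<lambda>x. ?u x + ?v x) (\<lambda>x. ?u x + ?v x)" by simp
    have 2: "b (\<lambda>x. ?u x + ?v x) (\<lambda>x. ?u x + ?v x) = b ?u ?u + 2 * b ?u ?v + b ?v ?v"
      using expand[OF u v, of "-1"] by (simp only: scaleR_minus1_left diff_minus_eq_add) simp
    have 3: "b (\<lambda>x. s j x - s i x) (\<lambda>x. s j x - s i x) = b ?u ?u - 2 * b ?u ?v + b ?v ?v"
      using expand[OF u v, of 1] by simp
    have "m * nsq (\<lambda>x. s j x - s i x) \<le> b (\<lambda>x. s j x - s i x) (\<lambda>x. s j x - s i x)"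
      by (rule b_lower[OF L2_diff[OF sL sL]])
    then show ?thesis
      using 1 2 3 s[of i] s[of j] nsq_minus_commute[of "s j" "s i"] by (simp add: q_def)
  qed
  have "\<exists>N. \<forall>i\<ge>N. \<forall>j\<ge>N. nsq (\<lambda>x. s i x - s j x) < e" if e: "0 < e" for e
  proof -
    obtain N where N: "inverse (real (Suc N)) < e * m / 4"
      using reals_Archimedean[of "e * m / 4"] e m by auto
    have "nsq (\<lambda>x. s i x - s j x) < e" if "i \<ge> N" "j \<ge> N" for i j
    proof -
      have "2 / real (Suc i) \<le> 2 / real (Suc N)" "2 / real (Suc j) \<le> 2 / real (Suc N)"
        using that by (auto intro!: divide_left_mono)
      then have "m * nsq (\<lambda>x. s i x - s j x) \<le> 2 / real (Suc N) + 2 / real (Suc N)"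
        using par[of i j] by linarith
      also have "\<dots> = 4 * inverse (real (Suc N))" by (simp add: divide_inverse)
      also have "\<dots> < e * m" using N by simp
      finally show ?thesis using m by (simp add: mult.commute)
    qed
    then show ?thesis by blast
  qed
  from L2_complete[OF sL this] obtain f where
    f: "L2_cell f" and sf: "(\<lambda>n. nsq (\<lambda>x. s n x - f x)) \<longlonglongrightarrow> 0" by blast
  have fS: "f \<in> S" by (rule S_closed[OF sS f sf])
  have "b (\<lambda>x. f0 x - f x) t = 0" if t: "t \<in> S" for t
  proof -
    note tL = S_L2[OF t]
    have "(\<lambda>n. (b (\<lambda>x. f0 x - s n x) t)\<^sup>2) \<longlonglongrightarrow> 0"
    proof (rule tendsto_sandwich[of "\<lambda>n. 0"])
      show "\<forall>\<^sub>F n in sequentially. (b (\<lambda>x. f0 x - s n x) t)\<^sup>2 \<le> 1 / real (Suc n) * b t t"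
        using near[OF t] by (intro always_eventually) blast
      show "(\<lambda>n. 1 / real (Suc n) * b t t) \<longlonglongrightarrow> 0"
        using tendsto_mult_right[OF LIMSEQ_inverse_real_of_nat, of "b t t"] by (simp add: divide_inverse)
    qed auto
    then have 1: "(\<lambda>n. b (\<lambda>x. f0 x - s n x) t) \<longlonglongrightarrow> 0"
      using tendsto_null_power by force
    \<comment> \<open>The upper bound on \<open>b\<close> makes it continuous in L2, so
      near-orthogonality of \<open>f0 - s n\<close> passes to the limit \<open>f\<close>.\<close>
    have "(\<lambda>n. (b (\<lambda>x. s n x - f x) t)\<^sup>2) \<longlonglongrightarrow> 0"
    proof (rule tendsto_sandwich[of "\<lambda>n. 0"])
      show "\<forall>\<^sub>F n in sequentially. (b (\<lambda>x. s n x - f x) t)\<^sup>2 \<le> C * nsq (\<lambda>x. s n x - f x) * b t t"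
        using CS[OF L2_diff[OF sL f] tL] b_upper[OF L2_diff[OF sL f]] q_nonneg[OF tL]
        by (intro always_eventually allI) (meson mult_right_mono order_trans)
      show "(\<lambda>n. C * nsq (\<lambda>x. s n x - f x) * b t t) \<longlonglongrightarrow> 0"
        using tendsto_mult_right[OF tendsto_mult_left[OF sf, of C], of "b t t"] by simp
    qed auto
    then have 2: "(\<lambda>n. b (\<lambda>x. s n x - f x) t) \<longlonglongrightarrow> 0"
      using tendsto_null_power by force
    have "b (\<lambda>x. f0 x - s n x) t + b (\<lambda>x. s n x - f x) t = b (\<lambda>x. f0 x - f x) t" for n
      using b_diff f0 sL f tL by simp
    with tendsto_add[OF 1 2] show ?thesis
      using LIMSEQ_unique[OF tendsto_const] by simp
  qed
  then show ?thesis using fS by blast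
qed

section \<open>Periodic test functions and the Poincare inequality\<close>

text \<open>For continuous integrands this gives access to the translation, splitting, Fubini and
  fundamental theorems of the gauge integral.\<close>

lemma integral_cell:
  fixes f :: "real^2 \<Rightarrow> 'b::euclidean_space"
  assumes "continuous_on UNIV f"
  shows "(LINT x|\<mu>. f x) = integral cell f"
  by (rule lebesgue_integral_eq_integral[OF L2_integrable[OF L2_continuous[OF assms]]]) simp

lemma content_cell: "measure lborel (cbox 0 1 :: (real^2) set) = 1"
  by (simp add: content_cbox_if_cart interval_eq_empty_cart)

lemma integrable_cell:
  fixes f :: "real^2 \<Rightarrow> 'b::euclidean_space"
  assumes "continuous_on UNIV f"
  shows "f integrable_on cell"
  unfolding cell_def by (rule integrable_continuous[OF continuous_on_subset[OF assms]]) simp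

lemma integral_cell_const: "integral cell (\<lambda>x. c :: 'b::euclidean_space) = c"
  unfolding cell_def by (simp add: content_cell)

text \<open>The shifted cell is cut at coordinate 1; the slab that sticks out is moved back by one
  period and completes the rest to the original cell.\<close>

lemma periodic_shift_axis:
  fixes f :: "real^2 \<Rightarrow> 'b::euclidean_space"
  assumes cont: "continuous_on UNIV f" and per: "\<And>x. f (x + axis i 1) = f x"
    and t: "0 \<le> t" "t \<le> 1"
  shows "integral cell (\<lambda>x. f (x + t *\<^sub>R axis i 1)) = integral cell f"
proof -
  define e :: "real^2" where "e = axis i 1"
  have e: "e \<in> Basis" by (simp add: e_def)
  have xe: "x \<bullet> e = x $ i" for x :: "real^2" by (simp add: e_def inner_axis)
  have en: "e $ j = (if j = i then 1 else 0)" for j by (simp add: e_def axis_def)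
  \<comment> \<open>Upper corner of the slab of the cell on which the \<open>i\<close>-th coordinate
    is at most \<open>t\<close>.\<close>
  define b :: "real^2" where "b = (\<chi> j. if j = i then t else 1)"
  have ion: "f integrable_on cbox u v" for u v
    by (rule integrable_continuous[OF continuous_on_subset[OF cont]]) simp
  have low: "cbox 0 1 \<inter> {x. x \<bullet> e \<le> t} = cbox 0 b"
    using t by (auto simp: mem_box_cart xe b_def split: if_splits) (metis order_trans)+
  have high: "cbox (t *\<^sub>R e) (1 + t *\<^sub>R e) \<inter> {x. x \<bullet> e \<ge> 1} = cbox (0 + e) (b + e)"
    using t by (auto simp: mem_box_cart xe b_def en split: if_splits) (smt (verit))+
  have mid: "cbox (t *\<^sub>R e) (1 + t *\<^sub>R e) \<inter> {x. x \<bullet> e \<le> 1} = cbox 0 1 \<inter> {x. x \<bullet> e \<ge> t}"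
    using t by (auto simp: mem_box_cart xe en split: if_splits) (smt (verit))+
  have "integral cell (\<lambda>x. f (x + t *\<^sub>R e)) = integral (cbox (t *\<^sub>R e) (1 + t *\<^sub>R e)) f"
    unfolding cell_def
    using integral_shift_cbox[of "t *\<^sub>R e" "t *\<^sub>R e" "1 + t *\<^sub>R e" f] by simp
  also have "\<dots> = integral (cbox 0 1 \<inter> {x. x \<bullet> e \<ge> t}) f + integral (cbox (0 + e) (b + e)) f"
    using integral_split[OF ion e, of "t *\<^sub>R e" "1 + t *\<^sub>R e" 1] by (simp only: mid high)
  also have "integral (cbox (0 + e) (b + e)) f = integral (cbox 0 b) f"
    using integral_shift_cbox[of "0 + e" e "b + e" f] per by (simp add: e_def)
  also have "\<dots> = integral (cbox 0 1 \<inter> {x. x \<bullet> e \<le> t}) f" by (simp only: low)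
  also have "integral (cbox 0 1 \<inter> {x. x \<bullet> e \<ge> t}) f + integral (cbox 0 1 \<inter> {x. x \<bullet> e \<le> t}) f
      = integral cell f"
    using integral_split[OF ion e, of 0 1 t] by (simp add: cell_def)
  finally show ?thesis by (simp add: e_def)
qed

lemma periodic_shift:
  fixes f :: "real^2 \<Rightarrow> 'b::euclidean_space"
  assumes cont: "continuous_on UNIV f" and per: "\<And>x i. f (x + axis i 1) = f x"
    and h: "h \<in> cell"
  shows "integral cell (\<lambda>x. f (x + h)) = integral cell f"
proof -
  have bnd: "0 \<le> h $ i" "h $ i \<le> 1" for i
    using h by (auto simp: cell_def mem_box_cart)
  have eq: "x + h = x + h $ 1 *\<^sub>R axis 1 1 + h $ 2 *\<^sub>R axis 2 1" for x :: "real^2"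
    by (simp add: vec_eq_iff forall_2 axis_def)
  have "integral cell (\<lambda>x. f (x + h)) = integral cell (\<lambda>x. f (x + h $ 2 *\<^sub>R axis 2 1))"
    unfolding eq
  proof (rule periodic_shift_axis[of "\<lambda>x. f (x + h $ 2 *\<^sub>R axis 2 1)" 1 "h $ 1"])
    show "continuous_on UNIV (\<lambda>x. f (x + h $ 2 *\<^sub>R axis 2 1))"
      by (intro continuous_on_compose2[OF cont] continuous_intros) simp
    show "f (x + axis 1 1 + h $ 2 *\<^sub>R axis 2 1) = f (x + h $ 2 *\<^sub>R axis 2 1)" for x
      using per[of "x + h $ 2 *\<^sub>R axis 2 1" 1] by (simp add: add_ac)
  qed (rule bnd)+
  also have "\<dots> = integral cell f"
    by (rule periodic_shift_axis[OF cont per bnd])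
  finally show ?thesis .
qed

lemma test_fun_continuous:
  assumes "test_fun \<psi> \<psi>'"
  shows "continuous_on UNIV \<psi>" "continuous_on UNIV \<psi>'"
proof -
  have "isCont \<psi> x" for x
    using assms has_derivative_continuous[of \<psi> _ x UNIV] by (auto simp: test_fun_def)
  then show "continuous_on UNIV \<psi>" by (simp add: continuous_at_imp_continuous_on)
qed (use assms in \<open>simp add: test_fun_def\<close>)

lemma test_fun_L2:
  assumes "test_fun \<psi> \<psi>'"
  shows "L2_cell \<psi>" "L2_cell \<psi>'"
  by (rule L2_continuous test_fun_continuous[OF assms])+

text \<open>Periodicity of the gradient is not part of \<open>test_fun\<close>; it follows from
  uniqueness of the derivative.\<close>

lemma test_fun_periodic:
  assumes "test_fun \<psi> \<psi>'"
  shows "\<psi> (x + axis i 1) = \<psi> x" "\<psi>' (x + axis i 1) = \<psi>' x"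
proof -
  show per: "\<psi> (x + axis i 1) = \<psi> x" for x using assms by (simp add: test_fun_def)
  have d: "(\<psi> has_derivative (\<lambda>h. \<psi>' x \<bullet> h)) (at x)" for x using assms by (simp add: test_fun_def)
  have "((\<lambda>y. \<psi> (y + axis i 1)) has_derivative (\<lambda>h. \<psi>' (x + axis i 1) \<bullet> h)) (at x)"
    by (rule has_derivative_compose[where f = "\<lambda>y. y + axis i 1" and g = \<psi>, OF _ d])
       (auto intro!: derivative_eq_intros)
  then have "(\<psi> has_derivative (\<lambda>h. \<psi>' (x + axis i 1) \<bullet> h)) (at x)"
    by (simp add: per)
  from has_derivative_unique[OF this d] have "\<psi>' (x + axis i 1) \<bullet> h = \<psi>' x \<bullet> h" for h
    by (rule fun_cong)
  then show "\<psi>' (x + axis i 1) = \<psi>' x"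
    using vector_eq_rdot by blast
qed

lemma test_fun_FTC:
  assumes "test_fun \<psi> \<psi>'"
  shows "((\<lambda>t. \<psi>' (x + t *\<^sub>R h) \<bullet> h) has_integral \<psi> (x + h) - \<psi> x) {0..1}"
proof -
  have d: "(\<psi> has_derivative (\<lambda>h. \<psi>' x \<bullet> h)) (at x)" for x using assms by (simp add: test_fun_def)
  have "((\<lambda>t. \<psi> (x + t *\<^sub>R h)) has_vector_derivative \<psi>' (x + t *\<^sub>R h) \<bullet> h) (at t within {0..1})" for t
    unfolding has_vector_derivative_def
  proof (rule has_derivative_at_withinI)
    have "((\<lambda>t. \<psi> (x + t *\<^sub>R h)) has_derivative (\<lambda>s. \<psi>' (x + t *\<^sub>R h) \<bullet> (s *\<^sub>R h))) (at t)"
      by (rule has_derivative_compose[OF _ d]) (auto intro!: derivative_eq_intros)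
    then show "((\<lambda>t. \<psi> (x + t *\<^sub>R h)) has_derivative (\<lambda>s. s *\<^sub>R (\<psi>' (x + t *\<^sub>R h) \<bullet> h))) (at t)"
      by simp
  qed
  then show ?thesis
    using fundamental_theorem_of_calculus[of 0 1 "\<lambda>t. \<psi> (x + t *\<^sub>R h)"] by simp
qed

lemma continuous_on_line_shift:
  fixes g :: "real^2 \<Rightarrow> 'b::topological_space"
  assumes "continuous_on UNIV g"
  shows "continuous_on UNIV (\<lambda>(x, t). g (x + t *\<^sub>R h))"
  unfolding split_beta by (intro continuous_on_compose2[OF assms] continuous_intros) simp

lemma integral_swap_cell_line:
  fixes F :: "real^2 \<Rightarrow> real \<Rightarrow> real"
  assumes "continuous_on UNIV (\<lambda>(x, t). F x t)"
  shows "integral cell (\<lambda>x. integral {0..1} (F x)) = integral {0..1} (\<lambda>t. integral cell (\<lambda>x. F x t))"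
  using integral_swap_continuous[of "0 :: real^2" "0 :: real" 1 1 F] continuous_on_subset[OF assms]
  by (simp add: cell_def)

text \<open>Along an axis the derivative integrates to zero over one full period. Averaging over the
  starting point and exchanging the integrals turns this into the mean over the cell.\<close>

lemma test_fun_mean_gradient:
  assumes T: "test_fun \<psi> \<psi>'"
  shows "(LINT x|\<mu>. \<psi>' x) = 0"
proof -
  note c = test_fun_continuous(2)[OF T]
  have "integral cell (\<lambda>x. \<psi>' x \<bullet> axis i 1) = 0" for i :: 2
  proof -
    let ?e = "axis i 1 :: real^2"
    have ce: "continuous_on UNIV (\<lambda>x. \<psi>' x \<bullet> ?e)" by (intro continuous_intros c)
    have "integral cell (\<lambda>x. integral {0..1} (\<lambda>t. \<psi>' (x + t *\<^sub>R ?e) \<bullet> ?e)) = 0"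
      using integral_unique[OF test_fun_FTC[OF T]] test_fun_periodic(1)[OF T] by simp
    also have "integral cell (\<lambda>x. integral {0..1} (\<lambda>t. \<psi>' (x + t *\<^sub>R ?e) \<bullet> ?e))
        = integral {0..1} (\<lambda>t. integral cell (\<lambda>x. \<psi>' (x + t *\<^sub>R ?e) \<bullet> ?e))"
      by (rule integral_swap_cell_line[OF continuous_on_line_shift[OF ce]])
    also have "\<dots> = integral {0..1} (\<lambda>t::real. integral cell (\<lambda>x. \<psi>' x \<bullet> ?e))"
      by (intro integral_cong periodic_shift_axis[of "\<lambda>x. \<psi>' x \<bullet> ?e"] ce)
         (auto simp: test_fun_periodic[OF T])
    finally show ?thesis by simp
  qed
  then have "(LINT x|\<mu>. \<psi>' x \<bullet> axis i 1) = 0" for i :: 2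
    by (subst integral_cell) (auto intro!: continuous_intros c)
  then have "(LINT x|\<mu>. \<psi>' x) \<bullet> axis i 1 = 0" for i :: 2
    using integral_inner_left[of "axis i 1" \<mu> \<psi>'] L2_integrable[OF test_fun_L2(2)[OF T]] by simp
  then show ?thesis by (simp add: vec_eq_iff inner_axis)
qed

lemma test_fun_const: "test_fun (\<lambda>x. c) (\<lambda>x. 0)"
  by (auto simp: test_fun_def)

lemma test_fun_mult:
  assumes "test_fun \<psi> \<psi>'" "test_fun \<eta> \<eta>'"
  shows "test_fun (\<lambda>x. \<psi> x * \<eta> x) (\<lambda>x. \<psi> x *\<^sub>R \<eta>' x + \<eta> x *\<^sub>R \<psi>' x)"
  unfolding test_fun_def
proof (intro conjI allI)
  fix x
  have "((\<lambda>x. \<psi> x * \<eta> x) has_derivative (\<lambda>h. \<psi> x * (\<eta>' x \<bullet> h) + (\<psi>' x \<bullet> h) * \<eta> x)) (at x)"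
    using assms by (intro has_derivative_mult) (auto simp: test_fun_def)
  then show "((\<lambda>x. \<psi> x * \<eta> x) has_derivative (\<lambda>h. (\<psi> x *\<^sub>R \<eta>' x + \<eta> x *\<^sub>R \<psi>' x) \<bullet> h)) (at x)"
    by (simp add: inner_add_left mult.commute)
  show "\<psi> (x + axis i 1) * \<eta> (x + axis i 1) = \<psi> x * \<eta> x" for i
    using assms by (simp add: test_fun_def)
next
  show "continuous_on UNIV (\<lambda>x. \<psi> x *\<^sub>R \<eta>' x + \<eta> x *\<^sub>R \<psi>' x)"
    by (intro continuous_intros test_fun_continuous[OF assms(1)] test_fun_continuous[OF assms(2)])
qed

lemma test_fun_add:
  assumes "test_fun \<psi> \<psi>'" "test_fun \<eta> \<eta>'"
  shows "test_fun (\<lambda>x. \<psi> x + \<eta> x) (\<lambda>x. \<psi>' x + \<eta>' x)"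
  using assms by (auto simp: test_fun_def inner_add_left intro!: has_derivative_add continuous_intros)

lemma test_fun_scale:
  assumes "test_fun \<psi> \<psi>'"
  shows "test_fun (\<lambda>x. c * \<psi> x) (\<lambda>x. c *\<^sub>R \<psi>' x)"
  using assms by (auto simp: test_fun_def intro!: has_derivative_mult_right continuous_intros)

text \<open>The gradient of the product has mean zero.\<close>

lemma test_fun_by_parts:
  assumes T: "test_fun \<psi> \<psi>'" and U: "test_fun \<eta> \<eta>'"
  shows "(LINT x|\<mu>. \<psi> x *\<^sub>R \<eta>' x) = - (LINT x|\<mu>. \<eta> x *\<^sub>R \<psi>' x)"
proof -
  have "integrable \<mu> (\<lambda>x. \<psi> x *\<^sub>R \<eta>' x)" "integrable \<mu> (\<lambda>x. \<eta> x *\<^sub>R \<psi>' x)"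
    by (intro L2_integrable L2_continuous continuous_intros test_fun_continuous[OF T] test_fun_continuous[OF U])+
  then have "(LINT x|\<mu>. \<psi> x *\<^sub>R \<eta>' x) + (LINT x|\<mu>. \<eta> x *\<^sub>R \<psi>' x)
      = (LINT x|\<mu>. \<psi> x *\<^sub>R \<eta>' x + \<eta> x *\<^sub>R \<psi>' x)"
    by simp
  also have "\<dots> = 0" by (rule test_fun_mean_gradient[OF test_fun_mult[OF T U]])
  finally show ?thesis by (simp add: eq_neg_iff_add_eq_0)
qed

lemma test_fun_H1_per:
  assumes "test_fun \<phi> \<phi>'"
  shows "H1_per \<phi> \<phi>'"
  using test_fun_L2[OF assms] test_fun_by_parts[OF assms] by (auto simp: H1_per_def)

text \<open>Nonnegativity of the variance on a box of measure 1.\<close>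

lemma integral_power2_le:
  fixes f :: "'a::euclidean_space \<Rightarrow> real"
  assumes c: "continuous_on (cbox a b) f" and 1: "measure lborel (cbox a b) = 1"
  shows "(integral (cbox a b) f)\<^sup>2 \<le> integral (cbox a b) (\<lambda>x. (f x)\<^sup>2)"
proof -
  let ?I = "integral (cbox a b)" and ?m = "integral (cbox a b) f"
  have i: "f integrable_on cbox a b" "(\<lambda>x. (f x)\<^sup>2) integrable_on cbox a b"
    by (intro integrable_continuous continuous_intros c)+
  have "0 \<le> ?I (\<lambda>x. (f x - ?m)\<^sup>2)"
    by (rule integral_nonneg) (auto intro!: integrable_continuous continuous_intros c)
  also have "(\<lambda>x. (f x - ?m)\<^sup>2) = (\<lambda>x. (f x)\<^sup>2 - (2 * ?m) * f x + ?m\<^sup>2)"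
    by (auto simp: power2_diff)
  also have "?I \<dots> = ?I (\<lambda>x. (f x)\<^sup>2) - (2 * ?m) * ?m + ?m\<^sup>2"
    using i 1 integrable_on_cmult_left[OF i(1), of "2 * ?m"]
    by (subst integral_add integral_diff integral_mult_right integrable_diff; auto)+
  finally show ?thesis by (simp add: power2_eq_square)
qed

text \<open>
  For mean-zero \<open>p\<close> and \<open>x\<close> in the cell, \<open>p x\<close> is minus the average over \<open>h\<close> of
  \<open>p (x + h) - p x\<close>; periodicity makes the integral over \<open>x\<close> of \<open>|p' (x + t h)|\<^sup>2\<close> independent of \<open>t\<close> and \<open>h\<close>.
\<close>

theorem Poincare:
  assumes T: "test_fun p p'" and mean: "(LINT x|\<mu>. p x) = 0"
  shows "nsq p \<le> 2 * nsq p'"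
proof -
  note c = test_fun_continuous[OF T]
  note cc = continuous_on_compose2[OF c(1)] continuous_on_compose2[OF c(2)]
  define N where "N = integral cell (\<lambda>x. (norm (p' x))\<^sup>2)"
  have nsq_p': "nsq p' = N"
    unfolding nsq_def N_def by (rule integral_cell) (intro continuous_intros c)
  have mean': "integral cell p = 0"
    using mean integral_cell[OF c(1)] by simp
  define D where "D x h = p (x + h) - p x" for x h
  have cD: "continuous_on UNIV (\<lambda>(x, h). (D x h)\<^sup>2)"
    unfolding D_def split_beta by (intro continuous_intros cc) auto
  have cD1: "continuous_on UNIV (D x)" for x
    unfolding D_def by (intro continuous_intros cc) auto
  have cD2: "continuous_on UNIV (\<lambda>x. D x h)" for h
    unfolding D_def by (intro continuous_intros cc) auto
  have 1: "(p x)\<^sup>2 \<le> integral cell (\<lambda>h. (D x h)\<^sup>2)" if x: "x \<in> cell" for x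
  proof -
    have "integral cell (\<lambda>h. p (x + h)) = 0"
      using periodic_shift[OF c(1) test_fun_periodic(1)[OF T] x] mean' by (simp add: add.commute)
    moreover have "(\<lambda>h. p (x + h)) integrable_on cell"
      by (intro integrable_cell cc continuous_intros) auto
    ultimately have "integral cell (D x) = - p x"
      unfolding D_def
      by (subst integral_diff) (auto simp: integral_cell_const intro: integrable_cell)
    then show ?thesis
      using integral_power2_le[of 0 1 "D x"] continuous_on_subset[OF cD1, of "cbox 0 1"]
      by (simp add: content_cell cell_def)
  qed
  have 2: "(D x h)\<^sup>2 \<le> integral {0..1} (\<lambda>t. 2 * (norm (p' (x + t *\<^sub>R h)))\<^sup>2)" if h: "h \<in> cell" for x h
  proof -
    have bnd: "0 \<le> h $ i" "h $ i \<le> 1" for i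
      using h by (auto simp: cell_def mem_box_cart)
    have "(norm h)\<^sup>2 = (h $ 1)\<^sup>2 + (h $ 2)\<^sup>2"
      by (simp add: norm_eq_sqrt_inner inner_vec_def sum_2 power2_eq_square)
    also have "\<dots> \<le> 1 + 1"
      using bnd by (intro add_mono) (auto simp: power_le_one)
    \<comment> \<open>Source of the constant 2 in the inequality: the squared diagonal of the
      cell.\<close>
    finally have h2: "(norm h)\<^sup>2 \<le> 2" by simp
    have "(D x h)\<^sup>2 = (integral {0..1} (\<lambda>t. p' (x + t *\<^sub>R h) \<bullet> h))\<^sup>2"
      unfolding D_def using integral_unique[OF test_fun_FTC[OF T]] by simp
    also have "\<dots> \<le> integral {0..1} (\<lambda>t. (p' (x + t *\<^sub>R h) \<bullet> h)\<^sup>2)"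
      using integral_power2_le[of 0 1 "\<lambda>t. p' (x + t *\<^sub>R h) \<bullet> h"]
      by (force intro!: continuous_intros cc)
    also have "\<dots> \<le> integral {0..1} (\<lambda>t. 2 * (norm (p' (x + t *\<^sub>R h)))\<^sup>2)"
    proof (rule integral_le)
      fix t :: real
      have "(p' (x + t *\<^sub>R h) \<bullet> h)\<^sup>2 \<le> (norm (p' (x + t *\<^sub>R h)))\<^sup>2 * (norm h)\<^sup>2"
        using Cauchy_Schwarz_ineq[of "p' (x + t *\<^sub>R h)" h] by (simp add: dot_square_norm)
      also have "\<dots> \<le> (norm (p' (x + t *\<^sub>R h)))\<^sup>2 * 2"
        using h2 by (intro mult_left_mono) auto
      finally show "(p' (x + t *\<^sub>R h) \<bullet> h)\<^sup>2 \<le> 2 * (norm (p' (x + t *\<^sub>R h)))\<^sup>2" by simp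
    qed (auto intro!: integrable_continuous_real continuous_intros cc)
    finally show ?thesis .
  qed
  have 3: "integral cell (\<lambda>x. (D x h)\<^sup>2) \<le> 2 * N" if h: "h \<in> cell" for h
  proof -
    let ?g = "\<lambda>x. 2 * (norm (p' x))\<^sup>2"
    have cg: "continuous_on UNIV ?g" by (intro continuous_intros c)
    have "integral cell (\<lambda>x. (D x h)\<^sup>2) \<le> integral cell (\<lambda>x. integral {0..1} (\<lambda>t. ?g (x + t *\<^sub>R h)))"
    proof (rule integral_le)
      have "continuous_on UNIV (\<lambda>x. integral (cbox 0 1) (\<lambda>t::real. ?g (x + t *\<^sub>R h)))"
        by (rule integral_continuous_on_param)
           (rule continuous_on_subset[OF continuous_on_line_shift[OF cg, of h]], simp)
      then show "(\<lambda>x. integral {0..1} (\<lambda>t. ?g (x + t *\<^sub>R h))) integrable_on cell"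
        by (intro integrable_cell) simp
    qed (use 2[OF h] in \<open>auto intro!: integrable_cell continuous_intros cD2\<close>)
    also have "\<dots> = integral {0..1} (\<lambda>t. integral cell (\<lambda>x. ?g (x + t *\<^sub>R h)))"
      by (rule integral_swap_cell_line[OF continuous_on_line_shift[OF cg]])
    also have "\<dots> = integral {0..1} (\<lambda>t::real. integral cell ?g)"
    proof (rule integral_cong)
      fix t :: real assume "t \<in> {0..1}"
      then have "t *\<^sub>R h \<in> cell"
        using h by (auto simp: cell_def mem_box_cart intro: mult_le_one)
      then show "integral cell (\<lambda>x. ?g (x + t *\<^sub>R h)) = integral cell ?g"
        by (intro periodic_shift[of ?g] cg) (simp_all add: test_fun_periodic[OF T])
    qed
    also have "\<dots> = 2 * N" by (simp add: N_def)
    finally show ?thesis .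
  qed
  have "nsq p = integral cell (\<lambda>x. (p x)\<^sup>2)"
    unfolding nsq_def real_norm_def power2_abs by (rule integral_cell) (intro continuous_intros c)
  also have "\<dots> \<le> integral cell (\<lambda>x. integral cell (\<lambda>h. (D x h)\<^sup>2))"
  proof (rule integral_le)
    have "continuous_on UNIV (\<lambda>x. integral (cbox 0 1) (\<lambda>h. (D x h)\<^sup>2))"
      by (rule integral_continuous_on_param) (rule continuous_on_subset[OF cD], simp)
    then show "(\<lambda>x. integral cell (\<lambda>h. (D x h)\<^sup>2)) integrable_on cell"
      by (intro integrable_cell) (simp add: cell_def)
  qed (use 1 in \<open>auto intro!: integrable_cell continuous_intros c\<close>)
  also have "\<dots> = integral cell (\<lambda>h. integral cell (\<lambda>x. (D x h)\<^sup>2))"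
    unfolding cell_def
    by (rule integral_swap_continuous) (rule continuous_on_subset[OF cD], simp)
  also have "\<dots> \<le> integral cell (\<lambda>h::real^2. 2 * N)"
  proof (rule integral_le)
    have "continuous_on UNIV (\<lambda>h. integral (cbox 0 1) (\<lambda>x. (D x h)\<^sup>2))"
      by (rule integral_continuous_on_param)
         (unfold D_def split_beta, intro continuous_intros cc, auto)
    then show "(\<lambda>h. integral cell (\<lambda>x. (D x h)\<^sup>2)) integrable_on cell"
      by (intro integrable_cell) (simp add: cell_def)
  qed (use 3 in \<open>auto intro!: integrable_cell continuous_intros\<close>)
  also have "\<dots> = 2 * N" by (rule integral_cell_const)
  finally show ?thesis by (simp add: nsq_p')
qed

section \<open>Completeness of the trigonometric system\<close>

definition dual_lattice :: "(real^2) set" where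
  "dual_lattice = {w. \<forall>i. \<exists>n::int. w $ i = 2 * pi * n}"

text \<open>Real waves are used, so that no complex-valued fields occur. Constants arise from the
  frequency 0.\<close>

inductive trig_poly :: "(real^2 \<Rightarrow> real) \<Rightarrow> bool" where
  cos: "w \<in> dual_lattice \<Longrightarrow> trig_poly (\<lambda>x. cos (w \<bullet> x))"
| sin: "w \<in> dual_lattice \<Longrightarrow> trig_poly (\<lambda>x. sin (w \<bullet> x))"
| add: "trig_poly u \<Longrightarrow> trig_poly v \<Longrightarrow> trig_poly (\<lambda>x. u x + v x)"
| scale: "trig_poly u \<Longrightarrow> trig_poly (\<lambda>x. c * u x)"

lemma dual_lattice_add: "w \<in> dual_lattice \<Longrightarrow> w' \<in> dual_lattice \<Longrightarrow> w + w' \<in> dual_lattice"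
  by (simp add: dual_lattice_def) (metis distrib_left of_int_add)

lemma dual_lattice_diff: "w \<in> dual_lattice \<Longrightarrow> w' \<in> dual_lattice \<Longrightarrow> w - w' \<in> dual_lattice"
  by (simp add: dual_lattice_def) (metis right_diff_distrib of_int_diff)

lemma dual_lattice_zero: "0 \<in> dual_lattice"
  by (auto simp: dual_lattice_def intro: exI[of _ 0])

lemma dual_lattice_axis: "axis i (2 * pi) \<in> dual_lattice"
  by (auto simp: dual_lattice_def axis_def intro: exI[of _ 0] exI[of _ 1])

lemma trig_poly_const: "trig_poly (\<lambda>x. c)"
  using trig_poly.scale[OF trig_poly.cos[OF dual_lattice_zero], of c] by simp

text \<open>Product-to-sum formulas; sums and differences of frequencies stay in
  \<open>dual_lattice\<close>.\<close>

lemma trig_poly_mult_wave: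
  assumes "trig_poly u" and w: "w \<in> dual_lattice"
  shows "trig_poly (\<lambda>x. cos (w \<bullet> x) * u x) \<and> trig_poly (\<lambda>x. sin (w \<bullet> x) * u x)"
  using assms(1)
proof induction
  case (cos v)
  note d = dual_lattice_add[OF w cos] dual_lattice_diff[OF w cos]
  have 1: "(\<lambda>x. cos (w \<bullet> x) * cos (v \<bullet> x)) = (\<lambda>x. (1/2) * cos ((w - v) \<bullet> x) + (1/2) * cos ((w + v) \<bullet> x))"
    by (simp add: fun_eq_iff inner_add_left inner_diff_left cos_add cos_diff field_simps)
  have 2: "(\<lambda>x. sin (w \<bullet> x) * cos (v \<bullet> x)) = (\<lambda>x. (1/2) * sin ((w + v) \<bullet> x) + (1/2) * sin ((w - v) \<bullet> x))"
    by (simp add: fun_eq_iff inner_add_left inner_diff_left sin_add sin_diff field_simps)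
  show ?case unfolding 1 2 by (intro conjI trig_poly.intros d)
next
  case (sin v)
  note d = dual_lattice_add[OF w sin] dual_lattice_diff[OF w sin]
  have 1: "(\<lambda>x. cos (w \<bullet> x) * sin (v \<bullet> x)) = (\<lambda>x. (1/2) * sin ((w + v) \<bullet> x) + (-1/2) * sin ((w - v) \<bullet> x))"
    by (simp add: fun_eq_iff inner_add_left inner_diff_left sin_add sin_diff field_simps)
  have 2: "(\<lambda>x. sin (w \<bullet> x) * sin (v \<bullet> x)) = (\<lambda>x. (1/2) * cos ((w - v) \<bullet> x) + (-1/2) * cos ((w + v) \<bullet> x))"
    by (simp add: fun_eq_iff inner_add_left inner_diff_left cos_add cos_diff field_simps)
  show ?case unfolding 1 2 by (intro conjI trig_poly.intros d)
next
  case (add u v)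
  then show ?case by (simp add: distrib_left trig_poly.add)
next
  case (scale u c)
  then show ?case
    using trig_poly.scale[of "\<lambda>x. cos (w \<bullet> x) * u x" c] trig_poly.scale[of "\<lambda>x. sin (w \<bullet> x) * u x" c]
    by (simp add: mult.left_commute)
qed

lemma trig_poly_mult:
  assumes "trig_poly u" "trig_poly v"
  shows "trig_poly (\<lambda>x. u x * v x)"
  using assms(1)
proof induction
  case (add u u')
  then show ?case by (simp add: distrib_right trig_poly.add)
next
  case (scale u c)
  then show ?case
    using trig_poly.scale[of "\<lambda>x. u x * v x" c] by (simp add: mult.assoc)
qed (use trig_poly_mult_wave[OF assms(2)] in auto)

text \<open>Embedding of the torus into R^4 as a product of two circles. Its coordinates are the
  basic waves, so polynomials on R^4 pull back to trigonometric polynomials and Stone-Weierstrass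
  applies to the compact image of the cell.\<close>

definition torus_map :: "real^2 \<Rightarrow> (real^2) \<times> (real^2)" where
  "torus_map x = ((\<chi> i. cos (2 * pi * x $ i)), (\<chi> i. sin (2 * pi * x $ i)))"

lemma torus_map_continuous: "continuous_on S torus_map"
  unfolding torus_map_def by (intro continuous_intros continuous_on_vec_lambda)

text \<open>Equal images differ by integers in each coordinate. The open box for \<open>y\<close>
  excludes the opposite faces of the cell, which the map does identify.\<close>

lemma torus_map_eq:
  assumes "x \<in> cell" "y \<in> box 0 1" "torus_map x = torus_map y"
  shows "x = y"
proof -
  have "x $ i = y $ i" for i
  proof -
    have "sin (2 * pi * x $ i) = sin (2 * pi * y $ i) \<and> cos (2 * pi * x $ i) = cos (2 * pi * y $ i)"
      using assms(3) by (simp add: torus_map_def vec_eq_iff)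
    then obtain n :: int where "2 * pi * x $ i = 2 * pi * y $ i + 2 * pi * of_int n"
      using sin_cos_eq_iff by blast
    then have "2 * pi * x $ i = 2 * pi * (y $ i + of_int n)" by (simp add: distrib_left)
    then have n: "x $ i = y $ i + of_int n" by simp
    have "0 \<le> x $ i" "x $ i \<le> 1" "0 < y $ i" "y $ i < 1"
      using assms(1,2) by (auto simp: cell_def mem_box_cart)
    with n have "n = 0" by linarith
    with n show ?thesis by simp
  qed
  then show ?thesis by (simp add: vec_eq_iff)
qed

lemma polynomial_torus_map:
  assumes "real_polynomial_function P"
  shows "trig_poly (\<lambda>x. P (torus_map x))"
  using assms
proof induction
  case (linear f)
  then interpret bounded_linear f .
  have "torus_map x = (\<Sum>i\<in>UNIV. cos (axis i (2 * pi) \<bullet> x) *\<^sub>R (axis i 1, 0) + sin (axis i (2 * pi) \<bullet> x) *\<^sub>R (0, axis i 1))" for x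
    by (simp add: torus_map_def sum_2 vec_eq_iff forall_2 axis_def inner_vec_def)
  then have "f (torus_map x) = (f (axis 1 1, 0) * cos (axis 1 (2 * pi) \<bullet> x) + f (0, axis 1 1) * sin (axis 1 (2 * pi) \<bullet> x))
      + (f (axis 2 1, 0) * cos (axis 2 (2 * pi) \<bullet> x) + f (0, axis 2 1) * sin (axis 2 (2 * pi) \<bullet> x))" for x
    by (simp only: sum_2 add scaleR) simp
  then show ?case
    by (simp only:) (intro trig_poly.intros dual_lattice_axis)
qed (auto intro: trig_poly.add trig_poly_mult trig_poly_const)

text \<open>Integrability is part of the induction because the additive case has to split the
  integral.\<close>

lemma trig_poly_integral:
  assumes f: "integrable \<mu> f"
    and orth: "\<And>w. w \<in> dual_lattice \<Longrightarrow> (LINT x|\<mu>. cos (w \<bullet> x) * f x) = 0 \<and> (LINT x|\<mu>. sin (w \<bullet> x) * f x) = 0"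
    and u: "trig_poly u"
  shows "integrable \<mu> (\<lambda>x. u x * f x) \<and> (LINT x|\<mu>. u x * f x) = 0"
proof -
  have int: "integrable \<mu> (\<lambda>x. g x * f x)" if "continuous_on UNIV g" "\<And>x. \<bar>g x\<bar> \<le> 1" for g
  proof (rule Bochner_Integration.integrable_bound[OF f])
    show "(\<lambda>x. g x * f x) \<in> borel_measurable \<mu>"
      using continuous_measurable_cell[OF that(1)] f by auto
    show "AE x in \<mu>. norm (g x * f x) \<le> norm (f x)"
      using that(2) by (intro AE_I2) (simp add: abs_mult mult_left_le_one_le)
  qed
  show ?thesis
    using u
  proof induction
    case (cos w)
    then show ?case using orth by (auto intro!: int continuous_intros)
  next
    case (sin w)
    then show ?case using orth by (auto intro!: int continuous_intros)
  next
    case (add u v)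
    then show ?case by (simp add: distrib_right)
  next
    case (scale u c)
    then show ?case by (simp add: mult.assoc)
  qed
qed

text \<open>Uniform approximation of \<open>G\<close> by a polynomial on the compact image: the
  polynomial contributes 0, and the error is at most \<open>e\<close> times the L1 norm of
  \<open>f\<close>.\<close>

lemma continuous_torus_integral:
  assumes f: "integrable \<mu> f"
    and orth: "\<And>w. w \<in> dual_lattice \<Longrightarrow> (LINT x|\<mu>. cos (w \<bullet> x) * f x) = 0 \<and> (LINT x|\<mu>. sin (w \<bullet> x) * f x) = 0"
    and G: "continuous_on UNIV G" and Gb: "\<And>z. \<bar>G z\<bar> \<le> 1"
  shows "(LINT x|\<mu>. G (torus_map x) * f x) = 0"
proof -
  let ?I = "LINT x|\<mu>. \<bar>f x\<bar>"
  have cont: "continuous_on UNIV (\<lambda>x. G (torus_map x))"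
    by (intro continuous_on_compose2[OF G] torus_map_continuous) simp
  have iG: "integrable \<mu> (\<lambda>x. G (torus_map x) * f x)"
  proof (rule Bochner_Integration.integrable_bound[OF f])
    show "(\<lambda>x. G (torus_map x) * f x) \<in> borel_measurable \<mu>"
      using continuous_measurable_cell[OF cont] f by auto
    show "AE x in \<mu>. norm (G (torus_map x) * f x) \<le> norm (f x)"
      using Gb by (intro AE_I2) (simp add: abs_mult mult_left_le_one_le)
  qed
  have bound: "\<bar>LINT x|\<mu>. G (torus_map x) * f x\<bar> \<le> e * ?I" if e: "0 < e" for e
  proof -
    have "compact (torus_map ` cell)"
      unfolding cell_def by (intro compact_continuous_image torus_map_continuous compact_cbox)
    then obtain P where P: "real_polynomial_function P" "\<And>z. z \<in> torus_map ` cell \<Longrightarrow> \<bar>G z - P z\<bar> < e"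
      using Stone_Weierstrass_real_polynomial_function[OF _ continuous_on_subset[OF G subset_UNIV] e] by metis
    from trig_poly_integral[OF f orth polynomial_torus_map[OF P(1)]]
    have iP: "integrable \<mu> (\<lambda>x. P (torus_map x) * f x)" and P0: "(LINT x|\<mu>. P (torus_map x) * f x) = 0" by auto
    have "(LINT x|\<mu>. G (torus_map x) * f x) = (LINT x|\<mu>. G (torus_map x) * f x - P (torus_map x) * f x)"
      using iG iP P0 by simp
    also have "\<bar>\<dots>\<bar> \<le> (LINT x|\<mu>. \<bar>G (torus_map x) * f x - P (torus_map x) * f x\<bar>)"
      by (rule integral_abs_bound)
    also have "\<dots> \<le> (LINT x|\<mu>. e * \<bar>f x\<bar>)"
    proof (rule integral_mono)
      fix x assume "x \<in> space \<mu>"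
      then have "\<bar>G (torus_map x) - P (torus_map x)\<bar> \<le> e" using P(2)[of "torus_map x"] by (auto simp: less_imp_le)
      then show "\<bar>G (torus_map x) * f x - P (torus_map x) * f x\<bar> \<le> e * \<bar>f x\<bar>"
        by (simp add: abs_mult mult_right_mono flip: left_diff_distrib)
    qed (use iG iP f in auto)
    finally show ?thesis by simp
  qed
  show ?thesis
  proof (rule ccontr)
    let ?a = "\<bar>LINT x|\<mu>. G (torus_map x) * f x\<bar>"
    assume "(LINT x|\<mu>. G (torus_map x) * f x) \<noteq> 0"
    then have a: "0 < ?a" by simp
    obtain I where I: "I = ?I" "0 \<le> I" by simp
    \<comment> \<open>With this value as \<open>e\<close> the bound falls strictly below
      \<open>?a\<close>; the summand 1 covers \<open>I = 0\<close>.\<close>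
    have "0 < ?a / (2 * (I + 1))" using a I(2) by simp
    from bound[OF this] have "?a \<le> ?a / (2 * (I + 1)) * I" by (simp only: I(1))
    also have "\<dots> = ?a * (I / (2 * (I + 1)))" by simp
    also have "\<dots> < ?a * 1" using a I(2) by (intro mult_strict_left_mono) (auto simp: field_simps)
    finally show False by simp
  qed
qed

text \<open>
  The indicator of \<open>D\<close> is the limit of continuous functions on the torus, since the torus map is
  injective near \<open>D\<close>.
\<close>

lemma closed_set_integral:
  assumes f: "integrable \<mu> f"
    and orth: "\<And>w. w \<in> dual_lattice \<Longrightarrow> (LINT x|\<mu>. cos (w \<bullet> x) * f x) = 0 \<and> (LINT x|\<mu>. sin (w \<bullet> x) * f x) = 0"
    and D: "closed D" "D \<subseteq> box 0 1"
  shows "(LINT x|\<mu>. indicator D x * f x) = 0"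
proof (cases "D = {}")
  case False
  have "compact D"
    using D bounded_subset[OF bounded_box] by (simp add: compact_eq_bounded_closed)
  then have cD: "closed (torus_map ` D)"
    by (intro compact_imp_closed compact_continuous_image torus_map_continuous)
  \<comment> \<open>Tent functions around the image of \<open>D\<close>, which decrease to its
    indicator because the image is closed.\<close>
  define G where "G n z = max 0 (1 - real n * infdist z (torus_map ` D))" for n z
  have Gb: "\<bar>G n z\<bar> \<le> 1" for n z
    using infdist_nonneg[of z "torus_map ` D"] by (auto simp: G_def max_def)
  have "(LINT x|\<mu>. G n (torus_map x) * f x) = 0" for n
  proof (rule continuous_torus_integral[OF f orth])
    show "continuous_on UNIV (G n)"
      unfolding G_def by (intro continuous_intros)
  qed (auto simp: Gb)
  moreover have "(\<lambda>n. LINT x|\<mu>. G n (torus_map x) * f x) \<longlonglongrightarrow> (LINT x|\<mu>. indicator D x * f x)"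
  proof (rule integral_dominated_convergence[where w = "\<lambda>x. \<bar>f x\<bar>"])
    have "D \<inter> cell \<in> sets \<mu>"
      using D(1) by (auto simp: sets_restrict_space)
    then have "(\<lambda>x. indicator (D \<inter> cell) x :: real) \<in> borel_measurable \<mu>" by simp
    then have "(\<lambda>x. indicator (D \<inter> cell) x * f x) \<in> borel_measurable \<mu>" using f by auto
    then show "(\<lambda>x. indicator D x * f x) \<in> borel_measurable \<mu>"
      by (rule measurable_cong[THEN iffD1, rotated]) (auto simp: indicator_def)
    show "(\<lambda>x. G n (torus_map x) * f x) \<in> borel_measurable \<mu>" for n
    proof -
      have "continuous_on UNIV (\<lambda>x. G n (torus_map x))"
        unfolding G_def by (intro continuous_intros torus_map_continuous)
      from borel_measurable_times[OF continuous_measurable_cell[OF this] borel_measurable_integrable[OF f]]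
      show ?thesis .
    qed
    show "integrable \<mu> (\<lambda>x. \<bar>f x\<bar>)" using f by simp
    show "AE x in \<mu>. norm (G n (torus_map x) * f x) \<le> \<bar>f x\<bar>" for n
      using Gb by (intro AE_I2) (simp add: abs_mult mult_left_le_one_le)
    show "AE x in \<mu>. (\<lambda>n. G n (torus_map x) * f x) \<longlonglongrightarrow> indicator D x * f x"
    proof (rule AE_I2)
      fix x assume "x \<in> space \<mu>"
      then have x: "x \<in> cell" by simp
      have "(\<lambda>n. G n (torus_map x)) \<longlonglongrightarrow> indicator D x"
      proof (cases "x \<in> D")
        case True
        then have "infdist (torus_map x) (torus_map ` D) = 0" by simp
        then show ?thesis using True by (simp add: G_def)
      next
        case False
        then have "torus_map x \<notin> torus_map ` D"
          using torus_map_eq[OF x] D(2) by blast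
        then have pos: "0 < infdist (torus_map x) (torus_map ` D)"
          using cD \<open>D \<noteq> {}\<close> infdist_pos_not_in_closed by blast
        obtain N :: nat where N: "1 < real N * infdist (torus_map x) (torus_map ` D)"
          using reals_Archimedean3[OF pos] by blast
        have "G n (torus_map x) = 0" if "n \<ge> N" for n
        proof -
          have "real N * infdist (torus_map x) (torus_map ` D) \<le> real n * infdist (torus_map x) (torus_map ` D)"
            using that pos by (intro mult_right_mono) auto
          with N show ?thesis by (simp add: G_def)
        qed
        then have "(\<lambda>n. G n (torus_map x)) \<longlonglongrightarrow> 0"
          by (intro tendsto_eventually) (auto simp: eventually_sequentially)
        then show ?thesis using False by simp
      qed
      then show "(\<lambda>n. G n (torus_map x) * f x) \<longlonglongrightarrow> indicator D x * f x"
        by (rule tendsto_mult_right)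
    qed
  qed
  ultimately show ?thesis by (simp add: LIMSEQ_const_iff)
qed simp

text \<open>Inner regularity: a closed subset of the positivity set carries a zero integral of a
  positive function, hence is null, while it exhausts the set up to arbitrarily small
  measure.\<close>

lemma positive_part_null:
  assumes f: "integrable \<mu> f"
    and orth: "\<And>w. w \<in> dual_lattice \<Longrightarrow> (LINT x|\<mu>. cos (w \<bullet> x) * f x) = 0 \<and> (LINT x|\<mu>. sin (w \<bullet> x) * f x) = 0"
  shows "{x \<in> box 0 1. 0 < f x} \<in> null_sets lebesgue"
proof -
  have sub: "box 0 1 \<subseteq> cell" by (simp add: cell_def box_subset_cbox)
  define E where "E = {x \<in> box 0 1. 0 < f x}"
  have "{x \<in> space \<mu>. 0 < f x} \<in> sets \<mu>"
    by (rule borel_measurable_less[OF _ borel_measurable_integrable[OF f]]) simp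
  then have "{x \<in> cell. 0 < f x} \<in> sets lebesgue"
    by (simp add: sets_restrict_space_iff)
  then have "{x \<in> cell. 0 < f x} \<inter> box 0 1 \<in> sets lebesgue" by auto
  moreover have "E = {x \<in> cell. 0 < f x} \<inter> box 0 1" using sub by (auto simp: E_def)
  ultimately have E: "E \<in> sets lebesgue" by simp
  have "emeasure lebesgue E \<le> ennreal e" if e: "0 < e" for e
  proof -
    obtain T where T: "closed T" "T \<subseteq> E" "emeasure lebesgue (E - T) < ennreal e"
      using sets_lebesgue_inner_closed[OF E e] by metis
    have Tl: "T \<in> sets lebesgue" using T(1) by (simp add: borel_closed)
    have Tc: "T \<subseteq> cell" using T(2) sub by (auto simp: E_def)
    have Tm: "T \<in> sets \<mu>" using Tl Tc by (simp add: sets_restrict_space_iff)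
    have 0: "(LINT x|\<mu>. indicator T x * f x) = 0"
      using T(1,2) by (intro closed_set_integral[OF f orth]) (auto simp: E_def)
    have iT: "integrable \<mu> (\<lambda>x. indicator T x * f x)"
      using integrable_mult_indicator[OF Tm f] by simp
    have "AE x in \<mu>. indicator T x * f x = 0"
    proof (rule integral_nonneg_eq_0_iff_AE[OF iT, THEN iffD1, OF _ 0])
      show "AE x in \<mu>. 0 \<le> indicator T x * f x"
        using T(2) by (intro AE_I2) (auto simp: indicator_def E_def)
    qed
    then have "AE x in \<mu>. x \<notin> T"
      by (rule AE_mp, intro AE_I2) (use T(2) in \<open>auto simp: E_def indicator_def\<close>)
    then have "AE x in lebesgue. x \<in> cell \<longrightarrow> x \<notin> T"
      by (subst (asm) AE_restrict_space_iff) auto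
    then have "AE x in lebesgue. x \<notin> T" by (rule AE_mp) (use Tc in auto)
    then have T0: "emeasure lebesgue T = 0"
      using AE_iff_null_sets[OF Tl] by auto
    have "E = (E - T) \<union> T" using T(2) by auto
    then have "emeasure lebesgue E \<le> emeasure lebesgue (E - T) + emeasure lebesgue T"
      using emeasure_subadditive[of "E - T" lebesgue T] E Tl by auto
    then show ?thesis using T(3) T0 by simp
  qed
  then have "emeasure lebesgue E \<le> 0 + ennreal e" if "0 < e" for e
    using that by simp
  then have "emeasure lebesgue E \<le> 0" by (rule ennreal_le_epsilon)
  then show ?thesis using E by (auto simp: E_def null_sets_def)
qed

text \<open>The one-sided result is applied to \<open>f\<close> and to \<open>-f\<close>; the
  boundary of the cell, where the torus map is not injective, is a null set.\<close>

theorem trig_complete: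
  assumes f: "integrable \<mu> f"
    and orth: "\<And>w. w \<in> dual_lattice \<Longrightarrow> (LINT x|\<mu>. cos (w \<bullet> x) * f x) = 0 \<and> (LINT x|\<mu>. sin (w \<bullet> x) * f x) = 0"
  shows "AE x in \<mu>. f x = 0"
proof -
  have 1: "{x \<in> box 0 1. 0 < f x} \<in> null_sets lebesgue"
    by (rule positive_part_null[OF f orth])
  have 2: "{x \<in> box 0 1. 0 < - f x} \<in> null_sets lebesgue"
  proof (rule positive_part_null)
    show "integrable \<mu> (\<lambda>x. - f x)" using f by simp
    fix w assume "w \<in> dual_lattice"
    from orth[OF this]
    show "(LINT x|\<mu>. cos (w \<bullet> x) * - f x) = 0 \<and> (LINT x|\<mu>. sin (w \<bullet> x) * - f x) = 0" by simp
  qed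
  have 3: "cbox 0 1 - box 0 1 \<in> null_sets (lebesgue :: (real^2) measure)"
    using negligible_frontier_interval negligible_iff_null_sets by blast
  have "AE x in lebesgue. x \<in> cell \<longrightarrow> f x = 0"
    by (rule AE_I'[OF null_sets.Un[OF null_sets.Un[OF 1 2] 3]]) (auto simp: cell_def)
  then show ?thesis by (subst AE_restrict_space_iff) auto
qed

section \<open>Curl-free and divergence-free fields\<close>

text \<open>
  \<open>C\<^sup>2\<close> test functions. The symmetry of the Hessian \<open>\<psi>''\<close> is imposed instead of deduced.
\<close>

definition test_fun2 :: "(real^2 \<Rightarrow> real) \<Rightarrow> (real^2 \<Rightarrow> real^2) \<Rightarrow> (2 \<Rightarrow> real^2 \<Rightarrow> real^2) \<Rightarrow> bool" where
  "test_fun2 \<psi> \<psi>' \<psi>'' \<longleftrightarrow> test_fun \<psi> \<psi>' \<and> (\<forall>i. test_fun (\<lambda>x. \<psi>' x $ i) (\<psi>'' i)) \<and>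
     (\<forall>x. \<psi>'' 1 x $ 2 = \<psi>'' 2 x $ 1)"

lemma test_fun2_D: "test_fun2 \<psi> \<psi>' \<psi>'' \<Longrightarrow> test_fun \<psi> \<psi>'"
  by (simp add: test_fun2_def)

lemma test_fun2_add:
  "test_fun2 \<psi> \<psi>' \<psi>'' \<Longrightarrow> test_fun2 \<eta> \<eta>' \<eta>'' \<Longrightarrow>
    test_fun2 (\<lambda>x. \<psi> x + \<eta> x) (\<lambda>x. \<psi>' x + \<eta>' x) (\<lambda>i x. \<psi>'' i x + \<eta>'' i x)"
  by (auto simp: test_fun2_def intro: test_fun_add)

lemma test_fun2_scale:
  "test_fun2 \<psi> \<psi>' \<psi>'' \<Longrightarrow> test_fun2 (\<lambda>x. c * \<psi> x) (\<lambda>x. c *\<^sub>R \<psi>' x) (\<lambda>i x. c *\<^sub>R \<psi>'' i x)"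
  by (auto simp: test_fun2_def intro: test_fun_scale)

lemma test_fun2_const: "test_fun2 (\<lambda>x. c) (\<lambda>x. 0) (\<lambda>i x. 0)"
  by (auto simp: test_fun2_def intro: test_fun_const)

lemma dual_lattice_periodic:
  assumes "w \<in> dual_lattice"
  shows "sin (w \<bullet> (x + axis i 1)) = sin (w \<bullet> x)" "cos (w \<bullet> (x + axis i 1)) = cos (w \<bullet> x)"
proof -
  obtain n :: int where "w $ i = 2 * pi * of_int n" using assms by (auto simp: dual_lattice_def)
  then have "w \<bullet> (x + axis i 1) = w \<bullet> x + 2 * pi * of_int n"
    by (simp add: inner_add_right inner_axis)
  then show "sin (w \<bullet> (x + axis i 1)) = sin (w \<bullet> x)" "cos (w \<bullet> (x + axis i 1)) = cos (w \<bullet> x)"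
    using sin_cos_eq_iff by metis+
qed

lemma test_fun_sin:
  assumes "w \<in> dual_lattice"
  shows "test_fun (\<lambda>x. sin (w \<bullet> x)) (\<lambda>x. cos (w \<bullet> x) *\<^sub>R w)"
  unfolding test_fun_def
proof (intro conjI allI)
  show "((\<lambda>x. sin (w \<bullet> x)) has_derivative (\<lambda>h. (cos (w \<bullet> x) *\<^sub>R w) \<bullet> h)) (at x)" for x
    by (auto intro!: derivative_eq_intros)
qed (auto simp: dual_lattice_periodic[OF assms] intro!: continuous_intros)

lemma test_fun_cos:
  assumes "w \<in> dual_lattice"
  shows "test_fun (\<lambda>x. cos (w \<bullet> x)) (\<lambda>x. - sin (w \<bullet> x) *\<^sub>R w)"
  unfolding test_fun_def
proof (intro conjI allI)
  show "((\<lambda>x. cos (w \<bullet> x)) has_derivative (\<lambda>h. (- sin (w \<bullet> x) *\<^sub>R w) \<bullet> h)) (at x)" for x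
    by (auto intro!: derivative_eq_intros)
qed (auto simp: dual_lattice_periodic[OF assms] intro!: continuous_intros)

lemma test_fun2_sin:
  assumes "w \<in> dual_lattice"
  shows "test_fun2 (\<lambda>x. sin (w \<bullet> x)) (\<lambda>x. cos (w \<bullet> x) *\<^sub>R w) (\<lambda>i x. (w $ i) *\<^sub>R (- sin (w \<bullet> x) *\<^sub>R w))"
  unfolding test_fun2_def
  using test_fun_sin[OF assms] test_fun_scale[OF test_fun_cos[OF assms]] by (simp add: mult.commute)

lemma test_fun2_cos:
  assumes "w \<in> dual_lattice"
  shows "test_fun2 (\<lambda>x. cos (w \<bullet> x)) (\<lambda>x. - sin (w \<bullet> x) *\<^sub>R w) (\<lambda>i x. (- w $ i) *\<^sub>R (cos (w \<bullet> x) *\<^sub>R w))"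
proof -
  have "test_fun (\<lambda>x. (- sin (w \<bullet> x) *\<^sub>R w) $ i) (\<lambda>x. (- w $ i) *\<^sub>R (cos (w \<bullet> x) *\<^sub>R w))" for i
    using test_fun_scale[OF test_fun_sin[OF assms], of "- w $ i"] by (simp add: mult.commute)
  then show ?thesis
    unfolding test_fun2_def using test_fun_cos[OF assms] by simp
qed

lemma R_perp_mult: "R_perp *v v = vector [- v $ 2, v $ 1]"
  by (simp add: R_perp_def vec_eq_iff forall_2 matrix_vector_mult_def sum_2)

lemma R_perp_component [simp]: "(R_perp *v v) $ 1 = - v $ 2" "(R_perp *v v) $ 2 = v $ 1"
  by (simp_all add: R_perp_mult)

lemma inner_2: "(u :: real^2) \<bullet> v = u $ 1 * v $ 1 + u $ 2 * v $ 2"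
  by (simp add: inner_vec_def sum_2)

lemma R_perp_adjoint: "(R_perp *v u) \<bullet> v = - (u \<bullet> (R_perp *v v))"
  by (simp add: inner_2)

lemma R_perp_isometry: "(R_perp *v u) \<bullet> (R_perp *v v) = u \<bullet> v"
  by (simp add: inner_2)

lemma L2_R_perp: "L2_cell g \<Longrightarrow> L2_cell (\<lambda>x. R_perp *v g x)"
  by (rule L2_linear[OF _ matrix_vector_mul_bounded_linear])

text \<open>
  On the torus, a curl-free field of mean zero is the same as a gradient (\<open>curl_free_iff\<close> below).
\<close>

definition curl_free :: "(real^2 \<Rightarrow> real^2) \<Rightarrow> bool" where
  "curl_free g \<longleftrightarrow> L2_cell g \<and> (LINT x|\<mu>. g x) = 0 \<and>
     (\<forall>\<psi> \<psi>' \<psi>''. test_fun2 \<psi> \<psi>' \<psi>'' \<longrightarrow> ip g (\<lambda>x. R_perp *v \<psi>' x) = 0)"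

text \<open>Testing with C^2 functions only matches \<open>curl_free\<close> and lets a quarter turn
  exchange the two notions. By \<open>div_free_iff2\<close> it agrees with
  \<open>div_free\<close>.\<close>

definition div_free2 :: "(real^2 \<Rightarrow> real^2) \<Rightarrow> bool" where
  "div_free2 J \<longleftrightarrow> L2_cell J \<and> (\<forall>\<psi> \<psi>' \<psi>''. test_fun2 \<psi> \<psi>' \<psi>'' \<longrightarrow> ip J \<psi>' = 0)"

lemma curl_free_L2: "curl_free g \<Longrightarrow> L2_cell g"
  by (simp add: curl_free_def)

lemma div_free2_L2: "div_free2 J \<Longrightarrow> L2_cell J"
  by (simp add: div_free2_def)

lemma div_free_iff: "div_free J \<longleftrightarrow> L2_cell J \<and> (\<forall>\<psi> \<psi>'. test_fun \<psi> \<psi>' \<longrightarrow> ip J \<psi>' = 0)"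
  by (simp add: div_free_def ip_def)

lemma lint_nth:
  fixes f :: "real^2 \<Rightarrow> 'b::euclidean_space^2"
  assumes "L2_cell f"
  shows "(LINT x|\<mu>. f x) $ i = (LINT x|\<mu>. f x $ i)"
  using integral_bounded_linear[OF bounded_linear_vec_nth L2_integrable[OF assms], of i] by simp

lemma L2_mult_continuous:
  fixes f :: "real^2 \<Rightarrow> 'b::euclidean_space"
  assumes f: "L2_cell f" and u: "continuous_on UNIV u"
  shows "L2_cell (\<lambda>x. u x *\<^sub>R f x)"
proof -
  have "compact (u ` cell)"
    unfolding cell_def
    by (intro compact_continuous_image compact_cbox continuous_on_subset[OF u]) simp
  then obtain B where B: "\<And>x. x \<in> cell \<Longrightarrow> norm (u x) \<le> B"
    using compact_imp_bounded bounded_iff by (metis imageI)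
  show ?thesis
  proof (rule L2_bound[where h = "\<lambda>x. B\<^sup>2 * (norm (f x))\<^sup>2"])
    show "(\<lambda>x. u x *\<^sub>R f x) \<in> borel_measurable \<mu>"
      by (intro borel_measurable_scaleR continuous_measurable_cell[OF u] L2_meas[OF f])
    fix x assume "x \<in> cell"
    then have "(norm (u x))\<^sup>2 \<le> B\<^sup>2" using B by (intro power_mono) auto
    then show "(norm (u x *\<^sub>R f x))\<^sup>2 \<le> B\<^sup>2 * (norm (f x))\<^sup>2"
      by (simp add: power_mult_distrib mult_right_mono)
  qed (use L2_sq[OF f] in simp)
qed

lemma integrable_scaleR_gradient:
  assumes \<phi>: "L2_cell \<phi>" and T: "test_fun \<psi> \<psi>'"
  shows "integrable \<mu> (\<lambda>x. \<phi> x *\<^sub>R \<psi>' x)"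
proof (rule Bochner_Integration.integrable_bound)
  show "integrable \<mu> (\<lambda>x. \<phi> x \<bullet> norm (\<psi>' x))"
    by (rule L2_inner_integrable[OF \<phi>])
       (intro L2_continuous continuous_intros test_fun_continuous[OF T])
  show "(\<lambda>x. \<phi> x *\<^sub>R \<psi>' x) \<in> borel_measurable \<mu>"
    by (intro borel_measurable_scaleR L2_meas \<phi> test_fun_L2[OF T])
qed (simp add: abs_mult)

lemma H1_per_component:
  assumes H: "H1_per \<phi> g" and T: "test_fun \<psi> \<psi>'"
  shows "(LINT x|\<mu>. \<phi> x * \<psi>' x $ i) = - (LINT x|\<mu>. \<psi> x * g x $ i)"
proof -
  have L: "L2_cell \<phi>" "L2_cell g" using H by (auto simp: H1_per_def)
  note 1 = integrable_scaleR_gradient[OF L(1) T]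
  have 2: "integrable \<mu> (\<lambda>x. \<psi> x *\<^sub>R g x)"
    by (rule L2_integrable[OF L2_mult_continuous[OF L(2) test_fun_continuous(1)[OF T]]])
  have "(LINT x|\<mu>. \<phi> x *\<^sub>R \<psi>' x) $ i = - ((LINT x|\<mu>. \<psi> x *\<^sub>R g x) $ i)"
    using H T by (simp add: H1_per_def)
  then show ?thesis
    using integral_bounded_linear[OF bounded_linear_vec_nth 1, of i]
      integral_bounded_linear[OF bounded_linear_vec_nth 2, of i] by simp
qed

text \<open>Integration by parts moves the derivatives onto the test function, where the two mixed
  second derivatives cancel. The constant test function 1 gives mean zero.\<close>

lemma H1_per_curl_free:
  assumes H: "H1_per \<phi> g"
  shows "curl_free g"
  unfolding curl_free_def
proof (intro conjI allI impI)
  show g: "L2_cell g" using H by (simp add: H1_per_def)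
  have "(LINT x|\<mu>. \<phi> x *\<^sub>R (0 :: real^2)) = - (LINT x|\<mu>. 1 *\<^sub>R g x)"
    using H test_fun_const[of 1] unfolding H1_per_def by blast
  then show "(LINT x|\<mu>. g x) = 0" by simp
  fix \<psi> \<psi>' \<psi>'' assume T: "test_fun2 \<psi> \<psi>' \<psi>''"
  then have T': "test_fun (\<lambda>x. \<psi>' x $ i) (\<psi>'' i)" for i by (simp add: test_fun2_def)
  have int: "integrable \<mu> (\<lambda>x. \<psi>' x $ j * g x $ i)" for i j
    using L2_integrable[OF L2_linear[OF L2_mult_continuous[OF g test_fun_continuous(1)[OF T'[of j]]]
        bounded_linear_vec_nth[of i]]] by simp
  have "ip g (\<lambda>x. R_perp *v \<psi>' x) = (LINT x|\<mu>. \<psi>' x $ 1 * g x $ 2 - \<psi>' x $ 2 * g x $ 1)"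
    by (simp add: ip_def inner_2 mult.commute)
  also have "\<dots> = (LINT x|\<mu>. \<psi>' x $ 1 * g x $ 2) - (LINT x|\<mu>. \<psi>' x $ 2 * g x $ 1)"
    by (rule Bochner_Integration.integral_diff[OF int int])
  also have "\<dots> = (LINT x|\<mu>. \<phi> x * \<psi>'' 2 x $ 1) - (LINT x|\<mu>. \<phi> x * \<psi>'' 1 x $ 2)"
    using H1_per_component[OF H T', of 1 2] H1_per_component[OF H T', of 2 1] by simp
  also have "\<dots> = 0" using T by (simp add: test_fun2_def)
  finally show "ip g (\<lambda>x. R_perp *v \<psi>' x) = 0" .
qed

text \<open>
  The Fourier coefficient of \<open>m\<close> at a frequency \<open>w \<noteq> 0\<close> is orthogonal to both \<open>w\<close> and \<open>R w\<close>.
\<close>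

lemma curl_div_free_zero:
  assumes c: "curl_free m" and d: "div_free2 m"
  shows "AE x in \<mu>. m x = 0"
proof -
  note L = curl_free_L2[OF c]
  have orth: "(LINT x|\<mu>. u x *\<^sub>R m x) = 0"
    if u: "continuous_on UNIV u" and w: "w \<noteq> 0"
      and T: "test_fun2 \<psi> (\<lambda>x. u x *\<^sub>R w) \<psi>''" for u w \<psi> \<psi>''
  proof -
    let ?I = "LINT x|\<mu>. u x *\<^sub>R m x"
    note i = L2_integrable[OF L2_mult_continuous[OF L u]]
    have "ip m (\<lambda>x. u x *\<^sub>R w) = 0" using d T by (auto simp: div_free2_def)
    then have 1: "?I \<bullet> w = 0"
      using integral_inner_left[of w \<mu>, OF i] by (simp add: ip_def)
    have "ip m (\<lambda>x. R_perp *v (u x *\<^sub>R w)) = 0" using c T unfolding curl_free_def by blast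
    then have 2: "?I \<bullet> (R_perp *v w) = 0"
      using integral_inner_left[of "R_perp *v w" \<mu>, OF i] by (simp add: ip_def matrix_vector_mult_scaleR)
    \<comment> \<open>In the plane \<open>w\<close> and its quarter turn form an orthogonal basis,
      so a vector orthogonal to both vanishes.\<close>
    have "(?I $ 1) * (w \<bullet> w) = 0" "(?I $ 2) * (w \<bullet> w) = 0"
      using 1 2 unfolding inner_2 R_perp_component by algebra+
    with w show ?thesis by (auto simp: vec_eq_iff forall_2)
  qed
  have "(LINT x|\<mu>. cos (w \<bullet> x) *\<^sub>R m x) = 0 \<and> (LINT x|\<mu>. sin (w \<bullet> x) *\<^sub>R m x) = 0" if w: "w \<in> dual_lattice" for w
  proof (cases "w = 0")
    case True
    then show ?thesis using c by (simp add: curl_free_def)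
  next
    case False
    \<comment> \<open>The gradient of a sine is a cosine wave along \<open>w\<close>, so sine
      potentials test cosine coefficients, and conversely. The frequency 0 above is the
      mean.\<close>
    have "(LINT x|\<mu>. cos (w \<bullet> x) *\<^sub>R m x) = 0"
      by (rule orth[OF _ False test_fun2_sin[OF w]]) (intro continuous_intros)
    moreover have "(LINT x|\<mu>. - sin (w \<bullet> x) *\<^sub>R m x) = 0"
      by (rule orth[OF _ False test_fun2_cos[OF w]]) (intro continuous_intros)
    ultimately show ?thesis by simp
  qed
  moreover have "(LINT x|\<mu>. cos (w \<bullet> x) * m x $ i) = (LINT x|\<mu>. cos (w \<bullet> x) *\<^sub>R m x) $ i"
    "(LINT x|\<mu>. sin (w \<bullet> x) * m x $ i) = (LINT x|\<mu>. sin (w \<bullet> x) *\<^sub>R m x) $ i" for w i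
    by (subst lint_nth, (intro L2_mult_continuous L continuous_intros), simp)+
  ultimately have "AE x in \<mu>. m x $ i = 0" for i
    by (intro trig_complete L2_integrable L2_linear[OF L bounded_linear_vec_nth]) simp
  from this[of 1] this[of 2] show ?thesis
    by eventually_elim (simp add: vec_eq_iff forall_2)
qed

lemma curl_free_closed:
  assumes F: "\<And>n. curl_free (F n)" and f: "L2_cell f" and lim: "(\<lambda>n. nsq (\<lambda>x. F n x - f x)) \<longlonglongrightarrow> 0"
  shows "curl_free f"
  unfolding curl_free_def
proof (intro conjI allI impI f)
  note t = ip_tendsto[OF curl_free_L2[OF F] f _ lim]
  have "(LINT x|\<mu>. f x) \<bullet> v = 0" for v
  proof -
    have "ip (F n) (\<lambda>x. v) = 0" for n
      using F[of n] by (simp add: ip_const_right curl_free_def)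
    then have "ip f (\<lambda>x. v) = 0"
      using t[OF L2_const, of v] by (simp add: LIMSEQ_const_iff)
    then show ?thesis using f by (simp add: ip_const_right)
  qed
  from this[of "LINT x|\<mu>. f x"] show "(LINT x|\<mu>. f x) = 0" by simp
  fix \<psi> \<psi>' \<psi>'' assume T: "test_fun2 \<psi> \<psi>' \<psi>''"
  then have "ip (F n) (\<lambda>x. R_perp *v \<psi>' x) = 0" for n
    using F[of n] unfolding curl_free_def by blast
  then show "ip f (\<lambda>x. R_perp *v \<psi>' x) = 0"
    using t[OF L2_R_perp[OF test_fun_L2(2)[OF test_fun2_D[OF T]]]] by (simp add: LIMSEQ_const_iff)
qed

lemma curl_free_add:
  assumes "curl_free f" "curl_free g"
  shows "curl_free (\<lambda>x. f x + g x)"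
proof -
  note L = assms[THEN curl_free_L2]
  show ?thesis
    unfolding curl_free_def
  proof (intro conjI allI impI)
    show "L2_cell (\<lambda>x. f x + g x)" by (intro L2_add L)
    show "(LINT x|\<mu>. f x + g x) = 0"
      using assms L2_integrable[OF L(1)] L2_integrable[OF L(2)] by (simp add: curl_free_def)
    fix \<psi> \<psi>' \<psi>'' assume T: "test_fun2 \<psi> \<psi>' \<psi>''"
    then have "ip f (\<lambda>x. R_perp *v \<psi>' x) = 0" "ip g (\<lambda>x. R_perp *v \<psi>' x) = 0"
      using assms unfolding curl_free_def by blast+
    then show "ip (\<lambda>x. f x + g x) (\<lambda>x. R_perp *v \<psi>' x) = 0"
      by (subst ip_add_left[OF L L2_R_perp[OF test_fun_L2(2)[OF test_fun2_D[OF T]]]]) simp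
  qed
qed

lemma curl_free_scale:
  assumes "curl_free f"
  shows "curl_free (\<lambda>x. c *\<^sub>R f x)"
  using assms by (auto simp: curl_free_def L2_scale ip_scale_left)

lemma curl_free_diff: "curl_free f \<Longrightarrow> curl_free g \<Longrightarrow> curl_free (\<lambda>x. f x - g x)"
  using curl_free_add[of f "\<lambda>x. (-1) *\<^sub>R g x"] curl_free_scale[of g "-1"] by simp

lemma curl_free_zero: "curl_free (\<lambda>x. 0)"
  by (simp add: curl_free_def ip_def L2_const)

text \<open>The L2 closure of the gradients of C^2 test functions, a closed subspace onto which one
  can project.\<close>

definition approx_gradients :: "(real^2 \<Rightarrow> real^2) set" where
  "approx_gradients = {g. L2_cell g \<and>
     (\<forall>e>0. \<exists>p p' p''. test_fun2 p p' p'' \<and> nsq (\<lambda>x. g x - p' x) < e)}"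

lemma gradient_in_approx:
  assumes "test_fun2 p p' p''"
  shows "p' \<in> approx_gradients"
proof -
  have "nsq (\<lambda>x. p' x - p' x) = 0" by (simp add: nsq_def)
  then have "\<exists>q q' q''. test_fun2 q q' q'' \<and> nsq (\<lambda>x. p' x - q' x) < e" if "0 < e" for e
    using assms that by (intro exI[of _ p] exI[of _ p'] exI[of _ p'']) simp
  then show ?thesis
    using test_fun_L2(2)[OF test_fun2_D[OF assms]] by (simp add: approx_gradients_def)
qed

lemma approx_gradients_L2: "g \<in> approx_gradients \<Longrightarrow> L2_cell g"
  by (simp add: approx_gradients_def)

lemma approx_gradients_closed:
  assumes F: "\<And>n. F n \<in> approx_gradients" and f: "L2_cell f" and lim: "(\<lambda>n. nsq (\<lambda>x. F n x - f x)) \<longlonglongrightarrow> 0"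
  shows "f \<in> approx_gradients"
proof -
  have "\<exists>p p' p''. test_fun2 p p' p'' \<and> nsq (\<lambda>x. f x - p' x) < e" if e: "0 < e" for e
  proof -
    have FL: "L2_cell (F n)" for n using F[of n] by (simp add: approx_gradients_def)
    obtain n where n: "nsq (\<lambda>x. F n x - f x) < e / 4"
      using order_tendstoD(2)[OF lim, of "e / 4"] e by (auto simp: eventually_sequentially)
    have "0 < e / 4" using e by simp
    then obtain p p' p'' where p: "test_fun2 p p' p''" "nsq (\<lambda>x. F n x - p' x) < e / 4"
      using F[of n] unfolding approx_gradients_def by blast
    have "nsq (\<lambda>x. (f x - F n x) + (F n x - p' x)) \<le> 2 * nsq (\<lambda>x. f x - F n x) + 2 * nsq (\<lambda>x. F n x - p' x)"
      by (intro nsq_add_le L2_diff f FL test_fun_L2(2)[OF test_fun2_D[OF p(1)]])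
    then have "nsq (\<lambda>x. f x - p' x) < e"
      using n p(2) nsq_minus_commute[of f "F n"] by simp
    then show ?thesis using p(1) by blast
  qed
  then show ?thesis using f by (simp add: approx_gradients_def)
qed

lemma approx_gradients_add:
  assumes f: "f \<in> approx_gradients" and g: "g \<in> approx_gradients"
  shows "(\<lambda>x. f x + g x) \<in> approx_gradients"
proof -
  have L: "L2_cell f" "L2_cell g" using f g by (auto simp: approx_gradients_def)
  have "\<exists>p p' p''. test_fun2 p p' p'' \<and> nsq (\<lambda>x. (f x + g x) - p' x) < e" if e: "0 < e" for e
  proof -
    have e': "0 < e / 4" using e by simp
    obtain p p' p'' where p: "test_fun2 p p' p''" "nsq (\<lambda>x. f x - p' x) < e / 4"
      using f e' unfolding approx_gradients_def by blast
    obtain q q' q'' where q: "test_fun2 q q' q''" "nsq (\<lambda>x. g x - q' x) < e / 4"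
      using g e' unfolding approx_gradients_def by blast
    have "nsq (\<lambda>x. (f x - p' x) + (g x - q' x)) \<le> 2 * nsq (\<lambda>x. f x - p' x) + 2 * nsq (\<lambda>x. g x - q' x)"
      by (intro nsq_add_le L2_diff L test_fun_L2(2)[OF test_fun2_D[OF p(1)]] test_fun_L2(2)[OF test_fun2_D[OF q(1)]])
    also have "\<dots> < e" using p(2) q(2) by simp
    finally have "nsq (\<lambda>x. (f x + g x) - (p' x + q' x)) < e" by (simp add: algebra_simps)
    then show ?thesis using test_fun2_add[OF p(1) q(1)] by blast
  qed
  then show ?thesis using L2_add[OF L] by (simp add: approx_gradients_def)
qed

lemma nsq_scale: "nsq (\<lambda>x. c *\<^sub>R f x) = c\<^sup>2 * nsq f"
  by (simp add: nsq_def power_mult_distrib)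

lemma approx_gradients_scale:
  assumes f: "f \<in> approx_gradients"
  shows "(\<lambda>x. c *\<^sub>R f x) \<in> approx_gradients"
proof -
  have L: "L2_cell f" using f by (auto simp: approx_gradients_def)
  have "\<exists>p p' p''. test_fun2 p p' p'' \<and> nsq (\<lambda>x. c *\<^sub>R f x - p' x) < e" if e: "0 < e" for e
  proof -
    have pos: "0 < c\<^sup>2 + 1" by (simp add: add_nonneg_pos)
    then have e': "0 < e / (c\<^sup>2 + 1)" using e by simp
    obtain p p' p'' where p: "test_fun2 p p' p''" "nsq (\<lambda>x. f x - p' x) < e / (c\<^sup>2 + 1)"
      using f e' unfolding approx_gradients_def by blast
    have "nsq (\<lambda>x. c *\<^sub>R f x - c *\<^sub>R p' x) = c\<^sup>2 * nsq (\<lambda>x. f x - p' x)"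
      by (simp add: nsq_scale flip: scaleR_diff_right)
    also have "\<dots> \<le> (c\<^sup>2 + 1) * nsq (\<lambda>x. f x - p' x)"
      by (intro mult_right_mono nsq_nonneg) simp
    also have "\<dots> < e" using p(2) pos by (simp add: field_simps)
    finally show ?thesis using test_fun2_scale[OF p(1)] by blast
  qed
  then show ?thesis using L2_scale[OF L] by (simp add: approx_gradients_def)
qed

lemma approx_gradients_sequence:
  assumes "g \<in> approx_gradients"
  shows "\<exists>p p' p''. (\<forall>n. test_fun2 (p n) (p' n) (p'' n)) \<and>
    (\<forall>n. nsq (\<lambda>x. p' n x - g x) < inverse (real (Suc n))) \<and> (\<lambda>n. nsq (\<lambda>x. p' n x - g x)) \<longlonglongrightarrow> 0"
proof -
  have "\<exists>p p' p''. test_fun2 p p' p'' \<and> nsq (\<lambda>x. g x - p' x) < inverse (real (Suc n))" for n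
  proof -
    have "0 < inverse (real (Suc n))" by simp
    then show ?thesis using assms unfolding approx_gradients_def by blast
  qed
  then obtain p p' p'' where p: "\<And>n. test_fun2 (p n) (p' n) (p'' n)"
    "\<And>n. nsq (\<lambda>x. g x - p' n x) < inverse (real (Suc n))"
    by metis
  have p2: "nsq (\<lambda>x. p' n x - g x) < inverse (real (Suc n))" for n
    using p(2)[of n] by (simp add: nsq_minus_commute)
  moreover have "(\<lambda>n. nsq (\<lambda>x. p' n x - g x)) \<longlonglongrightarrow> 0"
    by (rule tendsto_sandwich[of "\<lambda>n. 0", OF _ _ tendsto_const LIMSEQ_inverse_real_of_nat])
       (intro always_eventually allI nsq_nonneg less_imp_le[OF p2])+
  ultimately show ?thesis using p(1) by blast
qed

text \<open>
  The component of \<open>g\<close> orthogonal to all gradients is both curl-free and divergence-free.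
\<close>

theorem curl_free_approx:
  assumes g: "curl_free g"
  shows "g \<in> approx_gradients"
proof -
  note L = curl_free_L2[OF g]
  have "\<exists>k\<in>approx_gradients. \<forall>t\<in>approx_gradients. ip (\<lambda>x. g x - k x) t = 0"
  proof (rule L2_projection[where m = 1 and C = 1])
    show "(\<lambda>x. 0) \<in> approx_gradients" by (rule gradient_in_approx[OF test_fun2_const])
    show "ip f h = ip h f" for f h :: "real^2 \<Rightarrow> real^2" by (rule ip_commute)
  qed (auto simp: L nsq_ip[symmetric] ip_scale_left ip_add_left
      intro: approx_gradients_L2 approx_gradients_add approx_gradients_scale approx_gradients_closed)
  then obtain k where k: "k \<in> approx_gradients"
    and orth: "\<And>t. t \<in> approx_gradients \<Longrightarrow> ip (\<lambda>x. g x - k x) t = 0" by blast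
  have kL: "L2_cell k" using k by (simp add: approx_gradients_def)
  obtain p p' p'' where p: "\<And>n. test_fun2 (p n) (p' n) (p'' n)"
    and "\<And>n. nsq (\<lambda>x. p' n x - k x) < inverse (real (Suc n))"
    and lim: "(\<lambda>n. nsq (\<lambda>x. p' n x - k x)) \<longlonglongrightarrow> 0"
    using approx_gradients_sequence[OF k] by blast
  have "curl_free (p' n)" for n
    by (rule H1_per_curl_free[OF test_fun_H1_per[OF test_fun2_D[OF p]]])
  from curl_free_closed[OF this kL lim] have "curl_free (\<lambda>x. g x - k x)"
    by (rule curl_free_diff[OF g])
  moreover have "div_free2 (\<lambda>x. g x - k x)"
    unfolding div_free2_def
  proof (intro conjI allI impI L2_diff L kL)
    fix \<psi> \<psi>' \<psi>'' assume "test_fun2 \<psi> \<psi>' \<psi>''"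
    then show "ip (\<lambda>x. g x - k x) \<psi>' = 0" by (rule orth[OF gradient_in_approx])
  qed
  ultimately have ae: "AE x in \<mu>. g x - k x = 0" by (rule curl_div_free_zero)
  have "nsq (\<lambda>x. k x - g x) = (LINT x|\<mu>. 0)"
    unfolding nsq_def
  proof (rule integral_cong_AE)
    show "AE x in \<mu>. (norm (k x - g x))\<^sup>2 = 0" using ae by eventually_elim simp
    show "(\<lambda>x. (norm (k x - g x))\<^sup>2) \<in> borel_measurable \<mu>"
      by (rule borel_measurable_integrable[OF L2_sq[OF L2_diff[OF kL L]]])
  qed simp
  \<comment> \<open>Almost everywhere equality with \<open>k\<close> becomes membership through the
    constant sequence \<open>k\<close>, which converges to \<open>g\<close> in the seminorm.\<close>
  then show ?thesis
    by (intro approx_gradients_closed[where F = "\<lambda>n. k", OF k L]) simp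
qed

text \<open>\<open>J\<close> annihilates gradients of C^2 functions by definition, and these are
  dense among curl-free fields.\<close>

lemma curl_free_orth:
  assumes g: "curl_free g" and J: "div_free2 J"
  shows "ip J g = 0"
proof -
  obtain p p' p'' where p: "\<And>n. test_fun2 (p n) (p' n) (p'' n)"
    and "\<And>n. nsq (\<lambda>x. p' n x - g x) < inverse (real (Suc n))"
    and lim: "(\<lambda>n. nsq (\<lambda>x. p' n x - g x)) \<longlonglongrightarrow> 0"
    using approx_gradients_sequence[OF curl_free_approx[OF g]] by blast
  have "ip J (p' n) = 0" for n
    using J p unfolding div_free2_def by blast
  then have "ip (p' n) J = 0" for n
    by (simp add: ip_commute[of _ J])
  then have "ip g J = 0"
    using ip_tendsto[OF test_fun_L2(2)[OF test_fun2_D[OF p]] curl_free_L2[OF g] div_free2_L2[OF J] lim]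
    by (simp add: LIMSEQ_const_iff)
  then show ?thesis by (simp add: ip_commute)
qed

text \<open>From C^2 to C^1 test functions: the gradient of a C^1 function is itself curl-free, so
  \<open>curl_free_orth\<close> applies to it.\<close>

theorem div_free_iff2: "div_free J \<longleftrightarrow> div_free2 J"
proof
  assume "div_free J"
  then show "div_free2 J"
    using test_fun2_D unfolding div_free_iff div_free2_def by blast
next
  assume "div_free2 J"
  then show "div_free J"
    using curl_free_orth H1_per_curl_free test_fun_H1_per div_free2_L2 unfolding div_free_iff by blast
qed

text \<open>The Poincare inequality turns convergence of the approximating gradients into L2
  convergence of their potentials, and the weak gradient identity passes to the limit.\<close>

theorem curl_free_potential:
  assumes g: "curl_free g"
  shows "\<exists>\<phi>. H1_per \<phi> g"
proof -
  note L = curl_free_L2[OF g]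
  obtain q p' p'' where q: "\<And>n. test_fun2 (q n) (p' n) (p'' n)"
    and small: "\<And>n. nsq (\<lambda>x. p' n x - g x) < inverse (real (Suc n))"
    and lim: "(\<lambda>n. nsq (\<lambda>x. p' n x - g x)) \<longlonglongrightarrow> 0"
    using approx_gradients_sequence[OF curl_free_approx[OF g]] by blast
  \<comment> \<open>Potentials are normalized to mean zero, as the Poincare inequality
    requires.\<close>
  define p where "p n x = q n x + - (LINT y|\<mu>. q n y)" for n x
  have p: "test_fun (p n) (p' n)" for n
    using test_fun_add[OF test_fun2_D[OF q] test_fun_const, of n "- (LINT y|\<mu>. q n y)"]
    unfolding p_def by simp
  have mean: "(LINT x|\<mu>. p n x) = 0" for n
    unfolding p_def using L2_integrable[OF test_fun_L2(1)[OF test_fun2_D[OF q]], of n]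
    by (subst Bochner_Integration.integral_add) (simp_all add: measure_cell)
  note pL = test_fun_L2(1)[OF p] and p'L = test_fun_L2(2)[OF p]
  have P: "nsq (\<lambda>x. p i x - p j x) \<le> 4 * nsq (\<lambda>x. p' i x - g x) + 4 * nsq (\<lambda>x. p' j x - g x)" for i j
  proof -
    have T: "test_fun (\<lambda>x. p i x - p j x) (\<lambda>x. p' i x - p' j x)"
      using test_fun_add[OF p test_fun_scale[OF p, of "-1"], of i j] by simp
    have "nsq (\<lambda>x. p i x - p j x) \<le> 2 * nsq (\<lambda>x. p' i x - p' j x)"
      by (rule Poincare[OF T]) (simp add: mean L2_integrable[OF pL])
    also have "(\<lambda>x. p' i x - p' j x) = (\<lambda>x. (p' i x - g x) + (g x - p' j x))" by simp
    also have "2 * nsq \<dots> \<le> 2 * (2 * nsq (\<lambda>x. p' i x - g x) + 2 * nsq (\<lambda>x. g x - p' j x))"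
      by (intro mult_left_mono nsq_add_le L2_diff L p'L) simp
    finally show ?thesis by (simp add: nsq_minus_commute[of g])
  qed
  have "\<exists>N. \<forall>i\<ge>N. \<forall>j\<ge>N. nsq (\<lambda>x. p i x - p j x) < e" if e: "0 < e" for e
  proof -
    obtain N where N: "inverse (real (Suc N)) < e / 8"
      using reals_Archimedean[of "e / 8"] e by auto
    have s: "nsq (\<lambda>x. p' i x - g x) < e / 8" if "i \<ge> N" for i
    proof -
      have "inverse (real (Suc i)) \<le> inverse (real (Suc N))"
        using that by (intro le_imp_inverse_le) auto
      then show ?thesis using small[of i] N by linarith
    qed
    have "nsq (\<lambda>x. p i x - p j x) < e" if "i \<ge> N" "j \<ge> N" for i j
      using P[of i j] s[OF that(1)] s[OF that(2)] by linarith
    then show ?thesis by blast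
  qed
  from L2_complete[OF pL this] obtain \<phi> where
    \<phi>: "L2_cell \<phi>" and lim\<phi>: "(\<lambda>n. nsq (\<lambda>x. p n x - \<phi> x)) \<longlonglongrightarrow> 0" by blast
  have "(LINT x|\<mu>. \<phi> x *\<^sub>R \<psi>' x) = - (LINT x|\<mu>. \<psi> x *\<^sub>R g x)" if T: "test_fun \<psi> \<psi>'" for \<psi> \<psi>'
  proof -
    note c = test_fun_continuous[OF T]
    have "(LINT x|\<mu>. \<phi> x *\<^sub>R \<psi>' x) $ i = (- (LINT x|\<mu>. \<psi> x *\<^sub>R g x)) $ i" for i
    proof -
      have Li: "L2_cell (\<lambda>x. \<psi>' x $ i)" "L2_cell (\<lambda>x. \<psi> x *\<^sub>R axis i 1 :: real^2)"
        by (intro L2_continuous continuous_intros c)+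
      have "ip (p n) (\<lambda>x. \<psi>' x $ i) = - ip (p' n) (\<lambda>x. \<psi> x *\<^sub>R axis i 1)" for n
        using H1_per_component[OF test_fun_H1_per[OF p] T, of n i] by (simp add: ip_def inner_axis)
      moreover have "(\<lambda>n. ip (p n) (\<lambda>x. \<psi>' x $ i)) \<longlonglongrightarrow> ip \<phi> (\<lambda>x. \<psi>' x $ i)"
        by (rule ip_tendsto[OF pL \<phi> Li(1) lim\<phi>])
      moreover have "(\<lambda>n. - ip (p' n) (\<lambda>x. \<psi> x *\<^sub>R axis i 1)) \<longlonglongrightarrow> - ip g (\<lambda>x. \<psi> x *\<^sub>R axis i 1)"
        by (intro tendsto_minus ip_tendsto[OF p'L L Li(2) lim])
      ultimately have eq: "ip \<phi> (\<lambda>x. \<psi>' x $ i) = - ip g (\<lambda>x. \<psi> x *\<^sub>R axis i 1)"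
        using LIMSEQ_unique by simp
      note 1 = integrable_scaleR_gradient[OF \<phi> T]
      have 2: "integrable \<mu> (\<lambda>x. \<psi> x *\<^sub>R g x)"
        by (rule L2_integrable[OF L2_mult_continuous[OF L c(1)]])
      show ?thesis
        using eq integral_bounded_linear[OF bounded_linear_vec_nth 1, of i]
          integral_bounded_linear[OF bounded_linear_vec_nth 2, of i]
        by (simp add: ip_def inner_axis)
    qed
    then show ?thesis by (simp add: vec_eq_iff)
  qed
  then show ?thesis using \<phi> L by (auto simp: H1_per_def)
qed

lemma curl_free_iff: "curl_free g \<longleftrightarrow> (\<exists>\<phi>. H1_per \<phi> g)"
  using curl_free_potential H1_per_curl_free by blast

lemma div_free2_const: "div_free2 (\<lambda>x. c)"
proof -
  have "ip (\<lambda>x. c) \<psi>' = 0" if "test_fun2 \<psi> \<psi>' \<psi>''" for \<psi> \<psi>' \<psi>''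
    using test_fun_mean_gradient[OF test_fun2_D[OF that]] test_fun_L2(2)[OF test_fun2_D[OF that]]
    by (simp add: ip_const_left)
  then show ?thesis by (auto simp: div_free2_def L2_const)
qed

lemma curl_free_rotate:
  assumes "curl_free g"
  shows "div_free2 (\<lambda>x. R_perp *v g x)"
proof -
  have "ip (\<lambda>x. R_perp *v g x) \<psi>' = 0" if T: "test_fun2 \<psi> \<psi>' \<psi>''" for \<psi> \<psi>' \<psi>''
  proof -
    have "ip (\<lambda>x. R_perp *v g x) \<psi>' = - ip g (\<lambda>x. R_perp *v \<psi>' x)"
      by (simp add: ip_def R_perp_adjoint)
    then show ?thesis using assms T unfolding curl_free_def by auto
  qed
  then show ?thesis using L2_R_perp[OF curl_free_L2[OF assms]] by (auto simp: div_free2_def)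
qed

text \<open>A quarter turn exchanges curl and divergence in the plane. The mean is subtracted
  because \<open>curl_free\<close> includes mean zero.\<close>

lemma div_free2_rotate:
  assumes J: "div_free2 J"
  shows "curl_free (\<lambda>x. R_perp *v J x - R_perp *v (LINT y|\<mu>. J y))"
proof -
  note L = div_free2_L2[OF J]
  have RL: "L2_cell (\<lambda>x. R_perp *v J x)" by (rule L2_R_perp[OF L])
  have mean: "(LINT x|\<mu>. R_perp *v J x) = R_perp *v (LINT y|\<mu>. J y)"
    by (rule integral_bounded_linear[OF matrix_vector_mul_bounded_linear L2_integrable[OF L]])
  have "ip (\<lambda>x. R_perp *v J x - R_perp *v (LINT y|\<mu>. J y)) (\<lambda>x. R_perp *v \<psi>' x) = 0"
    if T: "test_fun2 \<psi> \<psi>' \<psi>''" for \<psi> \<psi>' \<psi>''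
  proof -
    note TL = test_fun_L2(2)[OF test_fun2_D[OF T]]
    have "ip (\<lambda>x. R_perp *v J x) (\<lambda>x. R_perp *v \<psi>' x) = ip J \<psi>'"
      by (simp add: ip_def R_perp_isometry)
    moreover have "ip (\<lambda>x. R_perp *v (LINT y|\<mu>. J y)) (\<lambda>x. R_perp *v \<psi>' x) = ip (\<lambda>x. LINT y|\<mu>. J y) \<psi>'"
      by (simp add: ip_def R_perp_isometry)
    moreover have "ip J \<psi>' = 0" "ip (\<lambda>x. LINT y|\<mu>. J y) \<psi>' = 0"
      using J div_free2_const T unfolding div_free2_def by blast+
    ultimately show ?thesis
      by (subst ip_diff_left[OF RL L2_const L2_R_perp[OF TL]]) simp
  qed
  moreover have "(LINT x|\<mu>. R_perp *v J x - R_perp *v (LINT y|\<mu>. J y)) = 0"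
    by (subst Bochner_Integration.integral_diff[OF L2_integrable[OF RL]])
       (simp_all add: mean measure_cell)
  ultimately show ?thesis
    using L2_diff[OF RL L2_const] by (auto simp: curl_free_def)
qed

section \<open>Effective tensors\<close>

lemma div_free2_add:
  assumes "div_free2 f" "div_free2 g"
  shows "div_free2 (\<lambda>x. f x + g x)"
proof -
  note L = assms[THEN div_free2_L2]
  have "ip (\<lambda>x. f x + g x) \<psi>' = 0" if T: "test_fun2 \<psi> \<psi>' \<psi>''" for \<psi> \<psi>' \<psi>''
  proof -
    have "ip f \<psi>' = 0" "ip g \<psi>' = 0" using assms T unfolding div_free2_def by blast+
    then show ?thesis
      by (simp add: ip_add_left[OF L test_fun_L2(2)[OF test_fun2_D[OF T]]])
  qed
  then show ?thesis using L2_add[OF L] unfolding div_free2_def by blast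
qed

lemma div_free2_scale:
  assumes "div_free2 f"
  shows "div_free2 (\<lambda>x. c *\<^sub>R f x)"
  using assms L2_scale unfolding div_free2_def ip_scale_left by (metis mult_zero_right)

section \<open>Block operators and the cell problem in terms of curl-free and divergence-free
  fields\<close>

lemma block_apply_nth: "block_apply M E $ i = M $ i $ 1 *v E $ 1 + M $ i $ 2 *v E $ 2"
  by (simp add: block_apply_def sum_2)

lemma block_apply_bounded_linear: "bounded_linear (block_apply M)"
proof -
  have "linear (block_apply M)"
    by (rule linearI)
       (simp_all add: vec_eq_iff[of "block_apply _ _"] block_apply_nth matrix_vector_right_distrib
          matrix_vector_mult_scaleR scaleR_right_distrib)
  then show ?thesis by (simp add: linear_conv_bounded_linear)
qed

lemma block_apply_add_left: "block_apply (M + N) E = block_apply M E + block_apply N E"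
  by (simp add: vec_eq_iff[of "block_apply _ _"] block_apply_nth matrix_vector_mult_add_rdistrib)

lemmas scaleR_matrix_vector = scaleR_matrix_vector_assoc[symmetric]

lemma block_apply_scale_left: "block_apply (c *\<^sub>R M) E = c *\<^sub>R block_apply M E"
  by (simp add: vec_eq_iff[of "block_apply _ _"] block_apply_nth scaleR_matrix_vector scaleR_right_distrib)

lemma block_apply_ext:
  assumes "\<And>E. block_apply M E = block_apply N E"
  shows "M = N"
proof -
  have *: "M $ i $ j *v v = N $ i $ j *v v" for i j v
  proof -
    have "block_apply M (axis j v) $ i = block_apply N (axis j v) $ i" using assms by simp
    then show ?thesis using exhaust_2[of j] by (auto simp: block_apply_nth axis_def)
  qed
  then have "M $ i $ j = N $ i $ j" for i j
    using matrix_eq by blast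
  then show ?thesis by (simp add: vec_eq_iff)
qed

lemma linear_block_apply:
  assumes "linear (f :: pair_field \<Rightarrow> pair_field)"
  shows "\<exists>M. \<forall>E. f E = block_apply M E"
proof -
  interpret linear f by fact
  have ax: "axis j (u + v) = axis j u + axis j v" "axis j (c *\<^sub>R u) = c *\<^sub>R axis j u"
    for j :: 2 and c and u v :: "real^2"
    by (auto simp: axis_def vec_eq_iff)
  define M :: block where "M = (\<chi> i j. matrix (\<lambda>v. f (axis j v) $ i))"
  have "linear (\<lambda>v. f (axis j v) $ i)" for i j
    by (rule linearI) (simp_all add: ax add scale)
  then have M: "M $ i $ j *v v = f (axis j v) $ i" for i j v
    by (simp add: M_def matrix_works)
  have "E = axis 1 (E $ 1) + axis 2 (E $ 2)" for E :: pair_field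
    by (simp add: vec_eq_iff[of E] forall_2 axis_def)
  then have fE: "f E = f (axis 1 (E $ 1)) + f (axis 2 (E $ 2))" for E
    using add[of "axis 1 (E $ 1)" "axis 2 (E $ 2)"] by metis
  have "f E $ i = block_apply M E $ i" for E i
    by (subst fE) (simp add: block_apply_nth M)
  then show ?thesis by (metis vec_eq_iff)
qed

lemma cell_solution_iff:
  "cell_solution L E0 E \<longleftrightarrow> (\<forall>i. curl_free (\<lambda>x. E x $ i - E0 $ i)) \<and>
     (\<forall>i. div_free2 (\<lambda>x. block_apply (L x) (E x) $ i))"
proof -
  have "(\<exists>\<phi> g. (\<forall>i. H1_per (\<phi> i) (g i)) \<and> E = (\<lambda>x. E0 + (\<chi> i. g i x))) \<longleftrightarrow>
      (\<forall>i. curl_free (\<lambda>x. E x $ i - E0 $ i))" (is "?l \<longleftrightarrow> ?r")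
  proof
    assume ?l
    then obtain \<phi> g where g: "\<And>i. H1_per (\<phi> i) (g i)" "E = (\<lambda>x. E0 + (\<chi> i. g i x))" by blast
    then show ?r using H1_per_curl_free[OF g(1)] by simp
  next
    assume ?r
    then have "\<forall>i. \<exists>\<phi>. H1_per \<phi> (\<lambda>x. E x $ i - E0 $ i)" by (simp add: curl_free_iff)
    then obtain \<phi> where "\<And>i. H1_per (\<phi> i) (\<lambda>x. E x $ i - E0 $ i)" by metis
    then show ?l
      by (intro exI[of _ \<phi>] exI[of _ "\<lambda>i x. E x $ i - E0 $ i"]) (simp add: fun_eq_iff vec_eq_iff)
  qed
  then show ?thesis by (simp add: cell_solution_def div_free_iff2)
qed

lemma conductivity_solution_iff:
  "conductivity_solution s e0 e \<longleftrightarrow> curl_free (\<lambda>x. e x - e0) \<and> div_free2 (\<lambda>x. s x *v e x)"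
proof -
  have "(\<exists>\<phi> g. H1_per \<phi> g \<and> e = (\<lambda>x. e0 + g x)) \<longleftrightarrow> curl_free (\<lambda>x. e x - e0)" (is "?l \<longleftrightarrow> ?r")
  proof
    assume ?l
    then show ?r by (auto dest: H1_per_curl_free)
  next
    assume ?r
    then obtain \<phi> where "H1_per \<phi> (\<lambda>x. e x - e0)" by (auto simp: curl_free_iff)
    then show ?l by (intro exI[of _ \<phi>] exI[of _ "\<lambda>x. e x - e0"]) (simp add: fun_eq_iff)
  qed
  then show ?thesis by (simp add: conductivity_solution_def div_free_iff2)
qed

text \<open>The quadratic form attains a positive minimum on the compact unit sphere; homogeneity
  does the rest.\<close>

lemma posdef_coercive:
  fixes f :: "'a::euclidean_space \<Rightarrow> 'a"
  assumes f: "bounded_linear f" and pos: "\<And>u. u \<noteq> 0 \<Longrightarrow> 0 < u \<bullet> f u"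
  shows "\<exists>m>0. \<forall>u. m * (norm u)\<^sup>2 \<le> u \<bullet> f u"
proof -
  interpret bounded_linear f by fact
  have "sphere 0 1 \<noteq> ({} :: 'a set)" by simp
  moreover have "continuous_on (sphere 0 1) (\<lambda>u. u \<bullet> f u)"
    by (intro continuous_intros linear_continuous_on f)
  ultimately obtain u where u: "u \<in> sphere 0 1" "\<And>v. v \<in> sphere 0 1 \<Longrightarrow> u \<bullet> f u \<le> v \<bullet> f v"
    using continuous_attains_inf[OF compact_sphere, of 0 1 "\<lambda>u. u \<bullet> f u"] by blast
  have "(u \<bullet> f u) * (norm v)\<^sup>2 \<le> v \<bullet> f v" for v
  proof (cases "v = 0")
    case False
    have "u \<bullet> f u \<le> (v /\<^sub>R norm v) \<bullet> f (v /\<^sub>R norm v)" using False by (intro u(2)) simp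
    also have "\<dots> = (v \<bullet> f v) / (norm v)\<^sup>2" by (simp add: scaleR power2_eq_square divide_inverse)
    finally show ?thesis using False by (simp add: field_simps)
  qed simp
  moreover have "0 < u \<bullet> f u" using u(1) by (intro pos) auto
  ultimately show ?thesis by blast
qed

definition sym_posdef :: "block \<Rightarrow> bool" where
  "sym_posdef L \<longleftrightarrow> (\<forall>u v. u \<bullet> block_apply L v = v \<bullet> block_apply L u) \<and>
     (\<forall>u. u \<noteq> 0 \<longrightarrow> 0 < u \<bullet> block_apply L u)"

lemma L2_pair_components: "(\<And>i. L2_cell (\<lambda>x. f x $ i)) \<Longrightarrow> L2_cell f"
  for f :: "real^2 \<Rightarrow> pair_field"
  by (simp add: L2_vec_iff)

lemma ip_pair:
  fixes f g :: "real^2 \<Rightarrow> pair_field"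
  assumes f: "L2_cell f" and g: "L2_cell g"
  shows "ip f g = ip (\<lambda>x. f x $ 1) (\<lambda>x. g x $ 1) + ip (\<lambda>x. f x $ 2) (\<lambda>x. g x $ 2)"
proof -
  have "L2_cell (\<lambda>x. f x $ i)" "L2_cell (\<lambda>x. g x $ i)" for i
    using f g by (simp_all add: L2_vec_iff)
  moreover have "f x \<bullet> g x = f x $ 1 \<bullet> g x $ 1 + f x $ 2 \<bullet> g x $ 2" for x
    by (simp add: inner_vec_def[of "f x"] sum_2)
  ultimately show ?thesis
    by (simp add: ip_def L2_inner_integrable)
qed

lemma ip_cong: "(\<And>x. f x \<bullet> g x = f' x \<bullet> g' x) \<Longrightarrow> ip f g = ip f' g'"
  by (simp add: ip_def)

lemma curl_free_shift_L2:
  assumes "curl_free (\<lambda>x. e x - e0)"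
  shows "L2_cell e" "(LINT x|\<mu>. e x) = e0"
proof -
  have L: "L2_cell (\<lambda>x. (e x - e0) + e0)"
    by (rule L2_add[OF curl_free_L2[OF assms] L2_const])
  then show "L2_cell e" by simp
  have "(LINT x|\<mu>. (e x - e0) + e0) = (LINT x|\<mu>. e x - e0) + (LINT x|\<mu>. e0)"
    by (rule Bochner_Integration.integral_add)
       (intro L2_integrable curl_free_L2[OF assms] L2_const)+
  then show "(LINT x|\<mu>. e x) = e0" using assms by (simp add: curl_free_def measure_cell)
qed

lemma pair_solution_mean:
  fixes E :: "real^2 \<Rightarrow> pair_field"
  assumes "\<And>i. curl_free (\<lambda>x. E x $ i - E0 $ i)"
  shows "L2_cell E" "(LINT x|\<mu>. E x) = E0"
proof -
  show L: "L2_cell E"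
    by (intro L2_pair_components curl_free_shift_L2(1)[OF assms])
  show "(LINT x|\<mu>. E x) = E0"
    using curl_free_shift_L2(2)[OF assms] by (simp add: vec_eq_iff[of _ E0] lint_nth[OF L])
qed

text \<open>The Hill-Mandel identity: the fluctuation of \<open>F\<close> is curl-free, so only its
  mean pairs with the flux.\<close>

lemma Hill:
  fixes J F :: "real^2 \<Rightarrow> pair_field"
  assumes J: "\<And>i. div_free2 (\<lambda>x. J x $ i)" and F: "\<And>i. curl_free (\<lambda>x. F x $ i - F0 $ i)"
  shows "ip J F = (LINT x|\<mu>. J x) \<bullet> F0"
proof -
  have JL: "L2_cell J" by (intro L2_pair_components div_free2_L2 J)
  note FL = pair_solution_mean(1)[OF F]
  have "ip J (\<lambda>x. F x - F0) = 0"
    using curl_free_orth[OF F J] by (subst ip_pair[OF JL L2_diff[OF FL L2_const]]) simp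
  then have "ip J F = ip J (\<lambda>x. F0)"
    by (simp add: ip_diff_right[OF FL L2_const JL])
  then show ?thesis by (simp add: ip_const_right[OF JL])
qed

lemma Hill_single:
  assumes J: "div_free2 J" and F: "curl_free (\<lambda>x. F x - F0)"
  shows "ip J F = (LINT x|\<mu>. J x) \<bullet> F0"
proof -
  note JL = div_free2_L2[OF J] and FL = curl_free_shift_L2(1)[OF F]
  have "ip J (\<lambda>x. F x - F0) = 0" by (rule curl_free_orth[OF F J])
  then have "ip J F = ip J (\<lambda>x. F0)"
    by (simp add: ip_diff_right[OF FL L2_const JL])
  then show ?thesis by (simp add: ip_const_right[OF JL])
qed

section \<open>Existence, uniqueness and symmetry of the effective tensor for positive definite
  phases\<close>

locale coercive_composite =
  fixes A :: "(real^2) set" and La Lb :: block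
  assumes A: "A \<in> sets lebesgue" and La: "sym_posdef La" and Lb: "sym_posdef Lb"
begin

abbreviation L :: "real^2 \<Rightarrow> block" where "L \<equiv> two_phase A La Lb"

lemma L_apply: "block_apply (L x) v = (if x \<in> A then block_apply La v else block_apply Lb v)"
  by (simp add: two_phase_def)

lemma flux_L2: "L2_cell E \<Longrightarrow> L2_cell (\<lambda>x. block_apply (L x) (E x))"
  unfolding L_apply by (intro L2_if L2_linear[OF _ block_apply_bounded_linear] A)

lemma L_sym: "u \<bullet> block_apply (L x) v = v \<bullet> block_apply (L x) u"
  using La Lb by (simp add: sym_posdef_def L_apply)

lemma L_coercive: "\<exists>m>0. \<forall>x u. m * (norm u)\<^sup>2 \<le> u \<bullet> block_apply (L x) u"
proof -
  obtain m1 where m1: "m1 > 0" "\<And>u. m1 * (norm u)\<^sup>2 \<le> u \<bullet> block_apply La u"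
    using posdef_coercive[OF block_apply_bounded_linear, of La] La by (auto simp: sym_posdef_def)
  obtain m2 where m2: "m2 > 0" "\<And>u. m2 * (norm u)\<^sup>2 \<le> u \<bullet> block_apply Lb u"
    using posdef_coercive[OF block_apply_bounded_linear, of Lb] Lb by (auto simp: sym_posdef_def)
  have "min m1 m2 * (norm u)\<^sup>2 \<le> m1 * (norm u)\<^sup>2" "min m1 m2 * (norm u)\<^sup>2 \<le> m2 * (norm u)\<^sup>2" for u :: pair_field
    by (intro mult_right_mono; simp)+
  then have "min m1 m2 * (norm u)\<^sup>2 \<le> u \<bullet> block_apply (L x) u" for x u
    using m1(2)[of u] m2(2)[of u] by (auto simp: L_apply intro: order_trans)
  then show ?thesis using m1(1) m2(1) by (intro exI[of _ "min m1 m2"]) simp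
qed

lemma L_bounded: "\<exists>C. \<forall>x u. u \<bullet> block_apply (L x) u \<le> C * (norm u)\<^sup>2"
proof -
  obtain K1 where K1: "\<And>u. norm (block_apply La u) \<le> norm u * K1"
    using bounded_linear.bounded[OF block_apply_bounded_linear] by blast
  obtain K2 where K2: "\<And>u. norm (block_apply Lb u) \<le> norm u * K2"
    using bounded_linear.bounded[OF block_apply_bounded_linear] by blast
  have "u \<bullet> block_apply (L x) u \<le> max K1 K2 * (norm u)\<^sup>2" for x u
  proof -
    have "norm u * K1 \<le> norm u * max K1 K2" "norm u * K2 \<le> norm u * max K1 K2"
      by (intro mult_left_mono; simp)+
    then have "norm (block_apply (L x) u) \<le> norm u * max K1 K2"
      using K1[of u] K2[of u] by (auto simp: L_apply intro: order_trans)
    then have "norm u * norm (block_apply (L x) u) \<le> norm u * (norm u * max K1 K2)"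
      by (rule mult_left_mono) simp
    then show ?thesis
      using norm_cauchy_schwarz[of u "block_apply (L x) u"] by (simp add: power2_eq_square mult_ac)
  qed
  then show ?thesis by blast
qed

lemma energy_lower:
  assumes "\<And>x u. m * (norm u)\<^sup>2 \<le> u \<bullet> block_apply (L x) u" and E: "L2_cell E"
  shows "m * nsq E \<le> ip E (\<lambda>x. block_apply (L x) (E x))"
proof -
  have "(LINT x|\<mu>. m * (norm (E x))\<^sup>2) \<le> (LINT x|\<mu>. E x \<bullet> block_apply (L x) (E x))"
    by (rule integral_mono) (use assms L2_sq[OF E] L2_inner_integrable[OF E flux_L2[OF E]] in auto)
  then show ?thesis by (simp add: nsq_def ip_def)
qed

lemma energy_upper:
  assumes "\<And>x u. u \<bullet> block_apply (L x) u \<le> C * (norm u)\<^sup>2" and E: "L2_cell E"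
  shows "ip E (\<lambda>x. block_apply (L x) (E x)) \<le> C * nsq E"
proof -
  have "(LINT x|\<mu>. E x \<bullet> block_apply (L x) (E x)) \<le> (LINT x|\<mu>. C * (norm (E x))\<^sup>2)"
    by (rule integral_mono) (use assms L2_sq[OF E] L2_inner_integrable[OF E flux_L2[OF E]] in auto)
  then show ?thesis by (simp add: nsq_def ip_def)
qed

lemma L_add: "block_apply (L x) (u + v) = block_apply (L x) u + block_apply (L x) v"
  and L_scale: "block_apply (L x) (c *\<^sub>R u) = c *\<^sub>R block_apply (L x) u"
  using linear_simps[OF block_apply_bounded_linear] by blast+

text \<open>The constant \<open>E0\<close> minus its energy projection onto the mean-zero curl-free
  fields; orthogonality to that space is the weak form of the flux equation.\<close>

theorem solution_exists: "\<exists>E. cell_solution L E0 E"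
proof -
  obtain m where m: "m > 0" "\<And>x u. m * (norm u)\<^sup>2 \<le> u \<bullet> block_apply (L x) u" using L_coercive by blast
  obtain C where C: "\<And>x u. u \<bullet> block_apply (L x) u \<le> C * (norm u)\<^sup>2" using L_bounded by blast
  define S :: "(real^2 \<Rightarrow> pair_field) set" where "S = {g. \<forall>i. curl_free (\<lambda>x. g x $ i)}"
  define b where "b f g = ip f (\<lambda>x. block_apply (L x) (g x))" for f g
  have b_sym: "b f g = b g f" for f g
    unfolding b_def ip_def by (simp add: L_sym)
  have SL: "L2_cell g" if "g \<in> S" for g
    using that by (intro L2_pair_components curl_free_L2) (simp add: S_def)
  have "\<exists>s\<in>S. \<forall>t\<in>S. b (\<lambda>x. E0 - s x) t = 0"
  proof (rule L2_projection[where m = m and C = C])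
    show "m * nsq f \<le> b f f" if "L2_cell f" for f
      unfolding b_def by (rule energy_lower[OF m(2) that])
    show "b f f \<le> C * nsq f" if "L2_cell f" for f
      unfolding b_def by (rule energy_upper[OF C that])
    show "b (\<lambda>x. f x + g x) h = b f h + b g h" if "L2_cell f" "L2_cell g" "L2_cell h" for f g h
      unfolding b_def by (rule ip_add_left[OF that(1,2) flux_L2[OF that(3)]])
    show "b (\<lambda>x. c *\<^sub>R f x) h = c * b f h" for f h c
      unfolding b_def by (rule ip_scale_left)
    show "f \<in> S" if F: "\<And>n. F n \<in> S" and f: "L2_cell f" and lim: "(\<lambda>n. nsq (\<lambda>x. F n x - f x)) \<longlonglongrightarrow> 0" for F f
    proof -
      have FL: "L2_cell (F n)" for n by (rule SL[OF F])
      have "curl_free (\<lambda>x. f x $ i)" for i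
      proof (rule curl_free_closed)
        show "curl_free (\<lambda>x. F n x $ i)" for n using F[of n] by (simp add: S_def)
        show "L2_cell (\<lambda>x. f x $ i)" using f by (simp add: L2_vec_iff)
        have le: "nsq (\<lambda>x. F n x $ i - f x $ i) \<le> nsq (\<lambda>x. F n x - f x)" for n
          unfolding nsq_def
        proof (rule integral_mono)
          have "L2_cell (\<lambda>x. (F n x - f x) $ i)"
            using L2_diff[OF FL f, of n] unfolding L2_vec_iff[of "\<lambda>x. F n x - f x"] by blast
          then show "integrable \<mu> (\<lambda>x. (norm (F n x $ i - f x $ i))\<^sup>2)"
            using L2_sq[of "\<lambda>x. (F n x - f x) $ i"] by simp
          show "integrable \<mu> (\<lambda>x. (norm (F n x - f x))\<^sup>2)" by (rule L2_sq[OF L2_diff[OF FL f]])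
          show "(norm (F n x $ i - f x $ i))\<^sup>2 \<le> (norm (F n x - f x))\<^sup>2" for x
            using Finite_Cartesian_Product.norm_nth_le[of "F n x - f x" i] by (intro power_mono) auto
        qed
        show "(\<lambda>n. nsq (\<lambda>x. F n x $ i - f x $ i)) \<longlonglongrightarrow> 0"
          by (rule tendsto_sandwich[OF _ _ tendsto_const lim])
             (intro always_eventually allI nsq_nonneg le)+
      qed
      then show ?thesis by (simp add: S_def)
    qed
  qed (use m b_sym SL in \<open>auto simp: S_def curl_free_zero L2_const intro: curl_free_add curl_free_scale\<close>)
  then obtain s where s: "s \<in> S" and orth: "\<And>t. t \<in> S \<Longrightarrow> b (\<lambda>x. E0 - s x) t = 0" by blast
  define E where "E x = E0 - s x" for x
  have EL: "L2_cell E" unfolding E_def by (intro L2_diff L2_const SL s)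
  note JL = flux_L2[OF EL]
  have "curl_free (\<lambda>x. E x $ i - E0 $ i)" for i
    using curl_free_scale[of "\<lambda>x. s x $ i" "-1"] s by (simp add: E_def S_def)
  moreover have "div_free2 (\<lambda>x. block_apply (L x) (E x) $ i)" for i
    unfolding div_free2_def
  proof (intro conjI allI impI)
    show "L2_cell (\<lambda>x. block_apply (L x) (E x) $ i)" using JL by (simp add: L2_vec_iff)
    fix \<psi> \<psi>' \<psi>'' assume T: "test_fun2 \<psi> \<psi>' \<psi>''"
    then have c: "curl_free \<psi>'"
      by (rule H1_per_curl_free[OF test_fun_H1_per[OF test_fun2_D]])
    have "curl_free (\<lambda>x. axis i (\<psi>' x) $ j)" for j
      using c by (cases "j = i") (auto simp: axis_def curl_free_zero)
    \<comment> \<open>A variation in the \<open>i\<close>-th component alone isolates the divergence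
      of the \<open>i\<close>-th flux.\<close>
    then have "(\<lambda>x. axis i (\<psi>' x)) \<in> S" by (simp add: S_def)
    then have "ip (\<lambda>x. axis i (\<psi>' x)) (\<lambda>x. block_apply (L x) (E x)) = 0"
      using orth[of "\<lambda>x. axis i (\<psi>' x)"] b_sym[of _ "\<lambda>x. E0 - s x"] by (simp add: b_def E_def)
    moreover have "axis i u \<bullet> v = u \<bullet> v $ i" for u :: "real^2" and v
      by (simp add: inner_axis')
    ultimately show "ip (\<lambda>x. block_apply (L x) (E x) $ i) \<psi>' = 0"
      by (simp add: ip_def inner_commute)
  qed
  ultimately show ?thesis unfolding cell_solution_iff by blast
qed

lemma solution_L2:
  assumes "cell_solution L E0 E"
  shows "L2_cell E" "(LINT x|\<mu>. E x) = E0"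
  using assms pair_solution_mean unfolding cell_solution_iff by blast+

lemma solution_add:
  assumes "cell_solution L E0 E" "cell_solution L F0 F"
  shows "cell_solution L (E0 + F0) (\<lambda>x. E x + F x)"
proof -
  have "curl_free (\<lambda>x. (E x $ i - E0 $ i) + (F x $ i - F0 $ i))" for i
    using assms by (intro curl_free_add) (auto simp: cell_solution_iff)
  moreover have "div_free2 (\<lambda>x. block_apply (L x) (E x) $ i + block_apply (L x) (F x) $ i)" for i
    using assms by (intro div_free2_add) (auto simp: cell_solution_iff)
  ultimately show ?thesis by (simp add: cell_solution_iff L_add algebra_simps)
qed

lemma solution_scale:
  assumes "cell_solution L E0 E"
  shows "cell_solution L (c *\<^sub>R E0) (\<lambda>x. c *\<^sub>R E x)"
proof -
  have "curl_free (\<lambda>x. c *\<^sub>R (E x $ i - E0 $ i))" for i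
    using assms by (intro curl_free_scale) (auto simp: cell_solution_iff)
  moreover have "div_free2 (\<lambda>x. c *\<^sub>R (block_apply (L x) (E x) $ i))" for i
    using assms by (intro div_free2_scale) (auto simp: cell_solution_iff)
  ultimately show ?thesis by (simp add: cell_solution_iff L_scale scaleR_diff_right)
qed

abbreviation mean_flux :: "(real^2 \<Rightarrow> pair_field) \<Rightarrow> pair_field" where
  "mean_flux E \<equiv> (LINT x|\<mu>. block_apply (L x) (E x))"

text \<open>By pointwise symmetry the mixed energy can be read with either field as the flux; Hill's
  identity evaluates both readings.\<close>

lemma reciprocity:
  assumes E: "cell_solution L E0 E" and F: "cell_solution L F0 F"
  shows "mean_flux E \<bullet> F0 = mean_flux F \<bullet> E0"
proof -
  have "ip (\<lambda>x. block_apply (L x) (E x)) F = ip (\<lambda>x. block_apply (L x) (F x)) E"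
    by (rule ip_cong) (metis L_sym inner_commute)
  moreover have "ip (\<lambda>x. block_apply (L x) (E x)) F = mean_flux E \<bullet> F0"
    using E F by (intro Hill) (auto simp: cell_solution_iff)
  moreover have "ip (\<lambda>x. block_apply (L x) (F x)) E = mean_flux F \<bullet> E0"
    using E F by (intro Hill) (auto simp: cell_solution_iff)
  ultimately show ?thesis by simp
qed

text \<open>The mean flux is all that the effective tensor sees. Reciprocity expresses its pairing
  with an arbitrary \<open>F0\<close> through \<open>E0\<close> and one fixed solution for
  \<open>F0\<close>.\<close>

lemma solution_unique:
  assumes E: "cell_solution L E0 E" and F: "cell_solution L E0 F"
  shows "mean_flux E = mean_flux F"
proof -
  have "(mean_flux E - mean_flux F) \<bullet> F0 = 0" for F0
  proof -
    obtain G where G: "cell_solution L F0 G" using solution_exists by blast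
    from reciprocity[OF E this] reciprocity[OF F this] show ?thesis
      by (simp add: inner_diff_left)
  qed
  then show ?thesis using inner_eq_zero_iff[of "mean_flux E - mean_flux F"] by simp
qed

theorem effective_tensor_exists: "\<exists>M. is_effective_tensor L M"
proof -
  obtain E where E: "\<And>E0. cell_solution L E0 (E E0)" using solution_exists by metis
  \<comment> \<open>The chosen solutions may fail to be linear in \<open>E0\<close>, but their mean
    fluxes are linear, by \<open>solution_unique\<close>.\<close>
  define f where "f E0 = mean_flux (E E0)" for E0
  have "linear f"
  proof (rule linearI)
    fix E0 F0 and c :: real
    have i: "integrable \<mu> (\<lambda>x. block_apply (L x) (E E0 x))" for E0
      by (intro L2_integrable flux_L2 solution_L2(1)[OF E])
    have "f (E0 + F0) = mean_flux (\<lambda>x. E E0 x + E F0 x)"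
      unfolding f_def by (rule solution_unique[OF E solution_add[OF E E]])
    then show "f (E0 + F0) = f E0 + f F0" using i by (simp add: L_add f_def)
    have "f (c *\<^sub>R E0) = mean_flux (\<lambda>x. c *\<^sub>R E E0 x)"
      unfolding f_def by (rule solution_unique[OF E solution_scale[OF E]])
    then show "f (c *\<^sub>R E0) = c *\<^sub>R f E0" by (simp add: L_scale f_def)
  qed
  from linear_block_apply[OF this] obtain M where M: "\<And>E0. f E0 = block_apply M E0" by blast
  have "cell_solution L E0 (E E0) \<and> block_apply M E0 = mean_flux (E E0)" for E0
    using E M f_def by metis
  then have "is_effective_tensor L M"
    unfolding is_effective_tensor_def by blast
  then show ?thesis by blast
qed

lemma effective_tensor_eqI:
  assumes "is_effective_tensor L M"
  shows "effective_tensor L = M"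
  unfolding effective_tensor_def
proof (rule the_equality)
  show "is_effective_tensor L M" by fact
  fix N assume N: "is_effective_tensor L N"
  show "N = M"
  proof (rule block_apply_ext)
    fix E0
    obtain E where E: "cell_solution L E0 E" "block_apply M E0 = mean_flux E"
      using assms unfolding is_effective_tensor_def by blast
    obtain F where F: "cell_solution L E0 F" "block_apply N E0 = mean_flux F"
      using N unfolding is_effective_tensor_def by blast
    show "block_apply N E0 = block_apply M E0"
      using solution_unique[OF E(1) F(1)] E(2) F(2) by simp
  qed
qed

lemma is_effective_tensor: "is_effective_tensor L (effective_tensor L)"
  using effective_tensor_exists effective_tensor_eqI by blast

text \<open>Symmetry is reciprocity. The quadratic form at \<open>u\<close> equals the energy of the
  solution, which is not null almost everywhere because its mean is \<open>u\<close>.\<close>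

lemma effective_tensor_sym_posdef: "sym_posdef (effective_tensor L)"
proof -
  let ?M = "effective_tensor L"
  have M: "\<exists>E. cell_solution L E0 E \<and> block_apply ?M E0 = mean_flux E" for E0
    using is_effective_tensor unfolding is_effective_tensor_def by blast
  have "u \<bullet> block_apply ?M v = v \<bullet> block_apply ?M u" for u v
  proof -
    obtain E where E: "cell_solution L u E" "block_apply ?M u = mean_flux E" using M by blast
    obtain F where F: "cell_solution L v F" "block_apply ?M v = mean_flux F" using M by blast
    show ?thesis using reciprocity[OF E(1) F(1)] E(2) F(2) by (simp add: inner_commute)
  qed
  moreover have "0 < u \<bullet> block_apply ?M u" if u: "u \<noteq> 0" for u
  proof -
    obtain E where E: "cell_solution L u E" "block_apply ?M u = mean_flux E" using M by blast
    note EL = solution_L2[OF E(1)]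
    obtain m where m: "m > 0" "\<And>x u. m * (norm u)\<^sup>2 \<le> u \<bullet> block_apply (L x) u" using L_coercive by blast
    have "nsq E \<noteq> 0"
    proof
      assume "nsq E = 0"
      then have "AE x in \<mu>. E x = 0" by (rule nsq_zero_AE[OF EL(1)])
      then have "(LINT x|\<mu>. E x) = 0" using integral_eq_zero_AE by blast
      with EL(2) u show False by simp
    qed
    then have "0 < nsq E" using nsq_nonneg[of E] by simp
    then have "0 < m * nsq E" using m(1) by simp
    also have "\<dots> \<le> ip E (\<lambda>x. block_apply (L x) (E x))" by (rule energy_lower[OF m(2) EL(1)])
    also have "\<dots> = u \<bullet> block_apply ?M u"
      using E(1) Hill[of "\<lambda>x. block_apply (L x) (E x)" E u] E(2)
      by (simp add: cell_solution_iff ip_commute[of E] inner_commute)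
    finally show ?thesis .
  qed
  ultimately show ?thesis by (simp add: sym_posdef_def)
qed

end

section \<open>Covariance and duality\<close>

text \<open>The action of \<open>kron X (mat 1)\<close>. It only mixes the two components with
  constant coefficients, so it preserves curl-free and divergence-free pairs.\<close>

definition lift :: "real^2^2 \<Rightarrow> pair_field \<Rightarrow> pair_field" where
  "lift X E = (\<chi> i. X $ i $ 1 *\<^sub>R E $ 1 + X $ i $ 2 *\<^sub>R E $ 2)"

lemma lift_nth: "lift X E $ i = X $ i $ 1 *\<^sub>R E $ 1 + X $ i $ 2 *\<^sub>R E $ 2"
  by (simp add: lift_def)

lemma lift_bounded_linear: "bounded_linear (lift X)"
proof -
  have "linear (lift X)"
    by (rule linearI) (simp_all add: lift_def vec_eq_iff algebra_simps)
  then show ?thesis by (simp add: linear_conv_bounded_linear)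
qed

lemma lift_mult: "lift X (lift Y E) = lift (X ** Y) E"
  by (simp add: lift_def vec_eq_iff matrix_matrix_mult_def sum_2 algebra_simps)

lemma lift_mat_1: "lift (mat 1) E = E"
  by (simp add: lift_def vec_eq_iff forall_2 mat_def)

lemma T_op_apply: "block_apply T_op E $ 1 = - (R_perp *v E $ 2)" "block_apply T_op E $ 2 = R_perp *v E $ 1"
  by (simp_all add: block_apply_nth T_op_def kron_def R_perp_def scaleR_matrix_vector[symmetric] vec_eq_iff
      forall_2 matrix_vector_mult_def sum_2)

lemma isotropic_phase_apply:
  "block_apply (isotropic_phase \<sigma> r) E $ 1 = \<sigma> $ 1 $ 1 *\<^sub>R E $ 1 + \<sigma> $ 1 $ 2 *\<^sub>R E $ 2 - r *\<^sub>R (R_perp *v E $ 2)"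
  "block_apply (isotropic_phase \<sigma> r) E $ 2 = \<sigma> $ 2 $ 1 *\<^sub>R E $ 1 + \<sigma> $ 2 $ 2 *\<^sub>R E $ 2 + r *\<^sub>R (R_perp *v E $ 1)"
  unfolding isotropic_phase_def block_apply_add_left block_apply_scale_left
  by (simp_all add: T_op_apply) (simp_all add: block_apply_nth kron_def scaleR_matrix_vector)

lemma spd_sym: "spd \<sigma> \<Longrightarrow> \<sigma> $ 2 $ 1 = \<sigma> $ 1 $ 2"
  by (simp add: spd_def transpose_def vec_eq_iff)

lemma spd_quadratic:
  assumes "spd \<sigma>" "x \<noteq> 0 \<or> y \<noteq> 0"
  shows "0 < \<sigma> $ 1 $ 1 * x\<^sup>2 + 2 * \<sigma> $ 1 $ 2 * x * y + \<sigma> $ 2 $ 2 * y\<^sup>2"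
proof -
  have "(vector [x, y] :: real^2) \<noteq> 0" using assms(2) by (auto simp: vec_eq_iff forall_2)
  then have "0 < vector [x, y] \<bullet> (\<sigma> *v vector [x, y])" using assms(1) by (simp add: spd_def)
  also have "\<dots> = \<sigma> $ 1 $ 1 * x\<^sup>2 + 2 * \<sigma> $ 1 $ 2 * x * y + \<sigma> $ 2 $ 2 * y\<^sup>2"
    using spd_sym[OF assms(1)]
    by (simp add: inner_2 matrix_vector_mult_def sum_2 power2_eq_square algebra_simps)
  finally show ?thesis .
qed

text \<open>Symmetry holds because \<open>R_perp\<close> is skew and occurs with opposite signs in
  the two off-diagonal blocks. Positivity comes from completing the square.\<close>

lemma isotropic_phase_sym_posdef:
  assumes \<sigma>: "spd \<sigma>" and r: "r\<^sup>2 < det \<sigma>"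
  shows "sym_posdef (isotropic_phase \<sigma> r)"
  unfolding sym_posdef_def
proof (intro conjI allI impI)
  note s = spd_sym[OF \<sigma>]
  have ip2: "u \<bullet> v = u $ 1 \<bullet> v $ 1 + u $ 2 \<bullet> v $ 2" for u v :: pair_field
    by (simp only: inner_vec_def[of u v] sum_2)
  show "u \<bullet> block_apply (isotropic_phase \<sigma> r) v = v \<bullet> block_apply (isotropic_phase \<sigma> r) u" for u v
    unfolding ip2 isotropic_phase_apply s by (simp add: inner_2 algebra_simps)
  fix u :: pair_field assume u: "u \<noteq> 0"
  define a b d where "a = \<sigma> $ 1 $ 1" "b = \<sigma> $ 1 $ 2" "d = \<sigma> $ 2 $ 2"
  note abd = this
  have a: "0 < a" using spd_quadratic[OF \<sigma>, of 1 0] by (simp add: abd)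
  have det: "0 < a * d - b\<^sup>2 - r\<^sup>2" using r s by (simp add: det_2 abd power2_eq_square)
  let ?e = "u \<bullet> block_apply (isotropic_phase \<sigma> r) u"
  let ?w = "a *\<^sub>R u $ 1 + b *\<^sub>R u $ 2 - r *\<^sub>R (R_perp *v u $ 2)"
  \<comment> \<open>Completing the square in \<open>u $ 1\<close>: the quarter turn is an isometry
    and \<open>u $ 2\<close> is orthogonal to its own turn, so the remainder is a Schur complement
    times the squared norm of \<open>u $ 2\<close>.\<close>
  have eq: "a * ?e = ?w \<bullet> ?w + (a * d - b\<^sup>2 - r\<^sup>2) * (u $ 2 \<bullet> u $ 2)"
    unfolding ip2 isotropic_phase_apply s abd[symmetric]
    by (simp add: inner_2 power2_eq_square algebra_simps)
  have "0 < a * ?e"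
  proof (cases "u $ 2 = 0")
    case True
    then have "u $ 1 \<noteq> 0" using u by (auto simp: vec_eq_iff[of u] forall_2)
    then show ?thesis unfolding eq using True a by (simp add: matrix_vector_mult_0_right)
  next
    case False
    then have "0 < (a * d - b\<^sup>2 - r\<^sup>2) * (u $ 2 \<bullet> u $ 2)" using det by simp
    then show ?thesis unfolding eq by (simp add: add_nonneg_pos)
  qed
  then show "0 < ?e" using a by (simp add: zero_less_mult_iff)
qed

lemma curl_free_shift_rotate:
  assumes "curl_free (\<lambda>x. e x - e0)"
  shows "div_free2 (\<lambda>x. R_perp *v e x)"
proof -
  have "div_free2 (\<lambda>x. R_perp *v (e x - e0) + R_perp *v e0)"
    by (intro div_free2_add curl_free_rotate assms div_free2_const)
  then show ?thesis by (simp add: matrix_vector_mult_diff_distrib)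
qed

lemma T_op_div_free:
  assumes "\<And>i. curl_free (\<lambda>x. E x $ i - E0 $ i)"
  shows "div_free2 (\<lambda>x. block_apply T_op (E x) $ i)"
proof -
  have "div_free2 (\<lambda>x. - (R_perp *v E x $ 2))"
    using div_free2_scale[OF curl_free_shift_rotate[OF assms], of "-1"] by simp
  then show ?thesis
    using exhaust_2[of i] curl_free_shift_rotate[OF assms] by (auto simp: T_op_apply)
qed

text \<open>A solution for \<open>L'\<close> with applied field \<open>lift X E0\<close>, pulled
  back by the inverse of \<open>X\<close>, solves the problem for \<open>L\<close>: the congruence
  recombines the fluxes, and the \<open>T_op\<close> term is divergence-free with mean determined by
  \<open>E0\<close>.\<close>

theorem effective_tensor_transform:
  assumes M': "is_effective_tensor L' M'"
    and L: "\<And>x v. block_apply (L x) v = lift (transpose X) (block_apply (L' x) (lift X v)) + c *\<^sub>R block_apply T_op v"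
    and M: "\<And>v. block_apply M v = lift (transpose X) (block_apply M' (lift X v)) + c *\<^sub>R block_apply T_op v"
    and X: "invertible X"
  shows "is_effective_tensor L M"
  unfolding is_effective_tensor_def
proof
  fix E0
  obtain Y where Y: "X ** Y = mat 1" "Y ** X = mat 1" using X unfolding invertible_def by blast
  obtain E' where E': "cell_solution L' (lift X E0) E'"
    and mE': "block_apply M' (lift X E0) = (LINT x|\<mu>. block_apply (L' x) (E' x))"
    using M' unfolding is_effective_tensor_def by blast
  define J where "J x = block_apply (L' x) (E' x)" for x
  have J: "div_free2 (\<lambda>x. J x $ i)" for i using E' by (simp add: cell_solution_iff J_def)
  have c': "curl_free (\<lambda>x. E' x $ i - lift X E0 $ i)" for i using E' by (simp add: cell_solution_iff)
  define E where "E x = lift Y (E' x)" for x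
  have XE: "lift X (E x) = E' x" for x by (simp add: E_def lift_mult Y lift_mat_1)
  have E0: "E0 = lift Y (lift X E0)" by (simp add: lift_mult Y lift_mat_1)
  have cE: "curl_free (\<lambda>x. E x $ i - E0 $ i)" for i
  proof -
    have "curl_free (\<lambda>x. Y $ i $ 1 *\<^sub>R (E' x $ 1 - lift X E0 $ 1) + Y $ i $ 2 *\<^sub>R (E' x $ 2 - lift X E0 $ 2))"
      by (intro curl_free_add curl_free_scale c')
    moreover have "E x $ i - E0 $ i = Y $ i $ 1 *\<^sub>R (E' x $ 1 - lift X E0 $ 1) + Y $ i $ 2 *\<^sub>R (E' x $ 2 - lift X E0 $ 2)" for x
      by (subst E0) (simp add: E_def lift_nth[of Y] algebra_simps)
    ultimately show ?thesis by simp
  qed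
  have flux: "block_apply (L x) (E x) = lift (transpose X) (J x) + c *\<^sub>R block_apply T_op (E x)" for x
    by (simp add: L XE J_def)
  have "div_free2 (\<lambda>x. block_apply (L x) (E x) $ i)" for i
    unfolding flux vector_add_component vector_scaleR_component lift_nth
    by (intro div_free2_add div_free2_scale J T_op_div_free[OF cE])
  then have sol: "cell_solution L E0 E" using cE by (simp add: cell_solution_iff)
  note mE = pair_solution_mean[OF cE]
  have iJ: "integrable \<mu> J"
    by (intro L2_integrable L2_pair_components div_free2_L2 J)
  note iE = L2_integrable[OF mE(1)]
  have "(LINT x|\<mu>. block_apply (L x) (E x)) = (LINT x|\<mu>. lift (transpose X) (J x)) + (LINT x|\<mu>. c *\<^sub>R block_apply T_op (E x))"
    unfolding flux
    by (intro Bochner_Integration.integral_add integrable_scaleR_right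
        integrable_bounded_linear[OF lift_bounded_linear iJ]
        integrable_bounded_linear[OF block_apply_bounded_linear iE])
  also have "\<dots> = lift (transpose X) (LINT x|\<mu>. J x) + c *\<^sub>R block_apply T_op E0"
    by (simp add: integral_bounded_linear[OF lift_bounded_linear iJ]
        integral_bounded_linear[OF block_apply_bounded_linear iE] mE(2))
  also have "\<dots> = block_apply M E0" by (simp add: M mE' J_def)
  finally show "\<exists>E. cell_solution L E0 E \<and> block_apply M E0 = (LINT x|\<mu>. block_apply (L x) (E x))"
    using sol by (intro exI[of _ E]) simp
qed

text \<open>Scalar reciprocity. An effective matrix \<open>S\<close> supplies one solution for each
  applied field; pairing with these fixes the mean current of every other solution, with the
  transpose because symmetry of \<open>S\<close> is not yet known.\<close>

lemma conductivity_flux: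
  assumes S: "is_effective_conductivity (two_phase A (mat 1) (h *\<^sub>R mat 1)) S"
    and e: "conductivity_solution (two_phase A (mat 1) (h *\<^sub>R mat 1)) e0 e"
  shows "(LINT x|\<mu>. two_phase A (mat 1) (h *\<^sub>R mat 1) x *v e x) = transpose S *v e0"
proof -
  let ?s = "two_phase A (mat 1) (h *\<^sub>R mat 1) :: real^2 \<Rightarrow> real^2^2"
  have "((LINT x|\<mu>. ?s x *v e x) - transpose S *v e0) \<bullet> f0 = 0" for f0
  proof -
    obtain f where f: "conductivity_solution ?s f0 f" "S *v f0 = (LINT x|\<mu>. ?s x *v f x)"
      using S unfolding is_effective_conductivity_def by blast
    have "ip (\<lambda>x. ?s x *v e x) f = ip (\<lambda>x. ?s x *v f x) e"
      by (rule ip_cong) (simp add: two_phase_def scaleR_matrix_vector inner_commute)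
    moreover have "ip (\<lambda>x. ?s x *v e x) f = (LINT x|\<mu>. ?s x *v e x) \<bullet> f0"
      using e f by (intro Hill_single) (auto simp: conductivity_solution_iff)
    moreover have "ip (\<lambda>x. ?s x *v f x) e = (LINT x|\<mu>. ?s x *v f x) \<bullet> e0"
      using e f by (intro Hill_single) (auto simp: conductivity_solution_iff)
    ultimately have "(LINT x|\<mu>. ?s x *v e x) \<bullet> f0 = (S *v f0) \<bullet> e0" by (simp add: f(2))
    also have "\<dots> = (transpose S *v e0) \<bullet> f0"
      by (simp add: dot_lmul_matrix[symmetric] inner_commute)
    finally show ?thesis by (simp add: inner_diff_left)
  qed
  from this[of "(LINT x|\<mu>. ?s x *v e x) - transpose S *v e0"] show ?thesis by simp
qed

text \<open>By \<open>conductivity_flux\<close> every effective matrix equals the transpose of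
  \<open>S\<close>. Taking \<open>S\<close> itself gives symmetry, and then uniqueness.\<close>

lemma effective_conductivity_eqI:
  assumes S: "is_effective_conductivity (two_phase A (mat 1) (h *\<^sub>R mat 1)) S"
  shows "\<Sigma>_eff A h = S" "transpose S = S"
proof -
  let ?s = "two_phase A (mat 1) (h *\<^sub>R mat 1) :: real^2 \<Rightarrow> real^2^2"
  have *: "T = transpose S" if T: "is_effective_conductivity ?s T" for T
  proof -
    have "T *v e0 = transpose S *v e0" for e0
    proof -
      obtain e where e: "conductivity_solution ?s e0 e" "T *v e0 = (LINT x|\<mu>. ?s x *v e x)"
        using T unfolding is_effective_conductivity_def by blast
      then show ?thesis using conductivity_flux[OF S e(1)] by simp
    qed
    then show ?thesis by (simp add: matrix_eq)
  qed
  show sym: "transpose S = S" using *[OF S] by simp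
  show "\<Sigma>_eff A h = S"
    unfolding \<Sigma>_eff_def effective_conductivity_def
  proof (rule the_equality)
    show "is_effective_conductivity ?s S" by (rule S)
    show "T = S" if "is_effective_conductivity ?s T" for T
      using *[OF that] unfolding sym .
  qed
qed

lemma sym_posdef_block:
  assumes M: "sym_posdef M"
  shows "spd (M $ 1 $ 1)" "transpose (M $ 2 $ 1) = M $ 1 $ 2"
proof -
  have ip2: "u \<bullet> v = u $ 1 \<bullet> v $ 1 + u $ 2 \<bullet> v $ 2" for u v :: pair_field
    by (simp only: inner_vec_def[of u v] sum_2)
  have entry: "axis k (a :: real^2) \<bullet> block_apply M (axis l c) = a \<bullet> (M $ k $ l *v c)" for a c k l
  proof -
    have "block_apply M (axis l c) $ k = M $ k $ l *v c"
      using exhaust_2[of l] by (auto simp: block_apply_nth axis_def)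
    then show ?thesis by (simp add: inner_axis')
  qed
  have sym: "a \<bullet> (M $ k $ l *v c) = c \<bullet> (M $ l $ k *v a)" for a c k l
    using M unfolding sym_posdef_def by (metis entry)
  have tr: "transpose (M $ l $ k) = M $ k $ l" for k l
  proof -
    have "(M $ k $ l *v c - transpose (M $ l $ k) *v c) \<bullet> a = 0" for a c
      using sym[of a k l c] dot_lmul_matrix[of c "M $ l $ k" a]
      by (simp add: inner_diff_left inner_diff_right inner_commute)
    then have "M $ k $ l *v c = transpose (M $ l $ k) *v c" for c
      by (metis inner_eq_zero_iff right_minus_eq)
    then show ?thesis by (simp add: matrix_eq)
  qed
  show "transpose (M $ 2 $ 1) = M $ 1 $ 2" by (rule tr)
  have "0 < x \<bullet> (M $ 1 $ 1 *v x)" if "x \<noteq> 0" for x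
  proof -
    have "axis 1 x \<noteq> (0 :: pair_field)" using that by (auto simp: axis_def vec_eq_iff[of "vec_lambda _"])
    then show ?thesis using M entry[of 1 x 1 x] by (metis sym_posdef_def)
  qed
  then show "spd (M $ 1 $ 1)" by (simp add: spd_def tr)
qed

lemma spd_invertible: "spd M \<Longrightarrow> invertible M"
  unfolding invertible_left_inverse matrix_left_invertible_ker spd_def by fastforce

section \<open>The canonical composite and the duality relation\<close>

definition diag2 :: "real \<Rightarrow> real \<Rightarrow> real^2^2" where
  "diag2 a b = vector [vector [a, 0], vector [0, b]]"

lemma diag2_nth [simp]:
  "diag2 a b $ 1 $ 1 = a" "diag2 a b $ 1 $ 2 = 0" "diag2 a b $ 2 $ 1 = 0" "diag2 a b $ 2 $ 2 = b"
  by (simp_all add: diag2_def)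

lemma det_diag2 [simp]: "det (diag2 a b) = a * b"
  by (simp add: det_2)

lemma spd_diag2:
  assumes "0 < a" "0 < b"
  shows "spd (diag2 a b)"
proof -
  have "0 < x \<bullet> (diag2 a b *v x)" if "x \<noteq> 0" for x
  proof -
    have eq: "x \<bullet> (diag2 a b *v x) = a * (x $ 1)\<^sup>2 + b * (x $ 2)\<^sup>2"
      by (simp add: inner_2 matrix_vector_mult_def sum_2 power2_eq_square)
    have nn: "0 \<le> a * (x $ 1)\<^sup>2" "0 \<le> b * (x $ 2)\<^sup>2" using assms by auto
    have "x $ 1 \<noteq> 0 \<or> x $ 2 \<noteq> 0" using that by (auto simp: vec_eq_iff forall_2)
    then show ?thesis
    proof
      assume "x $ 1 \<noteq> 0"
      then have "0 < a * (x $ 1)\<^sup>2" using assms by simp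
      then show ?thesis using eq nn by linarith
    next
      assume "x $ 2 \<noteq> 0"
      then have "0 < b * (x $ 2)\<^sup>2" using assms by simp
      then show ?thesis using eq nn by linarith
    qed
  qed
  then show ?thesis
    by (auto simp: spd_def transpose_def vec_eq_iff forall_2)
qed

text \<open>
  The shift by \<open>- \<delta> T\<close> makes the degenerate phases of the duality argument positive definite.
\<close>

locale canonical_composite =
  fixes A :: "(real^2) set" and l1 l2 \<delta> :: real
  assumes A: "A \<in> sets lebesgue" and l1: "0 < l1" and l2: "0 < l2"
    and \<delta>: "0 < \<delta>" "\<delta> \<le> 1" "\<delta> \<le> sqrt (l1 * l2)"
begin

abbreviation La :: block where "La \<equiv> isotropic_phase (diag2 1 1) (1 - \<delta>)"
abbreviation Lb :: block where "Lb \<equiv> isotropic_phase (diag2 l1 l2) (sqrt (l1 * l2) - \<delta>)"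

sublocale coercive_composite A La Lb
proof
  show "A \<in> sets lebesgue" by (rule A)
  show "sym_posdef La"
  proof (rule isotropic_phase_sym_posdef)
    have "(1 - \<delta>)\<^sup>2 \<le> (1 - \<delta>) * 1" unfolding power2_eq_square using \<delta> by (intro mult_left_mono) auto
    then show "(1 - \<delta>)\<^sup>2 < det (diag2 1 1)" using \<delta> by simp
  qed (simp add: spd_diag2)
  show "sym_posdef Lb"
  proof (rule isotropic_phase_sym_posdef)
    have "(sqrt (l1 * l2) - \<delta>)\<^sup>2 < (sqrt (l1 * l2))\<^sup>2" using \<delta> by (intro power_strict_mono) auto
    then show "(sqrt (l1 * l2) - \<delta>)\<^sup>2 < det (diag2 l1 l2)" using l1 l2 by simp
  qed (simp add: spd_diag2 l1 l2)
qed

text \<open>Stands for the effective tensor of the degenerate phases, whose own cell problem is not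
  coercive: the shift is undone after averaging.\<close>

abbreviation M0 :: block where "M0 \<equiv> effective_tensor L + \<delta> *\<^sub>R T_op"

abbreviation s :: "real^2 \<Rightarrow> real^2^2" where "s \<equiv> two_phase A (mat 1) (sqrt (l2 / l1) *\<^sub>R mat 1)"

text \<open>
  For the degenerate flux \<open>J = L E + \<delta> T E\<close> this is \<open>J2 = h R J1\<close>.
\<close>

lemma flux_duality:
  "s x *v (R_perp *v (block_apply (L x) v + \<delta> *\<^sub>R block_apply T_op v) $ 1)
    = (block_apply (L x) v + \<delta> *\<^sub>R block_apply T_op v) $ 2"
proof -
  \<comment> \<open>With h = sqrt (l2 / l1) and s = sqrt (l1 l2) these are h l1 = s and h s = l2,
    the proportionality of the two rows of the degenerate phase.\<close>
  have r: "sqrt (l2 / l1) * l1 = sqrt (l1 * l2)" "sqrt (l2 / l1) * sqrt (l1 * l2) = l2"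
  proof -
    have "sqrt (l2 / l1) * l1 = sqrt (l2 / l1) * sqrt (l1\<^sup>2)" using l1 by simp
    also have "\<dots> = sqrt (l1 * l2)"
      unfolding real_sqrt_mult[symmetric] using l1 by (simp add: power2_eq_square)
    finally show "sqrt (l2 / l1) * l1 = sqrt (l1 * l2)" .
    have "sqrt (l2 / l1) * sqrt (l1 * l2) = sqrt (l2\<^sup>2)"
      unfolding real_sqrt_mult[symmetric] using l1 by (simp add: power2_eq_square)
    then show "sqrt (l2 / l1) * sqrt (l1 * l2) = l2" using l2 by simp
  qed
  have r': "sqrt (l2 / l1) * (l1 * y) = sqrt (l1 * l2) * y" "sqrt (l2 / l1) * (sqrt (l1 * l2) * y) = l2 * y" for y
    unfolding mult.assoc[symmetric] r by simp_all
  show ?thesis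
  proof (cases "x \<in> A")
    case True
    then show ?thesis
      by (simp add: two_phase_def isotropic_phase_apply T_op_apply vec_eq_iff forall_2 algebra_simps)
  next
    case False
    have "sqrt (l2 / l1) *\<^sub>R (R_perp *v (l1 *\<^sub>R v $ 1 - sqrt (l1 * l2) *\<^sub>R (R_perp *v v $ 2)))
        = l2 *\<^sub>R v $ 2 + sqrt (l1 * l2) *\<^sub>R (R_perp *v v $ 1)"
      by (simp add: vec_eq_iff forall_2 right_diff_distrib distrib_left r')
    with False show ?thesis
      by (simp add: two_phase_def isotropic_phase_apply T_op_apply scaleR_matrix_vector algebra_simps)
  qed
qed

lemma conductivity_from_solution:
  "\<exists>e. conductivity_solution s (R_perp *v block_apply M0 E0 $ 1) e \<and>
     (LINT x|\<mu>. s x *v e x) = block_apply M0 E0 $ 2"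
proof -
  obtain E where E: "cell_solution L E0 E" "block_apply (effective_tensor L) E0 = mean_flux E"
    using is_effective_tensor unfolding is_effective_tensor_def by blast
  define J where "J x = block_apply (L x) (E x) + \<delta> *\<^sub>R block_apply T_op (E x)" for x
  have c: "curl_free (\<lambda>x. E x $ i - E0 $ i)" for i using E(1) by (simp add: cell_solution_iff)
  have J: "div_free2 (\<lambda>x. J x $ i)" for i
    unfolding J_def vector_add_component vector_scaleR_component
    using E(1) by (intro div_free2_add div_free2_scale T_op_div_free[OF c]) (simp add: cell_solution_iff)
  have JL: "L2_cell J" by (intro L2_pair_components div_free2_L2 J)
  have "(LINT x|\<mu>. J x) = mean_flux E + (LINT x|\<mu>. \<delta> *\<^sub>R block_apply T_op (E x))"
    unfolding J_def
    by (intro Bochner_Integration.integral_add L2_integrable flux_L2 L2_scale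
        L2_linear[OF _ block_apply_bounded_linear] pair_solution_mean(1)[OF c])
  also have "\<dots> = block_apply M0 E0"
    using integral_bounded_linear[OF block_apply_bounded_linear L2_integrable[OF pair_solution_mean(1)[OF c]], of T_op]
    by (simp add: E(2) block_apply_add_left block_apply_scale_left pair_solution_mean(2)[OF c])
  finally have "(LINT x|\<mu>. J x $ i) = block_apply M0 E0 $ i" for i
    using lint_nth[OF JL, of i] by simp
  moreover have "s x *v (R_perp *v J x $ 1) = J x $ 2" for x
    unfolding J_def by (rule flux_duality)
  moreover have "curl_free (\<lambda>x. R_perp *v J x $ 1 - R_perp *v (LINT x|\<mu>. J x $ 1))"
    by (rule div_free2_rotate[OF J])
  ultimately show ?thesis
    using J[of 2]
    by (intro exI[of _ "\<lambda>x. R_perp *v J x $ 1"]) (simp add: conductivity_solution_iff)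
qed

lemma spd_block: "spd (effective_tensor L $ 1 $ 1)"
  by (rule sym_posdef_block(1)[OF effective_tensor_sym_posdef])

lemma M0_11: "M0 $ 1 $ 1 = effective_tensor L $ 1 $ 1"
  by (simp add: T_op_def kron_def R_perp_def)

text \<open>Every applied field \<open>e0\<close> of the scalar problem is reached from the tensor
  problem because the upper left block is invertible. This shows that an effective conductivity
  exists; \<open>conductivity_flux\<close> then yields the relation for all
  \<open>E0\<close>.\<close>

theorem conductivity_relation:
  "transpose (\<Sigma>_eff A (sqrt (l2 / l1))) = \<Sigma>_eff A (sqrt (l2 / l1))"
  "block_apply M0 E0 $ 2 = \<Sigma>_eff A (sqrt (l2 / l1)) *v (R_perp *v block_apply M0 E0 $ 1)"
proof -
  let ?B = "M0 $ 1 $ 1"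
  have "invertible ?B" unfolding M0_11 by (rule spd_invertible[OF spd_block])
  then obtain Y where Y: "?B ** Y = mat 1" unfolding invertible_def by blast
  \<comment> \<open>Apply \<open>axis 1 u\<close>, with \<open>u\<close> chosen so that the first
    mean flux is minus the quarter turn of \<open>e0\<close>; its own quarter turn is then
    \<open>e0\<close>, and \<open>S *v e0\<close> is the second mean flux.\<close>
  define S where "S = M0 $ 2 $ 1 ** Y ** (- R_perp)"
  have "is_effective_conductivity s S"
    unfolding is_effective_conductivity_def
  proof
    fix e0
    let ?u = "Y *v (- (R_perp *v e0))"
    have neg: "(- R_perp) *v e0 = - (R_perp *v e0)"
      using scaleR_matrix_vector[of "-1" R_perp e0] by simp
    have 1: "block_apply M0 (axis 1 ?u) $ 1 = - (R_perp *v e0)"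
      using Y by (simp only: block_apply_nth axis_nth) (simp add: axis_def matrix_vector_mul_assoc)
    have 2: "block_apply M0 (axis 1 ?u) $ 2 = S *v e0"
      unfolding S_def
      by (simp only: block_apply_nth axis_nth) (simp add: axis_def neg flip: matrix_vector_mul_assoc)
    obtain e where "conductivity_solution s (R_perp *v block_apply M0 (axis 1 ?u) $ 1) e"
      "(LINT x|\<mu>. s x *v e x) = block_apply M0 (axis 1 ?u) $ 2"
      using conductivity_from_solution[of "axis 1 ?u"] by blast
    moreover have "R_perp *v block_apply M0 (axis 1 ?u) $ 1 = e0"
      unfolding 1 by (simp add: vec_eq_iff forall_2)
    ultimately show "\<exists>e. conductivity_solution s e0 e \<and> S *v e0 = (LINT x|\<mu>. s x *v e x)"
      unfolding 2 by (intro exI[of _ e]) simp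
  qed
  note S = effective_conductivity_eqI[OF this] conductivity_flux[OF this]
  show "transpose (\<Sigma>_eff A (sqrt (l2 / l1))) = \<Sigma>_eff A (sqrt (l2 / l1))" by (simp add: S)
  obtain e where "conductivity_solution s (R_perp *v block_apply M0 E0 $ 1) e"
    "(LINT x|\<mu>. s x *v e x) = block_apply M0 E0 $ 2"
    using conductivity_from_solution[of E0] by blast
  then show "block_apply M0 E0 $ 2 = \<Sigma>_eff A (sqrt (l2 / l1)) *v (R_perp *v block_apply M0 E0 $ 1)"
    using S(3) by (simp add: S(1,2))
qed

end

section \<open>Reduction to the canonical composite\<close>

lemma matrix2_eqI:
  fixes A B :: "real^2^2"
  assumes "A $ 1 $ 1 = B $ 1 $ 1" "A $ 1 $ 2 = B $ 1 $ 2" "A $ 2 $ 1 = B $ 2 $ 1" "A $ 2 $ 2 = B $ 2 $ 2"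
  shows "A = B"
  using assms by (simp add: vec_eq_iff forall_2)

lemma matrix_mult_2: "((A :: real^2^2) ** B) $ i $ j = A $ i $ 1 * B $ 1 $ j + A $ i $ 2 * B $ 2 $ j"
  by (simp add: matrix_matrix_mult_def sum_2)

lemma R_perp_nth [simp]:
  "R_perp $ 1 $ 1 = 0" "R_perp $ 1 $ 2 = -1" "R_perp $ 2 $ 1 = 1" "R_perp $ 2 $ 2 = 0"
  by (simp_all add: R_perp_def)

lemma cof_nth [simp]:
  "cof M $ 1 $ 1 = M $ 2 $ 2" "cof M $ 1 $ 2 = - M $ 2 $ 1"
  "cof M $ 2 $ 1 = - M $ 1 $ 2" "cof M $ 2 $ 2 = M $ 1 $ 1"
  by (simp_all add: cof_def)

section \<open>Simultaneous diagonalization of the two quadratic forms\<close>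

text \<open>A singular symmetric 2 by 2 matrix is plus or minus a dyad v v^T. The square roots of
  the diagonal give v up to the relative sign of its entries, which is that of
  \<open>b\<close>.\<close>

lemma symmetric_rank_one:
  fixes a b d :: real
  assumes "a * d = b\<^sup>2"
  shows "\<exists>\<epsilon> v1 v2. (\<epsilon> = 1 \<or> \<epsilon> = -1) \<and> a = \<epsilon> * v1 * v1 \<and> b = \<epsilon> * v1 * v2 \<and> d = \<epsilon> * v2 * v2"
proof -
  have pos: "\<exists>v1 v2. a = v1 * v1 \<and> b = v1 * v2 \<and> d = v2 * v2" if "0 \<le> a" "0 \<le> d" "a * d = b\<^sup>2" for a b d :: real
  proof -
    have "sqrt a * sqrt d = \<bar>b\<bar>" using that(3) by (simp flip: real_sqrt_mult)
    then show ?thesis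
      using that(1,2)
      by (intro exI[of _ "sqrt a"] exI[of _ "if 0 \<le> b then sqrt d else - sqrt d"]) auto
  qed
  have "0 \<le> a * d" using assms by simp
  then consider "0 \<le> a" "0 \<le> d" | "0 \<le> - a" "0 \<le> - d" by (auto simp: zero_le_mult_iff)
  then show ?thesis
  proof cases
    case 1
    from pos[OF this assms] obtain v1 v2 where "a = v1 * v1 \<and> b = v1 * v2 \<and> d = v2 * v2" by blast
    then show ?thesis by (intro exI[of _ 1] exI[of _ v1] exI[of _ v2]) simp
  next
    case 2
    have "- a * - d = (- b)\<^sup>2" using assms by simp
    from pos[OF 2 this] obtain v1 v2 where "- a = v1 * v1 \<and> - b = v1 * v2 \<and> - d = v2 * v2" by blast
    then show ?thesis by (intro exI[of _ "-1"] exI[of _ v1] exI[of _ v2]) auto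
  qed
qed

text \<open>Supplies test vectors that remove one of two rank-one terms while a definite form stays
  positive on them.\<close>

lemma spd_perp:
  assumes "spd \<sigma>"
  shows "\<exists>x y. w1 * x + w2 * y = 0 \<and> 0 < \<sigma> $ 1 $ 1 * x\<^sup>2 + 2 * \<sigma> $ 1 $ 2 * x * y + \<sigma> $ 2 $ 2 * y\<^sup>2"
proof (cases "w1 = 0 \<and> w2 = 0")
  case True
  then show ?thesis using spd_quadratic[OF assms, of 1 0] by (intro exI[of _ 1] exI[of _ 0]) simp
next
  case False
  then show ?thesis
    using spd_quadratic[OF assms, of "- w2" w1] by (intro exI[of _ "- w2"] exI[of _ w1]) auto
qed

text \<open>At a double root the difference \<open>S\<close> would be plus or minus v v^T, and the
  mixed coefficient \<open>k\<close> of the determinant would vanish. Up to sign, \<open>k\<close>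
  is the form of \<open>\<sigma>1\<close> at (-v2, v1), so v = 0 and \<open>\<sigma>2\<close> would
  be a multiple of \<open>\<sigma>1\<close>.\<close>

lemma distinct_roots:
  assumes \<sigma>1: "spd \<sigma>1" and \<sigma>2: "spd \<sigma>2" and nm: "\<And>c. \<sigma>2 \<noteq> c *\<^sub>R \<sigma>1"
    and det1: "0 < det \<sigma>1" and roots: "{t. det (\<sigma>2 - t *\<^sub>R \<sigma>1) = 0} = {l1, l2}"
  shows "l1 \<noteq> l2"
proof
  assume "l1 = l2"
  then have root: "det (\<sigma>2 - t *\<^sub>R \<sigma>1) = 0 \<longleftrightarrow> t = l1" for t using roots by auto
  define S where "S = \<sigma>2 - l1 *\<^sub>R \<sigma>1"
  note s1 = spd_sym[OF \<sigma>1] and s2 = spd_sym[OF \<sigma>2]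
  have sS: "S $ 2 $ 1 = S $ 1 $ 2" by (simp add: S_def s1 s2)
  have dS: "S $ 1 $ 1 * S $ 2 $ 2 = (S $ 1 $ 2)\<^sup>2"
    using root[of l1] sS by (simp add: S_def[symmetric] det_2 power2_eq_square)
  define k where "k = \<sigma>1 $ 1 $ 1 * S $ 2 $ 2 + \<sigma>1 $ 2 $ 2 * S $ 1 $ 1 - 2 * \<sigma>1 $ 1 $ 2 * S $ 1 $ 2"
  have exp: "det (\<sigma>2 - (l1 + u) *\<^sub>R \<sigma>1) = u * (u * det \<sigma>1 - k)" for u
  proof -
    have "\<sigma>2 - (l1 + u) *\<^sub>R \<sigma>1 = S - u *\<^sub>R \<sigma>1" by (simp add: S_def algebra_simps)
    then show ?thesis
      using dS sS by (simp add: det_2 k_def s1 power2_eq_square algebra_simps)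
  qed
  \<comment> \<open>The second zero of the factored determinant; it has to coincide with
    \<open>l1\<close>.\<close>
  have "det (\<sigma>2 - (l1 + k / det \<sigma>1) *\<^sub>R \<sigma>1) = 0" unfolding exp using det1 by simp
  then have "k = 0" unfolding root using det1 by simp
  obtain \<epsilon> v1 v2 where \<epsilon>: "\<epsilon> = 1 \<or> \<epsilon> = -1"
    and S: "S $ 1 $ 1 = \<epsilon> * v1 * v1" "S $ 1 $ 2 = \<epsilon> * v1 * v2" "S $ 2 $ 2 = \<epsilon> * v2 * v2"
    using symmetric_rank_one[OF dS] by blast
  have "k = \<epsilon> * (\<sigma>1 $ 1 $ 1 * (- v2)\<^sup>2 + 2 * \<sigma>1 $ 1 $ 2 * (- v2) * v1 + \<sigma>1 $ 2 $ 2 * v1\<^sup>2)"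
    unfolding k_def S by (simp add: power2_eq_square algebra_simps)
  with \<open>k = 0\<close> \<epsilon> have "\<sigma>1 $ 1 $ 1 * (- v2)\<^sup>2 + 2 * \<sigma>1 $ 1 $ 2 * (- v2) * v1 + \<sigma>1 $ 2 $ 2 * v1\<^sup>2 = 0"
    by auto
  then have "\<not> (- v2 \<noteq> 0 \<or> v1 \<noteq> 0)"
    using spd_quadratic[OF \<sigma>1, of "- v2" v1] by linarith
  then have "S = 0" using S sS by (intro matrix2_eqI) auto
  then show False using nm[of l1] by (simp add: S_def)
qed

text \<open>\<open>S1\<close> and \<open>S2\<close> are singular, hence signed dyads, with \<sigma>1
  = S1 + S2 and \<sigma>2 = l2 S1 + l1 S2. Evaluating both forms at a vector that kills one dyad
  gives the signs and the positivity of the roots.\<close>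

lemma simultaneous_diagonalization:
  assumes \<sigma>1: "spd \<sigma>1" and \<sigma>2: "spd \<sigma>2" and ne: "l1 \<noteq> l2"
    and roots: "{t. det (\<sigma>2 - t *\<^sub>R \<sigma>1) = 0} = {l1, l2}"
  shows "0 < l1 \<and> 0 < l2 \<and> (\<exists>X. \<sigma>1 = transpose X ** X \<and> \<sigma>2 = transpose X ** diag2 l1 l2 ** X)"
proof -
  note s1 = spd_sym[OF \<sigma>1] and s2 = spd_sym[OF \<sigma>2]
  define S1 where "S1 = (1 / (l2 - l1)) *\<^sub>R (\<sigma>2 - l1 *\<^sub>R \<sigma>1)"
  define S2 where "S2 = (1 / (l1 - l2)) *\<^sub>R (\<sigma>2 - l2 *\<^sub>R \<sigma>1)"
  have det_scale: "det (c *\<^sub>R M) = c\<^sup>2 * det M" for c and M :: "real^2^2"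
    by (simp add: det_2 power2_eq_square algebra_simps)
  have sym: "S1 $ 2 $ 1 = S1 $ 1 $ 2" "S2 $ 2 $ 1 = S2 $ 1 $ 2" by (simp_all add: S1_def S2_def s1 s2)
  have "det S1 = 0" "det S2 = 0" using roots by (auto simp: S1_def S2_def det_scale)
  then have dS: "S1 $ 1 $ 1 * S1 $ 2 $ 2 = (S1 $ 1 $ 2)\<^sup>2" "S2 $ 1 $ 1 * S2 $ 2 $ 2 = (S2 $ 1 $ 2)\<^sup>2"
    using sym by (simp_all add: det_2 power2_eq_square)
  define c where "c = 1 / (l2 - l1)"
  have c: "c * (l2 - l1) = 1" "1 / (l1 - l2) = - c" using ne by (simp_all add: c_def field_simps)
  have S: "S1 $ i $ j = c * (\<sigma>2 $ i $ j - l1 * \<sigma>1 $ i $ j)" "S2 $ i $ j = - c * (\<sigma>2 $ i $ j - l2 * \<sigma>1 $ i $ j)" for i j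
    unfolding S1_def S2_def c(2) by (simp_all add: c_def)
  have e1: "\<sigma>1 $ i $ j = S1 $ i $ j + S2 $ i $ j" for i j
    using c(1) unfolding S by algebra
  have e2: "\<sigma>2 $ i $ j = l2 * S1 $ i $ j + l1 * S2 $ i $ j" for i j
    using c(1) unfolding S by algebra
  obtain \<epsilon> w1 w2 where \<epsilon>: "\<epsilon> = 1 \<or> \<epsilon> = -1"
    and W: "S1 $ 1 $ 1 = \<epsilon> * w1 * w1" "S1 $ 1 $ 2 = \<epsilon> * w1 * w2" "S1 $ 2 $ 2 = \<epsilon> * w2 * w2"
    using symmetric_rank_one[OF dS(1)] by blast
  obtain \<eta> v1 v2 where \<eta>: "\<eta> = 1 \<or> \<eta> = -1"
    and V: "S2 $ 1 $ 1 = \<eta> * v1 * v1" "S2 $ 1 $ 2 = \<eta> * v1 * v2" "S2 $ 2 $ 2 = \<eta> * v2 * v2"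
    using symmetric_rank_one[OF dS(2)] by blast
  have q1: "\<sigma>1 $ 1 $ 1 * x\<^sup>2 + 2 * \<sigma>1 $ 1 $ 2 * x * y + \<sigma>1 $ 2 $ 2 * y\<^sup>2
      = \<epsilon> * (w1 * x + w2 * y)\<^sup>2 + \<eta> * (v1 * x + v2 * y)\<^sup>2" for x y
    unfolding e1 W V by (simp add: power2_eq_square algebra_simps)
  have q2: "\<sigma>2 $ 1 $ 1 * x\<^sup>2 + 2 * \<sigma>2 $ 1 $ 2 * x * y + \<sigma>2 $ 2 $ 2 * y\<^sup>2
      = l2 * (\<epsilon> * (w1 * x + w2 * y)\<^sup>2) + l1 * (\<eta> * (v1 * x + v2 * y)\<^sup>2)" for x y
    unfolding e2 W V by (simp add: power2_eq_square algebra_simps)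
  have \<eta>1: "\<eta> = 1"
  proof -
    obtain x y where "w1 * x + w2 * y = 0" "0 < \<sigma>1 $ 1 $ 1 * x\<^sup>2 + 2 * \<sigma>1 $ 1 $ 2 * x * y + \<sigma>1 $ 2 $ 2 * y\<^sup>2"
      using spd_perp[OF \<sigma>1] by blast
    then have "0 < \<eta> * (v1 * x + v2 * y)\<^sup>2" unfolding q1 by simp
    then show ?thesis using \<eta> by (auto simp: zero_less_mult_iff)
  qed
  have \<epsilon>1: "\<epsilon> = 1"
  proof -
    obtain x y where "v1 * x + v2 * y = 0" "0 < \<sigma>1 $ 1 $ 1 * x\<^sup>2 + 2 * \<sigma>1 $ 1 $ 2 * x * y + \<sigma>1 $ 2 $ 2 * y\<^sup>2"
      using spd_perp[OF \<sigma>1] by blast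
    then have "0 < \<epsilon> * (w1 * x + w2 * y)\<^sup>2" unfolding q1 by simp
    then show ?thesis using \<epsilon> by (auto simp: zero_less_mult_iff)
  qed
  have "0 < l1"
  proof -
    obtain x y where "w1 * x + w2 * y = 0" "0 < \<sigma>2 $ 1 $ 1 * x\<^sup>2 + 2 * \<sigma>2 $ 1 $ 2 * x * y + \<sigma>2 $ 2 $ 2 * y\<^sup>2"
      using spd_perp[OF \<sigma>2] by blast
    then have "0 < l1 * (v1 * x + v2 * y)\<^sup>2" unfolding q2 \<eta>1 by simp
    then show ?thesis by (simp add: zero_less_mult_iff)
  qed
  moreover have "0 < l2"
  proof -
    obtain x y where "v1 * x + v2 * y = 0" "0 < \<sigma>2 $ 1 $ 1 * x\<^sup>2 + 2 * \<sigma>2 $ 1 $ 2 * x * y + \<sigma>2 $ 2 $ 2 * y\<^sup>2"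
      using spd_perp[OF \<sigma>2] by blast
    then have "0 < l2 * (w1 * x + w2 * y)\<^sup>2" unfolding q2 \<epsilon>1 by simp
    then show ?thesis by (simp add: zero_less_mult_iff)
  qed
  moreover
  \<comment> \<open>The vector of \<open>S2\<close> comes first because \<open>S2\<close> carries
    \<open>l1\<close> in \<open>\<sigma>2\<close>.\<close>
  define X :: "real^2^2" where "X = vector [vector [v1, v2], vector [w1, w2]]"
  have "\<sigma>1 = transpose X ** X"
    by (rule matrix2_eqI) (simp_all add: X_def matrix_mult_2 transpose_def e1 sym W V \<epsilon>1 \<eta>1)
  moreover have "\<sigma>2 = transpose X ** diag2 l1 l2 ** X"
    by (rule matrix2_eqI) (simp_all add: X_def matrix_mult_2 transpose_def e2 sym W V \<epsilon>1 \<eta>1)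
  ultimately show ?thesis by blast
qed

text \<open>
  The sign of the determinant is free because \<open>diag (1, -1)\<close> commutes with \<open>diag (l1, l2)\<close>.
\<close>

lemma simultaneous_diagonalization_det:
  assumes "\<sigma>1 = transpose X ** X" "\<sigma>2 = transpose X ** diag2 l1 l2 ** X" "d\<^sup>2 = det \<sigma>1"
  shows "\<exists>Y. \<sigma>1 = transpose Y ** Y \<and> \<sigma>2 = transpose Y ** diag2 l1 l2 ** Y \<and> det Y = d"
proof -
  have "(det X)\<^sup>2 = d\<^sup>2" using assms by (simp add: det_mul power2_eq_square)
  then have "det X = d \<or> det X = - d" by (rule power2_eq_iff[THEN iffD1])
  then show ?thesis
  proof
    assume "det X = d"
    then show ?thesis using assms by blast
  next
    assume d: "det X = - d"
    have "transpose (diag2 1 (-1) ** X) ** (diag2 1 (-1) ** X) = transpose X ** X"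
      "transpose (diag2 1 (-1) ** X) ** diag2 l1 l2 ** (diag2 1 (-1) ** X) = transpose X ** diag2 l1 l2 ** X"
      by (rule matrix2_eqI; simp add: matrix_mult_2 transpose_def)+
    moreover have "det (diag2 1 (-1) ** X) = d" using d by (simp add: det_mul)
    ultimately show ?thesis using assms by metis
  qed
qed

section \<open>Congruence of block operators and the final formula\<close>

text \<open>Rests on X^T R X = (det X) R: the congruence acts on the first tensor factor of T, so
  its coefficient is multiplied by det X.\<close>

lemma lift_phase:
  assumes "\<sigma> = transpose X ** D ** X"
  shows "block_apply (isotropic_phase \<sigma> (\<rho> * det X + c)) v
    = lift (transpose X) (block_apply (isotropic_phase D \<rho>) (lift X v)) + c *\<^sub>R block_apply T_op v"
proof -
  have "block_apply (isotropic_phase \<sigma> (\<rho> * det X + c)) v $ i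
    = (lift (transpose X) (block_apply (isotropic_phase D \<rho>) (lift X v)) + c *\<^sub>R block_apply T_op v) $ i" for i
    using exhaust_2[of i] unfolding assms
    by (auto simp: isotropic_phase_apply T_op_apply lift_nth matrix_mult_2 transpose_def det_2 vec_eq_iff
        forall_2 algebra_simps)
  then show ?thesis by (simp add: vec_eq_iff)
qed

text \<open>The product of \<open>kron (transpose X) (mat 1)\<close>, \<open>M\<close> and
  \<open>kron X (mat 1)\<close>, written out in blocks.\<close>

definition conjugate :: "real^2^2 \<Rightarrow> block \<Rightarrow> block" where
  "conjugate X M = (\<chi> i j. (X $ 1 $ i * X $ 1 $ j) *\<^sub>R M $ 1 $ 1 + (X $ 1 $ i * X $ 2 $ j) *\<^sub>R M $ 1 $ 2
      + (X $ 2 $ i * X $ 1 $ j) *\<^sub>R M $ 2 $ 1 + (X $ 2 $ i * X $ 2 $ j) *\<^sub>R M $ 2 $ 2)"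

lemma conjugate_apply:
  "block_apply (conjugate X M) v = lift (transpose X) (block_apply M (lift X v))"
  unfolding conjugate_def
  by (simp add: vec_eq_iff[of "block_apply _ _"] block_apply_nth lift_nth transpose_def
      matrix_vector_mult_add_rdistrib matrix_vector_right_distrib matrix_vector_mult_scaleR
      scaleR_matrix_vector algebra_simps)

lemma block_relations:
  assumes sym: "transpose (M $ 2 $ 1) = M $ 1 $ 2"
    and rel: "\<And>v. block_apply M v $ 2 = S *v (R_perp *v block_apply M v $ 1)"
  shows "M $ 2 $ 1 = S ** R_perp ** M $ 1 $ 1"
    "M $ 1 $ 2 = transpose (S ** R_perp ** M $ 1 $ 1)"
    "M $ 2 $ 2 = S ** R_perp ** transpose (S ** R_perp ** M $ 1 $ 1)"
proof -
  have *: "M $ 2 $ j = S ** R_perp ** M $ 1 $ j" for j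
  proof -
    have "block_apply M (axis j c) $ k = M $ k $ j *v c" for k c
      using exhaust_2[of j] by (auto simp: block_apply_nth axis_def)
    then have "M $ 2 $ j *v c = (S ** R_perp ** M $ 1 $ j) *v c" for c
      using rel[of "axis j c"] by (simp add: matrix_vector_mul_assoc[symmetric])
    then show ?thesis by (simp add: matrix_eq)
  qed
  show "M $ 2 $ 1 = S ** R_perp ** M $ 1 $ 1" by (rule *)
  with sym show t: "M $ 1 $ 2 = transpose (S ** R_perp ** M $ 1 $ 1)" by simp
  show "M $ 2 $ 2 = S ** R_perp ** transpose (S ** R_perp ** M $ 1 $ 1)"
    using *[of 2] by (simp only: t)
qed

text \<open>The left side is det X times X^(-1) diag (-1, 1) X, and \<open>transpose (cof X)\<close>
  is the adjugate det X times X^(-1); in this form the remaining identities are polynomial.\<close>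

lemma inverse_times:
  assumes \<sigma>: "\<sigma> = transpose X ** X" and X: "det X \<noteq> 0" and S: "S = transpose X ** diag2 (-1) 1 ** X"
  shows "det X *\<^sub>R (matrix_inv \<sigma> ** S) = transpose (cof X) ** diag2 (-1) 1 ** X"
proof -
  have "det \<sigma> \<noteq> 0" using X by (simp add: \<sigma> det_mul)
  then have inv: "matrix_inv \<sigma> ** \<sigma> = mat 1"
    unfolding matrix_inv_def using someI_ex[of "\<lambda>B. \<sigma> ** B = mat 1 \<and> B ** \<sigma> = mat 1"]
    by (simp add: invertible_det_nz[symmetric] invertible_def)
  have "\<sigma> ** (transpose (cof X) ** diag2 (-1) 1 ** X) = det X *\<^sub>R S"
    unfolding \<sigma> S by (rule matrix2_eqI; simp add: matrix_mult_2 transpose_def det_2 algebra_simps)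
  then have "matrix_inv \<sigma> ** (\<sigma> ** (transpose (cof X) ** diag2 (-1) 1 ** X)) = matrix_inv \<sigma> ** (det X *\<^sub>R S)"
    by simp
  moreover have "matrix_inv \<sigma> ** (det X *\<^sub>R S) = det X *\<^sub>R (matrix_inv \<sigma> ** S)"
    by (rule matrix2_eqI) (simp_all add: matrix_mult_2 algebra_simps)
  ultimately show ?thesis by (simp add: matrix_mul_assoc inv)
qed

lemma lift_T_op:
  "lift (transpose X) (block_apply T_op (lift X v)) = det X *\<^sub>R block_apply T_op v"
proof -
  have "lift (transpose X) (block_apply T_op (lift X v)) $ i = (det X *\<^sub>R block_apply T_op v) $ i" for i
    using exhaust_2[of i]
    by (auto simp: T_op_apply lift_nth transpose_def det_2 vec_eq_iff forall_2 algebra_simps)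
  then show ?thesis by (simp add: vec_eq_iff)
qed

lemma block_mult_T_op_kron: "block_mult T_op (kron Q B) = kron (R_perp ** Q) (R_perp ** B)"
  by (simp add: vec_eq_iff forall_2 block_mult_def T_op_def kron_def matrix_matrix_mult_def sum_2)

lemma scaleR_kron: "c *\<^sub>R kron Q B = kron (c *\<^sub>R Q) B"
  by (simp add: vec_eq_iff kron_def)

text \<open>For symmetric A, R A R^T = cof A. Hence the lower right block is S cof A S and the lower
  left one is S cof A R. Put B = cof A S - a I. As B is trace-free, R B is symmetric, so the
  off-diagonal blocks are a R - R B (lower) and -a R - R B (upper). The part with a is a T, which
  contributes the summand a det X to the last coefficient; the common part -R B gives the term with
  \<open>Q\<close>.\<close>

lemma conjugate_eq:
  assumes M: "M $ 2 $ 1 = S ** R_perp ** A"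
    "M $ 1 $ 2 = transpose (S ** R_perp ** A)"
    "M $ 2 $ 2 = S ** R_perp ** transpose (S ** R_perp ** A)"
    "M $ 1 $ 1 = A"
    and A: "A $ 2 $ 1 = A $ 1 $ 2" and S: "S $ 2 $ 1 = S $ 1 $ 2"
    and Q: "det X *\<^sub>R Q = transpose (cof X) ** diag2 (-1) 1 ** X"
    and a: "a = 1 / 2 * trace (cof A ** S)"
  shows "conjugate X M + (r - det X) *\<^sub>R T_op
    = kron (transpose X ** diag2 0 1 ** X) (S ** cof A ** S) + kron (transpose X ** diag2 1 0 ** X) A
      + det X *\<^sub>R block_mult T_op (kron Q (cof A ** S - a *\<^sub>R mat 1)) + (r + det X * (a - 1)) *\<^sub>R T_op"
proof -
  have t: "det X *\<^sub>R block_mult T_op (kron Q B)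
      = kron (R_perp ** (transpose (cof X) ** diag2 (-1) 1 ** X)) (R_perp ** B)" for B
  proof -
    have "det X *\<^sub>R (R_perp ** Q) = R_perp ** (det X *\<^sub>R Q)"
      by (rule matrix2_eqI) (simp_all add: matrix_mult_2)
    then show ?thesis by (simp add: block_mult_T_op_kron scaleR_kron Q)
  qed
  have a': "a = 1 / 2 * (A $ 2 $ 2 * S $ 1 $ 1 - 2 * A $ 1 $ 2 * S $ 1 $ 2 + A $ 1 $ 1 * S $ 2 $ 2)"
    unfolding a by (simp add: trace_def sum_2 matrix_mult_2 A S)
  have "(conjugate X M + (r - det X) *\<^sub>R T_op) $ i $ j
    = (kron (transpose X ** diag2 0 1 ** X) (S ** cof A ** S) + kron (transpose X ** diag2 1 0 ** X) A
      + det X *\<^sub>R block_mult T_op (kron Q (cof A ** S - a *\<^sub>R mat 1)) + (r + det X * (a - 1)) *\<^sub>R T_op) $ i $ j" for i j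
    unfolding t
    by (rule matrix2_eqI; insert exhaust_2[of i] exhaust_2[of j];
        auto simp: conjugate_def M kron_def T_op_def matrix_mult_2 transpose_def A S det_2 a' mat_def;
        simp add: field_simps)
  then show ?thesis by (simp add: vec_eq_iff)
qed

text \<open>The quantifier order expresses the dependence: \<open>Lstar\<close> is chosen once the
  microstructure is given and before the moduli, which reach it only as \<open>l1\<close> and
  \<open>l2\<close>. The set equation for the roots admits either order of them.\<close>

theorem mainTheorem10:
  fixes A1 A2 :: "(real^2) set"
  assumes "microstructure A1 A2"
  shows "\<exists>Lstar :: real \<Rightarrow> real \<Rightarrow> real^2^2.
    \<forall>(\<sigma>1 :: real^2^2) (\<sigma>2 :: real^2^2) (r1 :: real) (r2 :: real) (l1 :: real) (l2 :: real).
      spd \<sigma>1 \<and> spd \<sigma>2 \<and> r1\<^sup>2 < det \<sigma>1 \<and> r2\<^sup>2 < det \<sigma>2 \<and>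
      (\<forall>c. \<sigma>2 \<noteq> c *\<^sub>R \<sigma>1) \<and> (\<forall>c. \<sigma>1 \<noteq> c *\<^sub>R \<sigma>2) \<and>
      r1 \<noteq> r2 \<and> \<bar>r1 - r2\<bar> = \<bar>sqrt (det \<sigma>1) - sqrt (det \<sigma>2)\<bar> \<and>
      {t. det (\<sigma>2 - t *\<^sub>R \<sigma>1) = 0} = {l1, l2} \<longrightarrow>
      (let L = Lstar l1 l2;
           S1 = (1 / (l2 - l1)) *\<^sub>R (\<sigma>2 - l1 *\<^sub>R \<sigma>1);
           S2 = (1 / (l1 - l2)) *\<^sub>R (\<sigma>2 - l2 *\<^sub>R \<sigma>1);
           \<sigma>star = \<Sigma>_eff A1 (sqrt (l2 / l1));
           \<alpha> = (sqrt (det \<sigma>1) - sqrt (det \<sigma>2)) / (r1 - r2) * sqrt (det \<sigma>1);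
           astar = 1 / 2 * trace (cof L ** \<sigma>star);
           Astar = cof L ** \<sigma>star - astar *\<^sub>R mat 1;
           \<beta> = r1 + \<alpha> * (astar - 1)
       in spd L \<and>
          effective_tensor (two_phase A1 (isotropic_phase \<sigma>1 r1) (isotropic_phase \<sigma>2 r2)) =
            kron S1 (\<sigma>star ** cof L ** \<sigma>star) + kron S2 L
            + \<alpha> *\<^sub>R block_mult T_op (kron (matrix_inv \<sigma>1 ** (S1 - S2)) Astar)
            + \<beta> *\<^sub>R T_op)"
proof -
  have A1: "A1 \<in> sets lebesgue" using assms by (simp add: microstructure_def)
  define \<delta> where "\<delta> l1 l2 = min 1 (sqrt (l1 * l2))" for l1 l2
  \<comment> \<open>Upper left block of the shifted canonical composite; the phases and the shift
    are functions of \<open>l1\<close> and \<open>l2\<close> alone.\<close>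
  define Lstar where "Lstar l1 l2 = effective_tensor (two_phase A1
      (isotropic_phase (diag2 1 1) (1 - \<delta> l1 l2)) (isotropic_phase (diag2 l1 l2) (sqrt (l1 * l2) - \<delta> l1 l2))) $ 1 $ 1"
    for l1 l2
  show ?thesis
  proof (rule exI[of _ Lstar], intro allI impI, elim conjE)
    fix \<sigma>1 \<sigma>2 :: "real^2^2" and r1 r2 l1 l2 :: real
    assume \<sigma>1: "spd \<sigma>1" and \<sigma>2: "spd \<sigma>2" and d1: "r1\<^sup>2 < det \<sigma>1" and d2: "r2\<^sup>2 < det \<sigma>2"
      and nm: "\<forall>c. \<sigma>2 \<noteq> c *\<^sub>R \<sigma>1" and r12: "r1 \<noteq> r2"
      and rr: "\<bar>r1 - r2\<bar> = \<bar>sqrt (det \<sigma>1) - sqrt (det \<sigma>2)\<bar>"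
      and roots: "{t. det (\<sigma>2 - t *\<^sub>R \<sigma>1) = 0} = {l1, l2}"
    have det1: "0 < det \<sigma>1" using d1 zero_le_power2[of r1] by linarith
    have ne: "l1 \<noteq> l2" using distinct_roots[OF \<sigma>1 \<sigma>2 _ det1 roots] nm by blast
    from simultaneous_diagonalization[OF \<sigma>1 \<sigma>2 ne roots]
    obtain X0 where l: "0 < l1" "0 < l2" and X0: "\<sigma>1 = transpose X0 ** X0" "\<sigma>2 = transpose X0 ** diag2 l1 l2 ** X0"
      by blast
    define s where "s = sqrt (l1 * l2)"
    define D where "D = sqrt (det \<sigma>1)"
    have s: "0 < s" using l by (simp add: s_def)
    have D: "0 < D" "D\<^sup>2 = det \<sigma>1" using det1 by (simp_all add: D_def)
    have "det \<sigma>2 = det \<sigma>1 * (l1 * l2)" unfolding X0 by (simp add: det_mul)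
    then have D2: "sqrt (det \<sigma>2) = D * s" by (simp add: D_def s_def real_sqrt_mult)
    have rr': "\<bar>r1 - r2\<bar> = D * \<bar>1 - s\<bar>"
    proof -
      have "\<bar>D - D * s\<bar> = \<bar>D * (1 - s)\<bar>" by (simp add: right_diff_distrib)
      also have "\<dots> = D * \<bar>1 - s\<bar>" using D by (simp add: abs_mult)
      finally show ?thesis using rr by (simp add: D2 flip: D_def)
    qed
    have s1: "1 - s \<noteq> 0" using rr' r12 by auto
    \<comment> \<open>The determinant forced by r1 = d + c and r2 = s d + c.\<close>
    define d where "d = (r1 - r2) / (1 - s)"
    have rd: "r1 - r2 = (1 - s) * d" using s1 by (simp add: d_def)
    \<comment> \<open>Here the hypothesis on |r1 - r2| enters: it makes \<open>d\<close> an
      admissible determinant for a factor of \<open>\<sigma>1\<close>.\<close>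
    have "\<bar>d\<bar> = D" using rr' s1 by (simp add: d_def)
    then have "d\<^sup>2 = det \<sigma>1" using D(2) by (metis power2_abs)
    from simultaneous_diagonalization_det[OF X0 this]
    obtain X where X: "\<sigma>1 = transpose X ** X" "\<sigma>2 = transpose X ** diag2 l1 l2 ** X" and dX: "det X = d" by blast
    have d0: "d \<noteq> 0" using rd r12 by auto
    have \<alpha>: "(sqrt (det \<sigma>1) - sqrt (det \<sigma>2)) / (r1 - r2) * sqrt (det \<sigma>1) = det X"
    proof -
      have "(D - D * s) / ((1 - s) * d) * D = D\<^sup>2 * (1 - s) / ((1 - s) * d)"
        by (simp add: power2_eq_square algebra_simps)
      also have "\<dots> = d"
        unfolding D(2) \<open>d\<^sup>2 = det \<sigma>1\<close>[symmetric] using s1 d0 by (simp add: power2_eq_square)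
      finally show ?thesis by (simp add: D2 rd dX flip: D_def)
    qed
    define e where "e = \<delta> l1 l2"
    interpret canonical_composite A1 l1 l2 e
      by unfold_locales (use A1 l in \<open>auto simp: e_def \<delta>_def\<close>)
    have Ls: "Lstar l1 l2 = effective_tensor L $ 1 $ 1"
      by (simp add: Lstar_def e_def)
    interpret P: coercive_composite A1 "isotropic_phase \<sigma>1 r1" "isotropic_phase \<sigma>2 r2"
      by unfold_locales (intro A1 isotropic_phase_sym_posdef \<sigma>1 \<sigma>2 d1 d2)+
    let ?S = "\<Sigma>_eff A1 (sqrt (l2 / l1))"
    let ?M = "conjugate X M0 + (r1 - det X) *\<^sub>R T_op"
    \<comment> \<open>The total multiple of \<open>T_op\<close> to be added after the congruence,
      given that the shifted canonical phases carry the coefficients \<open>1 - e\<close> and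
      \<open>s - e\<close>.\<close>
    define c where "c = r1 - (1 - e) * d"
    have r: "r1 = (1 - e) * det X + c" "r2 = (s - e) * det X + c"
      using rd by (simp_all add: c_def dX algebra_simps)
    have \<sigma>1': "\<sigma>1 = transpose X ** diag2 1 1 ** X"
      unfolding X(1) by (rule matrix2_eqI) (simp_all add: matrix_mult_2)
    have "is_effective_tensor P.L ?M"
    proof (rule effective_tensor_transform[OF is_effective_tensor])
      show "invertible X" using d0 dX by (simp add: invertible_det_nz)
      show "block_apply (P.L x) v = lift (transpose X) (block_apply (L x) (lift X v)) + c *\<^sub>R block_apply T_op v" for x v
        using lift_phase[OF \<sigma>1', of "1 - e" c v] lift_phase[OF X(2), of "s - e" c v]
        unfolding r[symmetric] by (simp add: two_phase_def s_def)
      show "block_apply ?M v = lift (transpose X) (block_apply (effective_tensor L) (lift X v)) + c *\<^sub>R block_apply T_op v" for v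
      proof -
        have "block_apply (conjugate X M0) v = lift (transpose X) (block_apply M0 (lift X v))"
          by (rule conjugate_apply)
        also have "\<dots> = lift (transpose X) (block_apply (effective_tensor L) (lift X v)) + (e * d) *\<^sub>R block_apply T_op v"
          using lift_T_op[of X v]
          by (simp add: block_apply_add_left block_apply_scale_left linear_simps[OF lift_bounded_linear] dX)
        finally show ?thesis
          unfolding block_apply_add_left[of "conjugate X M0"] block_apply_scale_left
          by (simp add: c_def dX algebra_simps)
      qed
    qed
    then have eff: "effective_tensor P.L = ?M" by (rule P.effective_tensor_eqI)
    have S1: "(1 / (l2 - l1)) *\<^sub>R (\<sigma>2 - l1 *\<^sub>R \<sigma>1) = transpose X ** diag2 0 1 ** X"
    proof -
      have "\<sigma>2 - l1 *\<^sub>R \<sigma>1 = (l2 - l1) *\<^sub>R (transpose X ** diag2 0 1 ** X)"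
        unfolding X by (rule matrix2_eqI) (simp_all add: matrix_mult_2 algebra_simps)
      then show ?thesis using ne by simp
    qed
    have S2: "(1 / (l1 - l2)) *\<^sub>R (\<sigma>2 - l2 *\<^sub>R \<sigma>1) = transpose X ** diag2 1 0 ** X"
    proof -
      have "\<sigma>2 - l2 *\<^sub>R \<sigma>1 = (l1 - l2) *\<^sub>R (transpose X ** diag2 1 0 ** X)"
        unfolding X by (rule matrix2_eqI) (simp_all add: matrix_mult_2 algebra_simps)
      then show ?thesis using ne by simp
    qed
    have S12: "transpose X ** diag2 0 1 ** X - transpose X ** diag2 1 0 ** X = transpose X ** diag2 (-1) 1 ** X"
      by (rule matrix2_eqI) (simp_all add: matrix_mult_2 algebra_simps)
    note Q = inverse_times[OF X(1) _ refl, unfolded dX, OF d0, folded dX]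
    have symM: "transpose (M0 $ 2 $ 1) = M0 $ 1 $ 2"
    proof -
      have "transpose (T_op $ 2 $ 1) = T_op $ 1 $ 2"
        by (rule matrix2_eqI) (simp_all add: T_op_def kron_def transpose_def)
      moreover have "transpose (M0 $ 2 $ 1) = transpose (effective_tensor L $ 2 $ 1) + e *\<^sub>R transpose (T_op $ 2 $ 1)"
        by (rule matrix2_eqI) (simp_all add: transpose_def)
      ultimately show ?thesis
        using sym_posdef_block(2)[OF effective_tensor_sym_posdef] by simp
    qed
    note rel = block_relations[OF symM conductivity_relation(2), unfolded M0_11]
    have symS: "?S $ 2 $ 1 = ?S $ 1 $ 2"
      using conductivity_relation(1) by (simp add: transpose_def vec_eq_iff)
    show "let L = Lstar l1 l2;
           S1 = (1 / (l2 - l1)) *\<^sub>R (\<sigma>2 - l1 *\<^sub>R \<sigma>1);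
           S2 = (1 / (l1 - l2)) *\<^sub>R (\<sigma>2 - l2 *\<^sub>R \<sigma>1);
           \<sigma>star = \<Sigma>_eff A1 (sqrt (l2 / l1));
           \<alpha> = (sqrt (det \<sigma>1) - sqrt (det \<sigma>2)) / (r1 - r2) * sqrt (det \<sigma>1);
           astar = 1 / 2 * trace (cof L ** \<sigma>star);
           Astar = cof L ** \<sigma>star - astar *\<^sub>R mat 1;
           \<beta> = r1 + \<alpha> * (astar - 1)
       in spd L \<and>
          effective_tensor (two_phase A1 (isotropic_phase \<sigma>1 r1) (isotropic_phase \<sigma>2 r2)) =
            kron S1 (\<sigma>star ** cof L ** \<sigma>star) + kron S2 L
            + \<alpha> *\<^sub>R block_mult T_op (kron (matrix_inv \<sigma>1 ** (S1 - S2)) Astar)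
            + \<beta> *\<^sub>R T_op"
      unfolding Let_def \<alpha> S1 S2 S12 Ls eff
      by (intro conjI spd_block
          conjugate_eq[OF rel M0_11 spd_sym[OF spd_block] symS Q refl])
  qed
qed

end
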